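(* Let $\mathcal{E}$ be a locally cartesian closed category with a chosen object $I$, and let $\mathcal{T}$ be a class of morphisms of $\mathcal{E}$, called trivial fibrations, such that: (1) every trivial fibration has a section; (2) trivial fibrations are stable under pushforward when considered as arrows in a slice category: for every morphism $p\colon A\to X$ and every morphism $r\colon (qr\colon C\to A)\to (q\colon B\to A)$ of $\mathcal{E}/A$ whose underlying map $r\colon C\to B$ is a trivial fibration, the underlying map $p_*r\colon \Pi_A C\to \Pi_A B$ of its image under $p_*\colon \mathcal{E}/A\to\mathcal{E}/X$ is a trivial fibration; (3) trivial fibrations are stable under retract in the arrow category of $\mathcal{E}$. Call a map $p\colon A\to X$ a fibration if the map $\delta\Rightarrow p\colon A^I\times I\to A_\epsilon$ is a trivial fibration. Then fibrations are closed under pushforward along fibrations: if $p\colon A\to X$ and $q\colon B\to A$ are fibrations, then $p_*q\colon \Pi_A B\to X$ is a fibration.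
   Context: A locally cartesian closed category is a category with finite limits all of whose slices are cartesian closed. Every $p\colon A\to X$ yields adjoint functors $p_!\dashv p^*\dashv p_*$ between $\mathcal{E}/A$ and $\mathcal{E}/X$, where $p_!$ is composition with $p$, $p^*$ is pullback along $p$, and $p_*\colon\mathcal{E}/A\to\mathcal{E}/X$ is pushforward. For $q\colon B\to A$, the object $p_*q$ of $\mathcal{E}/X$ is written $p_*q\colon\Pi_AB\to X$. For an object $X$, $\epsilon\colon X^I\times I\to X$ denotes the evaluation map (the counit of $-\times I\dashv (-)^I$). Given $p\colon A\to X$, let $A_\epsilon$ be the pullback of $p\colon A\to X$ along $\epsilon\colon X^I\times I\to X$. The map $\delta\Rightarrow p\colon A^I\times I\to A_\epsilon$ is the map induced, via the universal property of the pullback, by $p^I\times I\colon A^I\times I\to X^I\times I$ and $\epsilon\colon A^I\times I\to A$ (these agree in $X$ by naturality of evaluation). *)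

theory Defs
  imports Main
begin

section \<open>Categories, functors, adjunctions\<close>

record ('o, 'm) category =
  Obj :: "'o set"
  Arr :: "'m set"
  Dom :: "'m \<Rightarrow> 'o"
  Cod :: "'m \<Rightarrow> 'o"
  Ident :: "'o \<Rightarrow> 'm"
  Comp :: "'m \<Rightarrow> 'm \<Rightarrow> 'm" (infixr "\<cdot>\<index>" 70)

definition hom :: "('o, 'm) category \<Rightarrow> 'o \<Rightarrow> 'o \<Rightarrow> 'm set" where
  "hom C a b = {f \<in> Arr C. Dom C f = a \<and> Cod C f = b}"

locale category =
  fixes C :: "('o, 'm) category" (structure)
  assumes Dom_Obj: "f \<in> Arr C \<Longrightarrow> Dom C f \<in> Obj C"
    and Cod_Obj: "f \<in> Arr C \<Longrightarrow> Cod C f \<in> Obj C"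
    and Ident_hom: "a \<in> Obj C \<Longrightarrow> Ident C a \<in> hom C a a"
    and Comp_hom: "\<lbrakk>f \<in> hom C a b; g \<in> hom C b c\<rbrakk> \<Longrightarrow> g \<cdot> f \<in> hom C a c"
    and Comp_Ident_left: "f \<in> hom C a b \<Longrightarrow> Ident C b \<cdot> f = f"
    and Comp_Ident_right: "f \<in> hom C a b \<Longrightarrow> f \<cdot> Ident C a = f"
    and Comp_assoc:
      "\<lbrakk>f \<in> hom C a b; g \<in> hom C b c; h \<in> hom C c d\<rbrakk> \<Longrightarrow> (h \<cdot> g) \<cdot> f = h \<cdot> (g \<cdot> f)"

record ('o, 'm, 'p, 'n) functor_data =
  omap :: "'o \<Rightarrow> 'p"
  amap :: "'m \<Rightarrow> 'n"

definition is_functor ::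
  "('o, 'm) category \<Rightarrow> ('p, 'n) category \<Rightarrow> ('o, 'm, 'p, 'n) functor_data \<Rightarrow> bool" where
  "is_functor C D F \<longleftrightarrow>
     (\<forall>a\<in>Obj C. omap F a \<in> Obj D) \<and>
     (\<forall>f\<in>Arr C. amap F f \<in> hom D (omap F (Dom C f)) (omap F (Cod C f))) \<and>
     (\<forall>a\<in>Obj C. amap F (Ident C a) = Ident D (omap F a)) \<and>
     (\<forall>f\<in>Arr C. \<forall>g\<in>Arr C. Cod C f = Dom C g \<longrightarrow>
        amap F (g \<cdot>\<^bsub>C\<^esub> f) = amap F g \<cdot>\<^bsub>D\<^esub> amap F f)"

text \<open>\<open>F \<stileturn> G\<close> with counit \<open>\<epsilon>\<close>: a natural transformation \<open>F G \<Rightarrow> 1\<close> each of whose components is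
  a universal arrow from \<open>F\<close>.\<close>

definition adjunction ::
  "('o, 'm) category \<Rightarrow> ('p, 'n) category \<Rightarrow> ('o, 'm, 'p, 'n) functor_data \<Rightarrow>
   ('p, 'n, 'o, 'm) functor_data \<Rightarrow> ('p \<Rightarrow> 'n) \<Rightarrow> bool" where
  "adjunction C D F G \<epsilon> \<longleftrightarrow>
     is_functor C D F \<and> is_functor D C G \<and>
     (\<forall>y\<in>Obj D. \<epsilon> y \<in> hom D (omap F (omap G y)) y) \<and>
     (\<forall>f\<in>Arr D. f \<cdot>\<^bsub>D\<^esub> \<epsilon> (Dom D f) = \<epsilon> (Cod D f) \<cdot>\<^bsub>D\<^esub> amap F (amap G f)) \<and>
     (\<forall>x\<in>Obj C. \<forall>y\<in>Obj D. \<forall>f\<in>hom D (omap F x) y.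
        \<exists>!g. g \<in> hom C x (omap G y) \<and> \<epsilon> y \<cdot>\<^bsub>D\<^esub> amap F g = f)"

text \<open>Right adjoints, and below products and pullbacks, are only determined up to isomorphism;
  one is chosen. The value is meaningful only where one exists.\<close>

definition right_adjoint ::
  "('o, 'm) category \<Rightarrow> ('p, 'n) category \<Rightarrow> ('o, 'm, 'p, 'n) functor_data \<Rightarrow>
   ('p, 'n, 'o, 'm) functor_data \<times> ('p \<Rightarrow> 'n)" where
  "right_adjoint C D F = (SOME (G, \<epsilon>). adjunction C D F G \<epsilon>)"


section \<open>Limits\<close>

definition is_cone ::
  "('j, 'k) category \<Rightarrow> ('o, 'm) category \<Rightarrow> ('j, 'k, 'o, 'm) functor_data \<Rightarrow>
   'o \<Rightarrow> ('j \<Rightarrow> 'm) \<Rightarrow> bool" where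
  "is_cone J C D L \<pi> \<longleftrightarrow>
     L \<in> Obj C \<and> (\<forall>j\<in>Obj J. \<pi> j \<in> hom C L (omap D j)) \<and>
     (\<forall>u\<in>Arr J. amap D u \<cdot>\<^bsub>C\<^esub> \<pi> (Dom J u) = \<pi> (Cod J u))"

definition is_limit ::
  "('j, 'k) category \<Rightarrow> ('o, 'm) category \<Rightarrow> ('j, 'k, 'o, 'm) functor_data \<Rightarrow>
   'o \<Rightarrow> ('j \<Rightarrow> 'm) \<Rightarrow> bool" where
  "is_limit J C D L \<pi> \<longleftrightarrow>
     is_cone J C D L \<pi> \<and>
     (\<forall>M \<rho>. is_cone J C D M \<rho> \<longrightarrow>
        (\<exists>!h. h \<in> hom C M L \<and> (\<forall>j\<in>Obj J. \<pi> j \<cdot>\<^bsub>C\<^esub> h = \<rho> j)))"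

text \<open>Every finite category is isomorphic to one whose objects and arrows are natural numbers,
  so these index categories suffice.\<close>

definition has_finite_limits :: "('o, 'm) category \<Rightarrow> bool" where
  "has_finite_limits C \<longleftrightarrow>
     (\<forall>(J :: (nat, nat) category) D.
        category J \<and> finite (Obj J) \<and> finite (Arr J) \<and> is_functor J C D \<longrightarrow>
        (\<exists>L \<pi>. is_limit J C D L \<pi>))"

definition is_terminal :: "('o, 'm) category \<Rightarrow> 'o \<Rightarrow> bool" where
  "is_terminal C t \<longleftrightarrow> t \<in> Obj C \<and> (\<forall>a\<in>Obj C. \<exists>!f. f \<in> hom C a t)"

definition is_product ::
  "('o, 'm) category \<Rightarrow> 'o \<Rightarrow> 'o \<Rightarrow> 'o \<Rightarrow> 'm \<Rightarrow> 'm \<Rightarrow> bool" where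
  "is_product C a b P \<pi>\<^sub>1 \<pi>\<^sub>2 \<longleftrightarrow>
     P \<in> Obj C \<and> \<pi>\<^sub>1 \<in> hom C P a \<and> \<pi>\<^sub>2 \<in> hom C P b \<and>
     (\<forall>c\<in>Obj C. \<forall>f\<in>hom C c a. \<forall>g\<in>hom C c b.
        \<exists>!h. h \<in> hom C c P \<and> \<pi>\<^sub>1 \<cdot>\<^bsub>C\<^esub> h = f \<and> \<pi>\<^sub>2 \<cdot>\<^bsub>C\<^esub> h = g)"

definition product :: "('o, 'm) category \<Rightarrow> 'o \<Rightarrow> 'o \<Rightarrow> 'o \<times> 'm \<times> 'm" where
  "product C a b = (SOME (P, \<pi>\<^sub>1, \<pi>\<^sub>2). is_product C a b P \<pi>\<^sub>1 \<pi>\<^sub>2)"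

definition prod_obj :: "('o, 'm) category \<Rightarrow> 'o \<Rightarrow> 'o \<Rightarrow> 'o" where
  "prod_obj C a b = fst (product C a b)"

definition prod_proj1 :: "('o, 'm) category \<Rightarrow> 'o \<Rightarrow> 'o \<Rightarrow> 'm" where
  "prod_proj1 C a b = fst (snd (product C a b))"

definition prod_proj2 :: "('o, 'm) category \<Rightarrow> 'o \<Rightarrow> 'o \<Rightarrow> 'm" where
  "prod_proj2 C a b = snd (snd (product C a b))"

definition prod_pair ::
  "('o, 'm) category \<Rightarrow> 'o \<Rightarrow> 'o \<Rightarrow> 'm \<Rightarrow> 'm \<Rightarrow> 'm" where
  "prod_pair C a b f g =
     (THE h. h \<in> hom C (Dom C f) (prod_obj C a b) \<and>
        prod_proj1 C a b \<cdot>\<^bsub>C\<^esub> h = f \<and> prod_proj2 C a b \<cdot>\<^bsub>C\<^esub> h = g)"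

text \<open>The functor \<open>- \<times> b\<close>.\<close>

definition prod_functor ::
  "('o, 'm) category \<Rightarrow> 'o \<Rightarrow> ('o, 'm, 'o, 'm) functor_data" where
  "prod_functor C b =
     \<lparr>omap = (\<lambda>a. prod_obj C a b),
      amap = (\<lambda>f. prod_pair C (Cod C f) b
        (f \<cdot>\<^bsub>C\<^esub> prod_proj1 C (Dom C f) b) (prod_proj2 C (Dom C f) b))\<rparr>"

definition is_pullback ::
  "('o, 'm) category \<Rightarrow> 'm \<Rightarrow> 'm \<Rightarrow> 'o \<Rightarrow> 'm \<Rightarrow> 'm \<Rightarrow> bool" where
  "is_pullback C f g P \<pi>\<^sub>1 \<pi>\<^sub>2 \<longleftrightarrow>
     P \<in> Obj C \<and> \<pi>\<^sub>1 \<in> hom C P (Dom C f) \<and> \<pi>\<^sub>2 \<in> hom C P (Dom C g) \<and>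
     f \<cdot>\<^bsub>C\<^esub> \<pi>\<^sub>1 = g \<cdot>\<^bsub>C\<^esub> \<pi>\<^sub>2 \<and>
     (\<forall>c\<in>Obj C. \<forall>u\<in>hom C c (Dom C f). \<forall>v\<in>hom C c (Dom C g).
        f \<cdot>\<^bsub>C\<^esub> u = g \<cdot>\<^bsub>C\<^esub> v \<longrightarrow>
        (\<exists>!h. h \<in> hom C c P \<and> \<pi>\<^sub>1 \<cdot>\<^bsub>C\<^esub> h = u \<and> \<pi>\<^sub>2 \<cdot>\<^bsub>C\<^esub> h = v))"

definition pullback :: "('o, 'm) category \<Rightarrow> 'm \<Rightarrow> 'm \<Rightarrow> 'o \<times> 'm \<times> 'm" where
  "pullback C f g = (SOME (P, \<pi>\<^sub>1, \<pi>\<^sub>2). is_pullback C f g P \<pi>\<^sub>1 \<pi>\<^sub>2)"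

definition pb_obj :: "('o, 'm) category \<Rightarrow> 'm \<Rightarrow> 'm \<Rightarrow> 'o" where
  "pb_obj C f g = fst (pullback C f g)"

definition pb_proj1 :: "('o, 'm) category \<Rightarrow> 'm \<Rightarrow> 'm \<Rightarrow> 'm" where
  "pb_proj1 C f g = fst (snd (pullback C f g))"

definition pb_proj2 :: "('o, 'm) category \<Rightarrow> 'm \<Rightarrow> 'm \<Rightarrow> 'm" where
  "pb_proj2 C f g = snd (snd (pullback C f g))"

definition pb_pair ::
  "('o, 'm) category \<Rightarrow> 'm \<Rightarrow> 'm \<Rightarrow> 'm \<Rightarrow> 'm \<Rightarrow> 'm" where
  "pb_pair C f g u v =
     (THE h. h \<in> hom C (Dom C u) (pb_obj C f g) \<and>
        pb_proj1 C f g \<cdot>\<^bsub>C\<^esub> h = u \<and> pb_proj2 C f g \<cdot>\<^bsub>C\<^esub> h = v)"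


section \<open>Slices and locally cartesian closed categories\<close>

text \<open>The objects of the slice over \<open>X\<close> are the arrows with codomain \<open>X\<close>. The pair \<open>(r, q)\<close> stands
  for the arrow \<open>r : q r \<rightarrow> q\<close> of the slice, whose domain \<open>q r\<close> is determined by \<open>r\<close> and \<open>q\<close>; its
  underlying map is the first component.\<close>

definition slice :: "('o, 'm) category \<Rightarrow> 'o \<Rightarrow> ('m, 'm \<times> 'm) category" where
  "slice C X =
     \<lparr>Obj = {q \<in> Arr C. Cod C q = X},
      Arr = {(r, q). r \<in> Arr C \<and> q \<in> Arr C \<and> Cod C q = X \<and> Cod C r = Dom C q},
      Dom = (\<lambda>(r, q). q \<cdot>\<^bsub>C\<^esub> r),
      Cod = snd,
      Ident = (\<lambda>q. (Ident C (Dom C q), q)),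
      Comp = (\<lambda>(s, q) (r, _). (s \<cdot>\<^bsub>C\<^esub> r, q))\<rparr>"

definition cartesian_closed :: "('o, 'm) category \<Rightarrow> bool" where
  "cartesian_closed C \<longleftrightarrow>
     category C \<and>
     (\<exists>t. is_terminal C t) \<and>
     (\<forall>a\<in>Obj C. \<forall>b\<in>Obj C. \<exists>P \<pi>\<^sub>1 \<pi>\<^sub>2. is_product C a b P \<pi>\<^sub>1 \<pi>\<^sub>2) \<and>
     (\<forall>b\<in>Obj C. \<exists>G \<epsilon>. adjunction C C (prod_functor C b) G \<epsilon>)"

definition locally_cartesian_closed :: "('o, 'm) category \<Rightarrow> bool" where
  "locally_cartesian_closed C \<longleftrightarrow>
     category C \<and> has_finite_limits C \<and> (\<forall>X\<in>Obj C. cartesian_closed (slice C X))"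

text \<open>\<open>p\<^sup>* : C/X \<rightarrow> C/A\<close> for \<open>p : A \<rightarrow> X\<close>.\<close>

definition pullback_functor ::
  "('o, 'm) category \<Rightarrow> 'm \<Rightarrow> ('m, 'm \<times> 'm, 'm, 'm \<times> 'm) functor_data" where
  "pullback_functor C p =
     \<lparr>omap = (\<lambda>y. pb_proj1 C p y),
      amap = (\<lambda>(r, y).
        (pb_pair C p y (pb_proj1 C p (y \<cdot>\<^bsub>C\<^esub> r)) (r \<cdot>\<^bsub>C\<^esub> pb_proj2 C p (y \<cdot>\<^bsub>C\<^esub> r)),
         pb_proj1 C p y))\<rparr>"

text \<open>\<open>p\<^sub>* : C/A \<rightarrow> C/X\<close>. On an object \<open>q : B \<rightarrow> A\<close> its value is the arrow \<open>p\<^sub>* q : \<Pi>\<^sub>A B \<rightarrow> X\<close>.\<close>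

definition pushforward ::
  "('o, 'm) category \<Rightarrow> 'm \<Rightarrow> ('m, 'm \<times> 'm, 'm, 'm \<times> 'm) functor_data" where
  "pushforward C p =
     fst (right_adjoint (slice C (Cod C p)) (slice C (Dom C p)) (pullback_functor C p))"


section \<open>Fibrations\<close>

definition exp_functor ::
  "('o, 'm) category \<Rightarrow> 'o \<Rightarrow> ('o, 'm, 'o, 'm) functor_data" where
  "exp_functor C I = fst (right_adjoint C C (prod_functor C I))"

definition eval_map :: "('o, 'm) category \<Rightarrow> 'o \<Rightarrow> 'o \<Rightarrow> 'm" where
  "eval_map C I = snd (right_adjoint C C (prod_functor C I))"

text \<open>\<open>\<delta> \<Rightarrow> p : A\<^sup>I \<times> I \<rightarrow> A\<^sub>\<epsilon>\<close>, where \<open>A\<^sub>\<epsilon>\<close> is the pullback of \<open>\<epsilon> : X\<^sup>I \<times> I \<rightarrow> X\<close> and \<open>p : A \<rightarrow> X\<close>.\<close>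

definition delta_imp :: "('o, 'm) category \<Rightarrow> 'o \<Rightarrow> 'm \<Rightarrow> 'm" where
  "delta_imp C I p =
     pb_pair C (eval_map C I (Cod C p)) p
       (amap (prod_functor C I) (amap (exp_functor C I) p))
       (eval_map C I (Dom C p))"

definition fibration :: "('o, 'm) category \<Rightarrow> 'o \<Rightarrow> 'm set \<Rightarrow> 'm \<Rightarrow> bool" where
  "fibration C I T p \<longleftrightarrow> p \<in> Arr C \<and> delta_imp C I p \<in> T"

definition has_section :: "('o, 'm) category \<Rightarrow> 'm \<Rightarrow> bool" where
  "has_section C f \<longleftrightarrow>
     (\<exists>s\<in>hom C (Cod C f) (Dom C f). f \<cdot>\<^bsub>C\<^esub> s = Ident C (Cod C f))"

text \<open>\<open>g\<close> is a retract of \<open>f\<close> in the arrow category.\<close>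

definition arrow_retract :: "('o, 'm) category \<Rightarrow> 'm \<Rightarrow> 'm \<Rightarrow> bool" where
  "arrow_retract C g f \<longleftrightarrow>
     g \<in> Arr C \<and> f \<in> Arr C \<and>
     (\<exists>i\<in>hom C (Dom C g) (Dom C f). \<exists>j\<in>hom C (Cod C g) (Cod C f).
      \<exists>r\<in>hom C (Dom C f) (Dom C g). \<exists>s\<in>hom C (Cod C f) (Cod C g).
        f \<cdot>\<^bsub>C\<^esub> i = j \<cdot>\<^bsub>C\<^esub> g \<and> g \<cdot>\<^bsub>C\<^esub> r = s \<cdot>\<^bsub>C\<^esub> f \<and>
        r \<cdot>\<^bsub>C\<^esub> i = Ident C (Dom C g) \<and> s \<cdot>\<^bsub>C\<^esub> j = Ident C (Cod C g))"

end

theory Submission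
  imports Defs
begin

text \<open>In the internal language, over \<open>(x, i)\<close> in \<open>X\<^sup>I \<times> I\<close>, the map \<open>\<delta> \<Rightarrow> p\<^sub>*q\<close>
  sends a family \<open>g\<close> of sections \<open>g j \<in> \<Pi> (a \<in> A (x j)). B a\<close> to \<open>g i\<close>. Pushing the trivial fibration
  \<open>\<delta> \<Rightarrow> q\<close> forward along \<open>p\<^sup>I \<times> I : A\<^sup>I \<times> I \<rightarrow> X\<^sup>I \<times> I\<close> gives a trivial fibration \<open>t\<close> which sends a
  function \<open>h\<close>, assigning to each path \<open>a\<close> over \<open>x\<close> a path \<open>h a\<close> over \<open>a\<close>, to \<open>a \<mapsto> h a i\<close>. Let \<open>s\<close> be a
  section of \<open>\<delta> \<Rightarrow> p\<close>, so that \<open>s (x, j, a)\<close> is a path over \<open>x\<close> with value \<open>a\<close> at \<open>j\<close>. Then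
  \<open>\<delta> \<Rightarrow> p\<^sub>*q\<close> is a retract of \<open>t\<close>: on domains by \<open>g \<mapsto> (a \<mapsto> j \<mapsto> g j (a j))\<close> and
  \<open>h \<mapsto> (j \<mapsto> a \<mapsto> h (s (x, j, a)) j)\<close>, on codomains by \<open>k \<mapsto> (a \<mapsto> k (a i))\<close> and
  \<open>k \<mapsto> (a \<mapsto> k (s (x, i, a)))\<close>. These maps and identities are expressed with generalised elements:
  evaluation of a path and application of a section are operations on arrows that are natural
  in the stage.\<close>


section \<open>Categories, adjunctions and products\<close>

text \<open>Products, pullbacks and right adjoints are chosen by \<open>SOME\<close>, so existence
  has to be proved before anything can be computed: pullbacks are products in a slice, exponentials
  are those of the slice over a terminal object, and the right adjoint of pullback is cut out of
  slice exponentials. Both retraction identities rest on one fact: the lifted path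
  \<open>s (x, j, a)\<close> has value \<open>a\<close> at \<open>j\<close>. It turns
  \<open>g j (s (x, j, a) j)\<close> into \<open>g j a\<close>, and on codomains
  \<open>k (s (x, i, a) i)\<close> into \<open>k a\<close>. The square of the two retractions
  commutes because \<open>j\<close> becomes \<open>i\<close> there. The obstacle: on domains the
  lift is taken at an arbitrary \<open>j\<close>, whereas a section over
  \<open>p^I \<times> I\<close> accepts only arguments over the fixed pair \<open>(x, i)\<close>.
  Since \<open>p^I \<times> I\<close> leaves the \<open>I\<close>-component alone, the lifted path
  may be paired with \<open>i\<close> in place of \<open>j\<close>. Equations between arrows are
  tested on components, values and applications. Each construction is made at a generic element,
  from which naturality carries its formula to every stage.\<close>

lemma in_hom_iff: "f \<in> hom C a b \<longleftrightarrow> f \<in> Arr C \<and> Dom C f = a \<and> Cod C f = b"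
  by (auto simp: hom_def)

lemma some_triple:
  fixes P :: "'a \<Rightarrow> 'b \<Rightarrow> 'c \<Rightarrow> bool"
  defines "t \<equiv> SOME (x, y, z). P x y z"
  assumes "\<exists>x y z. P x y z"
  shows "P (fst t) (fst (snd t)) (snd (snd t))"
proof -
  have "\<exists>t. P (fst t) (fst (snd t)) (snd (snd t))"
    using assms(2) by auto
  from someI_ex[OF this] show ?thesis
    by (simp add: t_def case_prod_unfold)
qed

context category
begin

lemma comp_typing [simp]:
  assumes "f \<in> Arr C" "g \<in> Arr C" "Cod C f = Dom C g"
  shows "g \<cdot> f \<in> Arr C" "Dom C (g \<cdot> f) = Dom C f" "Cod C (g \<cdot> f) = Cod C g"
  using Comp_hom[of f "Dom C f" "Dom C g" g "Cod C g"] assms by (auto simp: in_hom_iff)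

lemma Ident_typing [simp]:
  assumes "a \<in> Obj C"
  shows "Ident C a \<in> Arr C" "Dom C (Ident C a) = a" "Cod C (Ident C a) = a"
  using Ident_hom[OF assms] by (auto simp: in_hom_iff)

lemma comp_assoc [simp]:
  assumes "f \<in> Arr C" "g \<in> Arr C" "h \<in> Arr C" "Cod C f = Dom C g" "Cod C g = Dom C h"
  shows "(h \<cdot> g) \<cdot> f = h \<cdot> (g \<cdot> f)"
  using Comp_assoc[of f "Dom C f" "Dom C g" g "Dom C h" h "Cod C h"] assms by (auto simp: in_hom_iff)

lemma comp_ident [simp]:
  assumes "f \<in> Arr C"
  shows "Cod C f = b \<Longrightarrow> Ident C b \<cdot> f = f" "Dom C f = a \<Longrightarrow> f \<cdot> Ident C a = f"
  using Comp_Ident_left[of f "Dom C f" "Cod C f"] Comp_Ident_right[of f "Dom C f" "Cod C f"] assms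
  by (auto simp: in_hom_iff)

lemma Dom_Cod_Obj [simp]: "f \<in> Arr C \<Longrightarrow> Dom C f \<in> Obj C" "f \<in> Arr C \<Longrightarrow> Cod C f \<in> Obj C"
  by (simp_all add: Dom_Obj Cod_Obj)

text \<open>Simplification associates composites to the right, so the side
  \<open>g \<cdot> f\<close> of an equation no longer occurs as a subterm of
  \<open>g \<cdot> (f \<cdot> m)\<close>. This rule and the next carry an equation past a further
  factor \<open>m\<close>.\<close>

lemma comp_right_cong:
  assumes "g \<cdot> f = g' \<cdot> f'" "f \<in> Arr C" "g \<in> Arr C" "Cod C f = Dom C g"
    "f' \<in> Arr C" "g' \<in> Arr C" "Cod C f' = Dom C g'"
    "m \<in> Arr C" "Cod C m = Dom C f" "Cod C m = Dom C f'"
  shows "g \<cdot> (f \<cdot> m) = g' \<cdot> (f' \<cdot> m)"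
  using assms comp_assoc[of m f g] comp_assoc[of m f' g'] by simp

lemma comp_right_cong1:
  assumes "g \<cdot> f = h" "f \<in> Arr C" "g \<in> Arr C" "Cod C f = Dom C g"
    "m \<in> Arr C" "Cod C m = Dom C f"
  shows "g \<cdot> (f \<cdot> m) = h \<cdot> m"
  using assms comp_assoc[of m f g] by simp

end

text \<open>Universal arrows from \<open>F\<close>, one for each object of \<open>D\<close>,
  assemble into a right adjoint: objects and counit come from choice, the action on arrows and
  functoriality from uniqueness. Both the exponential and the pushforward adjunction arise in this
  way.\<close>

lemma adjunction_exI:
  fixes C :: "('o, 'm) category" and D :: "('p, 'n) category"
  assumes C: "category C" and D: "category D" and F: "is_functor C D F"
    and univ: "\<And>y. y \<in> Obj D \<Longrightarrow> \<exists>g\<in>Obj C. \<exists>e\<in>hom D (omap F g) y.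
      \<forall>x\<in>Obj C. \<forall>f\<in>hom D (omap F x) y. \<exists>!h. h \<in> hom C x g \<and> e \<cdot>\<^bsub>D\<^esub> amap F h = f"
  shows "\<exists>G \<epsilon>. adjunction C D F G \<epsilon>"
proof -
  interpret C: category C by fact
  interpret D: category D by fact
  define U where "U y g e \<longleftrightarrow> g \<in> Obj C \<and> e \<in> hom D (omap F g) y \<and>
      (\<forall>x\<in>Obj C. \<forall>f\<in>hom D (omap F x) y. \<exists>!h. h \<in> hom C x g \<and> e \<cdot>\<^bsub>D\<^esub> amap F h = f)" for y g e
  have "\<forall>y\<in>Obj D. \<exists>g e. U y g e"
    using univ unfolding U_def Bex_def by blast
  then obtain g e where U: "\<And>y. y \<in> Obj D \<Longrightarrow> U y (g y) (e y)"
    by metis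
  have g [simp]: "g y \<in> Obj C" if "y \<in> Obj D" for y using U[OF that] by (simp add: U_def)
  have e [simp]: "e y \<in> Arr D" "Dom D (e y) = omap F (g y)" "Cod D (e y) = y" if "y \<in> Obj D" for y
    using U[OF that] by (simp_all add: U_def in_hom_iff)
  have u: "\<exists>!h. h \<in> hom C x (g y) \<and> e y \<cdot>\<^bsub>D\<^esub> amap F h = f"
    if "y \<in> Obj D" "x \<in> Obj C" "f \<in> hom D (omap F x) y" for x y f
    using U[OF that(1)] that(2,3) unfolding U_def by blast
  have Fo [simp]: "omap F a \<in> Obj D" if "a \<in> Obj C" for a
    using F that by (simp add: is_functor_def)
  have Fa [simp]: "amap F f \<in> Arr D" "Dom D (amap F f) = omap F (Dom C f)"
    "Cod D (amap F f) = omap F (Cod C f)" if "f \<in> Arr C" for f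
    using F that by (auto simp: is_functor_def in_hom_iff)
  have Fi [simp]: "amap F (Ident C a) = Ident D (omap F a)" if "a \<in> Obj C" for a
    using F that by (simp add: is_functor_def)
  have Fc [simp]: "amap F (k \<cdot>\<^bsub>C\<^esub> f) = amap F k \<cdot>\<^bsub>D\<^esub> amap F f"
    if "f \<in> Arr C" "k \<in> Arr C" "Cod C f = Dom C k" for f k
    using F that by (simp add: is_functor_def)
  \<comment> \<open>The value on \<open>f\<close> is the unique factorisation of
    \<open>f \<cdot> e\<close> through the counit at the codomain, so the counit is natural by
    construction.\<close>
  define G where "G = \<lparr>omap = g, amap = (\<lambda>f. THE h. h \<in> hom C (g (Dom D f)) (g (Cod D f)) \<and>
      e (Cod D f) \<cdot>\<^bsub>D\<^esub> amap F h = f \<cdot>\<^bsub>D\<^esub> e (Dom D f))\<rparr>"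
  have Gf: "amap G f \<in> hom C (g (Dom D f)) (g (Cod D f)) \<and>
      e (Cod D f) \<cdot>\<^bsub>D\<^esub> amap F (amap G f) = f \<cdot>\<^bsub>D\<^esub> e (Dom D f)" if "f \<in> Arr D" for f
    using theI'[OF u[of "Cod D f" "g (Dom D f)" "f \<cdot>\<^bsub>D\<^esub> e (Dom D f)"]] that
    by (simp add: G_def in_hom_iff)
  have Ga [simp]: "amap G f \<in> Arr C" "Dom C (amap G f) = g (Dom D f)"
    "Cod C (amap G f) = g (Cod D f)" if "f \<in> Arr D" for f
    using Gf[OF that] by (auto simp: in_hom_iff)
  have Ge: "e (Cod D f) \<cdot>\<^bsub>D\<^esub> amap F (amap G f) = f \<cdot>\<^bsub>D\<^esub> e (Dom D f)" if "f \<in> Arr D" for f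
    using Gf[OF that] by auto
  have Gu: "amap G f = h" if "f \<in> Arr D" "h \<in> hom C (g (Dom D f)) (g (Cod D f))"
    "e (Cod D f) \<cdot>\<^bsub>D\<^esub> amap F h = f \<cdot>\<^bsub>D\<^esub> e (Dom D f)" for f h
    using u[of "Cod D f" "g (Dom D f)" "f \<cdot>\<^bsub>D\<^esub> e (Dom D f)"] that Gf[OF that(1)]
    by (fastforce simp: in_hom_iff)
  have Go [simp]: "omap G y = g y" for y by (simp add: G_def)
  have "is_functor D C G"
    unfolding is_functor_def
  proof (intro conjI ballI impI)
    show "amap G (Ident D y) = Ident C (omap G y)" if "y \<in> Obj D" for y
      using that by (intro Gu) (simp_all add: in_hom_iff)
    show "amap G (k \<cdot>\<^bsub>D\<^esub> f) = amap G k \<cdot>\<^bsub>C\<^esub> amap G f"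
      if "f \<in> Arr D" "k \<in> Arr D" "Cod D f = Dom D k" for f k
    proof (intro Gu)
      \<comment> \<open>Moving \<open>k\<close> and then \<open>f\<close> past the counit shows that
        the composite solves the factorisation problem defining the value at
        \<open>k \<cdot> f\<close>.\<close>
      have "e (Cod D k) \<cdot>\<^bsub>D\<^esub> (amap F (amap G k) \<cdot>\<^bsub>D\<^esub> amap F (amap G f))
          = (k \<cdot>\<^bsub>D\<^esub> e (Dom D k)) \<cdot>\<^bsub>D\<^esub> amap F (amap G f)"
        using that Ge[of k] by (subst D.comp_assoc[symmetric]) simp_all
      also have "\<dots> = k \<cdot>\<^bsub>D\<^esub> (f \<cdot>\<^bsub>D\<^esub> e (Dom D f))"
        using that Ge[of f] by simp
      finally show "e (Cod D (k \<cdot>\<^bsub>D\<^esub> f)) \<cdot>\<^bsub>D\<^esub> amap F (amap G k \<cdot>\<^bsub>C\<^esub> amap G f)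
          = (k \<cdot>\<^bsub>D\<^esub> f) \<cdot>\<^bsub>D\<^esub> e (Dom D (k \<cdot>\<^bsub>D\<^esub> f))"
        using that by simp
    qed (use that in \<open>simp_all add: in_hom_iff\<close>)
  qed (simp_all add: in_hom_iff)
  then have "adjunction C D F G e"
    unfolding adjunction_def Go by (intro conjI ballI F u) (simp_all add: Ge in_hom_iff)
  then show ?thesis by blast
qed

text \<open>Kept apart from the closed structure: each slice is an instance before the whole
  category is known to have products.\<close>

locale binary_products = category +
  assumes ex_product: "\<lbrakk>a \<in> Obj C; b \<in> Obj C\<rbrakk> \<Longrightarrow> \<exists>P \<pi>\<^sub>1 \<pi>\<^sub>2. is_product C a b P \<pi>\<^sub>1 \<pi>\<^sub>2"
begin

lemma is_product_prod_obj:
  assumes "a \<in> Obj C" "b \<in> Obj C"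
  shows "is_product C a b (prod_obj C a b) (prod_proj1 C a b) (prod_proj2 C a b)"
  using some_triple[of "is_product C a b"] ex_product[OF assms]
  by (simp add: product_def prod_obj_def prod_proj1_def prod_proj2_def)

lemma prod_typing [simp]:
  assumes "a \<in> Obj C" "b \<in> Obj C"
  shows "prod_obj C a b \<in> Obj C"
    "prod_proj1 C a b \<in> Arr C" "Dom C (prod_proj1 C a b) = prod_obj C a b" "Cod C (prod_proj1 C a b) = a"
    "prod_proj2 C a b \<in> Arr C" "Dom C (prod_proj2 C a b) = prod_obj C a b" "Cod C (prod_proj2 C a b) = b"
  using is_product_prod_obj[OF assms] by (auto simp: is_product_def in_hom_iff)

lemma ex1_prod_pair:
  assumes "a \<in> Obj C" "b \<in> Obj C" "f \<in> Arr C" "g \<in> Arr C" "Dom C f = Dom C g" "Cod C f = a" "Cod C g = b"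
  shows "\<exists>!h. h \<in> hom C (Dom C f) (prod_obj C a b) \<and> prod_proj1 C a b \<cdot> h = f \<and> prod_proj2 C a b \<cdot> h = g"
  using is_product_prod_obj[of a b] assms Dom_Cod_Obj(1)[of f]
  unfolding is_product_def by (metis (no_types, lifting) in_hom_iff)

lemma prod_pair [simp]:
  assumes "a \<in> Obj C" "b \<in> Obj C" "f \<in> Arr C" "g \<in> Arr C" "Dom C f = Dom C g" "Cod C f = a" "Cod C g = b"
  shows "prod_pair C a b f g \<in> Arr C" "Dom C (prod_pair C a b f g) = Dom C g"
    "Cod C (prod_pair C a b f g) = prod_obj C a b"
    "prod_proj1 C a b \<cdot> prod_pair C a b f g = f" "prod_proj2 C a b \<cdot> prod_pair C a b f g = g"
  using theI'[OF ex1_prod_pair[OF assms]] assms(5) by (auto simp: prod_pair_def in_hom_iff)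

lemma prod_ext:
  assumes "a \<in> Obj C" "b \<in> Obj C" "h \<in> Arr C" "h' \<in> Arr C" "Dom C h = Dom C h'"
    "Cod C h = prod_obj C a b" "Cod C h' = prod_obj C a b"
    "prod_proj1 C a b \<cdot> h = prod_proj1 C a b \<cdot> h'" "prod_proj2 C a b \<cdot> h = prod_proj2 C a b \<cdot> h'"
  shows "h = h'"
  using ex1_prod_pair[of a b "prod_proj1 C a b \<cdot> h" "prod_proj2 C a b \<cdot> h"] assms
  by (auto simp: in_hom_iff)

lemma prod_pair_comp [simp]:
  assumes "a \<in> Obj C" "b \<in> Obj C" "f \<in> Arr C" "g \<in> Arr C" "Dom C f = Dom C g" "Cod C f = a" "Cod C g = b"
    "m \<in> Arr C" "Cod C m = Dom C g"
  shows "prod_pair C a b f g \<cdot> m = prod_pair C a b (f \<cdot> m) (g \<cdot> m)"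
  by (rule prod_ext[of a b]) (use assms in \<open>simp_all add: comp_right_cong1[OF prod_pair(4)] comp_right_cong1[OF prod_pair(5)]\<close>)

lemma prod_pair_eta:
  assumes "a \<in> Obj C" "b \<in> Obj C" "w \<in> Arr C" "Cod C w = prod_obj C a b"
  shows "prod_pair C a b (prod_proj1 C a b \<cdot> w) (prod_proj2 C a b \<cdot> w) = w"
  by (rule prod_ext[of a b]) (use assms in \<open>simp_all\<close>)

lemma prod_pair_proj [simp]:
  assumes "a \<in> Obj C" "b \<in> Obj C"
  shows "prod_pair C a b (prod_proj1 C a b) (prod_proj2 C a b) = Ident C (prod_obj C a b)"
  by (rule prod_ext[of a b]) (use assms in \<open>simp_all\<close>)

lemma is_functor_prod_functor:
  assumes "b \<in> Obj C"
  shows "is_functor C C (prod_functor C b)"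
  unfolding is_functor_def prod_functor_def using assms by (auto simp: in_hom_iff)

end

section \<open>Slices and pullbacks\<close>

lemma slice_simps [simp]:
  "Obj (slice C X) = {q \<in> Arr C. Cod C q = X}"
  "(r, q) \<in> Arr (slice C X) \<longleftrightarrow> r \<in> Arr C \<and> q \<in> Arr C \<and> Cod C q = X \<and> Cod C r = Dom C q"
  "Dom (slice C X) (r, q) = q \<cdot>\<^bsub>C\<^esub> r" "Cod (slice C X) (r, q) = q"
  "Ident (slice C X) q = (Ident C (Dom C q), q)"
  "(s, q) \<cdot>\<^bsub>slice C X\<^esub> (r, q') = (s \<cdot>\<^bsub>C\<^esub> r, q)"
  by (simp_all add: slice_def)

lemma in_hom_slice [simp]:
  "(r, q) \<in> hom (slice C X) y z \<longleftrightarrow>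
     q = z \<and> z \<in> Arr C \<and> Cod C z = X \<and> r \<in> Arr C \<and> Cod C r = Dom C z \<and> z \<cdot>\<^bsub>C\<^esub> r = y"
  by (auto simp: in_hom_iff)

lemma in_hom_sliceE:
  assumes "t \<in> hom (slice C X) y z"
  obtains r where "t = (r, z)" "z \<in> Arr C" "Cod C z = X" "r \<in> Arr C" "Cod C r = Dom C z" "z \<cdot>\<^bsub>C\<^esub> r = y"
  using assms by (cases t) simp

text \<open>A cone \<open>u\<close>, \<open>v\<close> over the cospan \<open>f\<close>,
  \<open>g\<close> is the same as the object \<open>f \<cdot> u\<close> of the slice with arrows to
  \<open>f\<close> and to \<open>g\<close>, so the two universal properties agree.\<close>

lemma (in category) slice_product_is_pullback:
  assumes fg: "f \<in> Arr C" "g \<in> Arr C" "Cod C f = X" "Cod C g = X"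
    and P: "is_product (slice C X) f g P \<pi>\<^sub>1 \<pi>\<^sub>2"
  shows "is_pullback C f g (Dom C P) (fst \<pi>\<^sub>1) (fst \<pi>\<^sub>2)"
proof -
  have PO: "P \<in> Arr C" "Cod C P = X" using P by (simp_all add: is_product_def)
  obtain r\<^sub>1 where r1: "\<pi>\<^sub>1 = (r\<^sub>1, f)" "r\<^sub>1 \<in> Arr C" "Cod C r\<^sub>1 = Dom C f" "f \<cdot> r\<^sub>1 = P"
    using P unfolding is_product_def by (metis in_hom_sliceE)
  obtain r\<^sub>2 where r2: "\<pi>\<^sub>2 = (r\<^sub>2, g)" "r\<^sub>2 \<in> Arr C" "Cod C r\<^sub>2 = Dom C g" "g \<cdot> r\<^sub>2 = P"
    using P unfolding is_product_def by (metis in_hom_sliceE)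
  \<comment> \<open>A slice arrow records only its underlying map and its target, so the domain has
    to be recovered from the triangle.\<close>
  have d: "Dom C r\<^sub>1 = Dom C P" "Dom C r\<^sub>2 = Dom C P" 
    using comp_typing(2)[of r\<^sub>1 f] comp_typing(2)[of r\<^sub>2 g] fg r1 r2 by simp_all
  have univ: "\<exists>!h. h \<in> hom C c (Dom C P) \<and> r\<^sub>1 \<cdot> h = u \<and> r\<^sub>2 \<cdot> h = v"
    if uv: "u \<in> Arr C" "v \<in> Arr C" "Dom C u = c" "Dom C v = c" "Cod C u = Dom C f" "Cod C v = Dom C g"
      "f \<cdot> u = g \<cdot> v" for c u v
  proof -
    have "(u, f) \<in> hom (slice C X) (f \<cdot> u) f" "(v, g) \<in> hom (slice C X) (f \<cdot> u) g"
      using uv fg by simp_all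
    moreover have "f \<cdot> u \<in> Obj (slice C X)"
      using uv fg by simp
    ultimately have ex1: "\<exists>!t. t \<in> hom (slice C X) (f \<cdot> u) P \<and>
        \<pi>\<^sub>1 \<cdot>\<^bsub>slice C X\<^esub> t = (u, f) \<and> \<pi>\<^sub>2 \<cdot>\<^bsub>slice C X\<^esub> t = (v, g)"
      using P unfolding is_product_def by blast
    then obtain t where t: "t \<in> hom (slice C X) (f \<cdot> u) P"
        "\<pi>\<^sub>1 \<cdot>\<^bsub>slice C X\<^esub> t = (u, f)" "\<pi>\<^sub>2 \<cdot>\<^bsub>slice C X\<^esub> t = (v, g)"
      by blast
    obtain h where h: "t = (h, P)" "h \<in> Arr C" "Cod C h = Dom C P" "P \<cdot> h = f \<cdot> u"
      using t(1) by (rule in_hom_sliceE)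
    have "Dom C h = c"
      using h uv fg PO comp_typing(2)[of h P] comp_typing(2)[of u f] by simp
    then have ex: "h \<in> hom C c (Dom C P) \<and> r\<^sub>1 \<cdot> h = u \<and> r\<^sub>2 \<cdot> h = v"
      using t(2,3) h r1 r2 by (simp add: in_hom_iff)
    have "h' = h" if h': "h' \<in> hom C c (Dom C P) \<and> r\<^sub>1 \<cdot> h' = u \<and> r\<^sub>2 \<cdot> h' = v" for h'
    proof -
      \<comment> \<open>A competitor must first be seen to lie over \<open>f \<cdot> u\<close>; only
        then is it a slice arrow to which uniqueness applies.\<close>
      have "P \<cdot> h' = f \<cdot> u"
        using comp_right_cong1[OF r1(4), of h'] h' r1 d fg by (simp add: in_hom_iff)
      then have "(h', P) \<in> hom (slice C X) (f \<cdot> u) P \<and>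
          \<pi>\<^sub>1 \<cdot>\<^bsub>slice C X\<^esub> (h', P) = (u, f) \<and> \<pi>\<^sub>2 \<cdot>\<^bsub>slice C X\<^esub> (h', P) = (v, g)"
        using h' r1 r2 PO by (simp add: in_hom_iff)
      with ex1 t h(1) show "h' = h" by blast
    qed
    with ex show ?thesis by blast
  qed
  show ?thesis
    unfolding is_pullback_def
  proof (intro conjI ballI impI)
    show "f \<cdot> fst \<pi>\<^sub>1 = g \<cdot> fst \<pi>\<^sub>2" using r1 r2 by simp
    show "\<exists>!h. h \<in> hom C c (Dom C P) \<and> fst \<pi>\<^sub>1 \<cdot> h = u \<and> fst \<pi>\<^sub>2 \<cdot> h = v"
      if "u \<in> hom C c (Dom C f)" "v \<in> hom C c (Dom C g)" "f \<cdot> u = g \<cdot> v" for c u v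
      using univ[of u v c] that r1(1) r2(1) by (simp add: in_hom_iff)
  qed (use r1 r2 d PO in \<open>simp_all add: in_hom_iff\<close>)
qed

section \<open>Chosen pullbacks and the terminal object\<close>

locale lccc = category +
  assumes lcc: "locally_cartesian_closed C"
begin

lemma binary_products_slice:
  assumes "X \<in> Obj C"
  shows "binary_products (slice C X)"
proof -
  have "cartesian_closed (slice C X)"
    using lcc assms by (simp add: locally_cartesian_closed_def)
  then show ?thesis
    unfolding cartesian_closed_def binary_products_def binary_products_axioms_def by blast
qed

text \<open>Read off from the product in the slice over the common codomain, which avoids setting up
  an index category for cospans.\<close>

lemma is_pullback_pb_obj:
  assumes "f \<in> Arr C" "g \<in> Arr C" "Cod C f = Cod C g"
  shows "is_pullback C f g (pb_obj C f g) (pb_proj1 C f g) (pb_proj2 C f g)"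
proof -
  interpret S: binary_products "slice C (Cod C f)"
    using assms by (intro binary_products_slice) simp
  have "f \<in> Obj (slice C (Cod C f))" "g \<in> Obj (slice C (Cod C f))"
    using assms by simp_all
  from slice_product_is_pullback[OF assms(1,2) refl assms(3)[symmetric] S.is_product_prod_obj[OF this]]
  have "\<exists>P \<pi>\<^sub>1 \<pi>\<^sub>2. is_pullback C f g P \<pi>\<^sub>1 \<pi>\<^sub>2"
    by (intro exI)
  then show ?thesis
    using some_triple[of "is_pullback C f g"]
    by (simp add: pullback_def pb_obj_def pb_proj1_def pb_proj2_def)
qed

lemma pb_typing [simp]:
  assumes "f \<in> Arr C" "g \<in> Arr C" "Cod C f = Cod C g"
  shows "pb_obj C f g \<in> Obj C"
    "pb_proj1 C f g \<in> Arr C" "Dom C (pb_proj1 C f g) = pb_obj C f g" "Cod C (pb_proj1 C f g) = Dom C f"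
    "pb_proj2 C f g \<in> Arr C" "Dom C (pb_proj2 C f g) = pb_obj C f g" "Cod C (pb_proj2 C f g) = Dom C g"
  using is_pullback_pb_obj[OF assms] by (auto simp: is_pullback_def in_hom_iff)

lemma pb_comm:
  assumes "f \<in> Arr C" "g \<in> Arr C" "Cod C f = Cod C g"
  shows "f \<cdot> pb_proj1 C f g = g \<cdot> pb_proj2 C f g"
  using is_pullback_pb_obj[OF assms] by (auto simp: is_pullback_def)

lemma ex1_pb_pair:
  assumes "f \<in> Arr C" "g \<in> Arr C" "Cod C f = Cod C g"
    "u \<in> Arr C" "v \<in> Arr C" "Dom C u = Dom C v" "Cod C u = Dom C f" "Cod C v = Dom C g" "f \<cdot> u = g \<cdot> v"
  shows "\<exists>!h. h \<in> hom C (Dom C u) (pb_obj C f g) \<and> pb_proj1 C f g \<cdot> h = u \<and> pb_proj2 C f g \<cdot> h = v"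
proof -
  have "Dom C u \<in> Obj C" "u \<in> hom C (Dom C u) (Dom C f)" "v \<in> hom C (Dom C u) (Dom C g)"
    using assms by (simp_all add: in_hom_iff)
  then show ?thesis
    using is_pullback_pb_obj[OF assms(1-3)] assms(9) unfolding is_pullback_def by blast
qed

lemma pb_pair [simp]:
  assumes "f \<in> Arr C" "g \<in> Arr C" "Cod C f = Cod C g"
    "u \<in> Arr C" "v \<in> Arr C" "Dom C u = Dom C v" "Cod C u = Dom C f" "Cod C v = Dom C g" "f \<cdot> u = g \<cdot> v"
  shows "pb_pair C f g u v \<in> Arr C" "Dom C (pb_pair C f g u v) = Dom C v"
    "Cod C (pb_pair C f g u v) = pb_obj C f g"
    "pb_proj1 C f g \<cdot> pb_pair C f g u v = u" "pb_proj2 C f g \<cdot> pb_pair C f g u v = v"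
  using theI'[OF ex1_pb_pair[OF assms]] assms(6) by (auto simp: pb_pair_def in_hom_iff)

lemma pb_ext:
  assumes "f \<in> Arr C" "g \<in> Arr C" "Cod C f = Cod C g" "h \<in> Arr C" "h' \<in> Arr C" "Dom C h = Dom C h'"
    "Cod C h = pb_obj C f g" "Cod C h' = pb_obj C f g"
    "pb_proj1 C f g \<cdot> h = pb_proj1 C f g \<cdot> h'" "pb_proj2 C f g \<cdot> h = pb_proj2 C f g \<cdot> h'"
  shows "h = h'"
proof -
  have "f \<cdot> (pb_proj1 C f g \<cdot> h) = g \<cdot> (pb_proj2 C f g \<cdot> h)"
    using assms(1-4,7) by (intro comp_right_cong[OF pb_comm]) simp_all
  then have "\<exists>!k. k \<in> hom C (Dom C h) (pb_obj C f g) \<and>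
      pb_proj1 C f g \<cdot> k = pb_proj1 C f g \<cdot> h \<and> pb_proj2 C f g \<cdot> k = pb_proj2 C f g \<cdot> h"
    using ex1_pb_pair[of f g "pb_proj1 C f g \<cdot> h" "pb_proj2 C f g \<cdot> h"] assms by simp
  moreover have "h \<in> hom C (Dom C h) (pb_obj C f g)" "h' \<in> hom C (Dom C h) (pb_obj C f g)"
    using assms by (simp_all add: in_hom_iff)
  ultimately show ?thesis
    using assms(9,10) by (metis (no_types))
qed

lemma pb_pair_comp [simp]:
  assumes fg: "f \<in> Arr C" "g \<in> Arr C" "Cod C f = Cod C g"
    and uv: "u \<in> Arr C" "v \<in> Arr C" "Dom C u = Dom C v" "Cod C u = Dom C f" "Cod C v = Dom C g"
      "f \<cdot> u = g \<cdot> v"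
    and m: "m \<in> Arr C" "Cod C m = Dom C v"
  shows "pb_pair C f g u v \<cdot> m = pb_pair C f g (u \<cdot> m) (v \<cdot> m)"
proof -
  have "f \<cdot> (u \<cdot> m) = g \<cdot> (v \<cdot> m)"
    using assms by (intro comp_right_cong) simp_all
  then show ?thesis
    by (rule_tac pb_ext[OF fg]) (use assms comp_right_cong1[OF pb_pair(4)[OF fg uv], of m]
      comp_right_cong1[OF pb_pair(5)[OF fg uv], of m] in \<open>simp_all\<close>)
qed

lemma pb_pair_proj [simp]:
  assumes "f \<in> Arr C" "g \<in> Arr C" "Cod C f = Cod C g"
  shows "pb_pair C f g (pb_proj1 C f g) (pb_proj2 C f g) = Ident C (pb_obj C f g)"
  by (rule pb_ext[of f g]) (use assms pb_comm[OF assms] in \<open>simp_all\<close>)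

lemma is_functor_pullback_functor:
  assumes p: "p \<in> Arr C"
  shows "is_functor (slice C (Cod C p)) (slice C (Dom C p)) (pullback_functor C p)"
proof -
  \<comment> \<open>The two legs agree over the codomain of \<open>p\<close>, which is the side
    condition under which \<open>pb_pair\<close> computes; \<open>c'\<close> is the case without a
    further factor \<open>m\<close>.\<close>
  have c: "p \<cdot> (pb_proj1 C p (y \<cdot> r) \<cdot> m) = y \<cdot> (r \<cdot> (pb_proj2 C p (y \<cdot> r) \<cdot> m))"
    if "r \<in> Arr C" "y \<in> Arr C" "Cod C y = Cod C p" "Cod C r = Dom C y"
      "m \<in> Arr C" "Cod C m = pb_obj C p (y \<cdot> r)" for r y m
    using comp_right_cong[OF pb_comm[of p "y \<cdot> r"], of m] that p by simp
  have c': "p \<cdot> pb_proj1 C p (y \<cdot> r) = y \<cdot> (r \<cdot> pb_proj2 C p (y \<cdot> r))"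
    if "r \<in> Arr C" "y \<in> Arr C" "Cod C y = Cod C p" "Cod C r = Dom C y" for r y
    using pb_comm[of p "y \<cdot> r"] that p by simp
  show ?thesis
    unfolding is_functor_def pullback_functor_def
    using p c' by (auto simp: in_hom_iff pb_comm)
qed

text \<open>A limit over the empty index category: its cones are bare objects, and any value, here
  \<open>undefined\<close>, is a diagram of this shape.\<close>

lemma ex_terminal: "\<exists>t. is_terminal C t"
proof -
  define J :: "(nat, nat) category" where "J = \<lparr>Obj = {}, Arr = {}, Dom = undefined, Cod = undefined,
    Ident = undefined, Comp = undefined\<rparr>"
  have "category J" "is_functor J C D" for D :: "(nat, nat, 'a, 'b) functor_data"
    by (unfold_locales) (auto simp: J_def in_hom_iff is_functor_def)
  then obtain L \<pi> where "is_limit J C undefined L \<pi>"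
    using lcc unfolding locally_cartesian_closed_def has_finite_limits_def
    by (metis J_def category.simps(1,2) finite.emptyI)
  then have "is_terminal C L"
    by (auto simp: is_limit_def is_cone_def is_terminal_def J_def)
  then show ?thesis ..
qed

end


section \<open>Exponentials and dependent products\<close>

context lccc
begin

text \<open>The exponential \<open>y\<^sup>f\<close> in the slice: \<open>\<alpha> g a\<close> is the value of the generalised element \<open>g\<close> at \<open>a\<close>,
  so that no chosen products of the slice occur.\<close>

definition is_slice_exponential where
  "is_slice_exponential f y \<gamma> \<alpha> \<longleftrightarrow> \<gamma> \<in> Arr C \<and> Cod C \<gamma> = Cod C f \<and>
    (\<forall>g a. g \<in> Arr C \<longrightarrow> a \<in> Arr C \<longrightarrow> Cod C g = Dom C \<gamma> \<longrightarrow> Cod C a = Dom C f \<longrightarrow> Dom C g = Dom C a \<longrightarrow>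
      \<gamma> \<cdot> g = f \<cdot> a \<longrightarrow>
      \<alpha> g a \<in> Arr C \<and> Dom C (\<alpha> g a) = Dom C a \<and> Cod C (\<alpha> g a) = Dom C y \<and> y \<cdot> \<alpha> g a = f \<cdot> a \<and>
      (\<forall>m. m \<in> Arr C \<longrightarrow> Cod C m = Dom C a \<longrightarrow> \<alpha> g a \<cdot> m = \<alpha> (g \<cdot> m) (a \<cdot> m))) \<and>
    (\<forall>z k. z \<in> Arr C \<longrightarrow> Cod C z = Cod C f \<longrightarrow> k \<in> Arr C \<longrightarrow> Dom C k = pb_obj C f z \<longrightarrow>
      Cod C k = Dom C y \<longrightarrow> y \<cdot> k = f \<cdot> pb_proj1 C f z \<longrightarrow>
      (\<exists>!g. g \<in> hom C (Dom C z) (Dom C \<gamma>) \<and> \<gamma> \<cdot> g = z \<and> \<alpha> (g \<cdot> pb_proj2 C f z) (pb_proj1 C f z) = k))"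

lemma slice_exponential_univ:
  assumes "is_slice_exponential f y \<gamma> \<alpha>" "z \<in> Arr C" "Cod C z = Cod C f" "k \<in> Arr C"
    "Dom C k = pb_obj C f z" "Cod C k = Dom C y" "y \<cdot> k = f \<cdot> pb_proj1 C f z"
  shows "\<exists>!g. g \<in> hom C (Dom C z) (Dom C \<gamma>) \<and> \<gamma> \<cdot> g = z \<and> \<alpha> (g \<cdot> pb_proj2 C f z) (pb_proj1 C f z) = k"
  using assms by (simp add: is_slice_exponential_def)

text \<open>Evaluation is the counit of the product functor of the slice, composed with a pairing
  \<open>t g a\<close> into the chosen slice product. The work lies in passing from the chosen slice
  products of the adjunction to the chosen pullbacks of the statement.\<close>

lemma ex_slice_exponential:
  assumes f [simp]: "f \<in> Arr C" and y [simp]: "y \<in> Arr C" and fy: "Cod C f = Cod C y"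
  shows "\<exists>\<gamma> \<alpha>. is_slice_exponential f y \<gamma> \<alpha>"
proof -
  define X where "X = Cod C f"
  define S where "S = slice C X"
  have X [simp]: "Cod C f = X" "Cod C y = X" by (simp_all add: X_def fy)
  have XO: "X \<in> Obj C"
    using Dom_Cod_Obj(2)[OF f] by simp
  have cc: "cartesian_closed S"
    using lcc XO unfolding locally_cartesian_closed_def S_def by blast
  interpret S: binary_products S
    unfolding S_def by (rule binary_products_slice[OF XO])
  have SO [simp]: "z \<in> Obj S \<longleftrightarrow> z \<in> Arr C \<and> Cod C z = X" for z
    by (auto simp: S_def)
  have SA: "(r, q) \<in> Arr S \<longleftrightarrow> r \<in> Arr C \<and> q \<in> Arr C \<and> Cod C q = X \<and> Cod C r = Dom C q"
    "Dom S (r, q) = q \<cdot> r" "Cod S (r, q) = q" "(s, q) \<cdot>\<^bsub>S\<^esub> (r, q') = (s \<cdot> r, q)"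
    "(r, q) \<in> hom S z z' \<longleftrightarrow> q = z' \<and> z' \<in> Arr C \<and> Cod C z' = X \<and> r \<in> Arr C \<and> Cod C r = Dom C z' \<and> z' \<cdot> r = z"
    for r q s q' z z' by (simp_all add: S_def)
  obtain G \<epsilon> where adj: "adjunction S S (prod_functor S f) G \<epsilon>"
    using cc f unfolding cartesian_closed_def by fastforce
  define \<gamma> where "\<gamma> = omap G y"
  have \<gamma> [simp]: "\<gamma> \<in> Arr C" "Cod C \<gamma> = X"
    using adj y X by (auto simp: adjunction_def is_functor_def \<gamma>_def)
  define D where "D = prod_obj S \<gamma> f"
  have D [simp]: "D \<in> Arr C" "Cod C D = X"
    using S.prod_typing(1)[of \<gamma> f] by (simp_all add: D_def)
  have "\<epsilon> y \<in> hom S D y"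
    using adj y X by (auto simp: adjunction_def prod_functor_def D_def \<gamma>_def)
  then obtain e where ey: "\<epsilon> y = (e, y)" and e [simp]: "e \<in> Arr C" "Cod C e = Dom C y" "y \<cdot> e = D"
    unfolding S_def by (metis in_hom_sliceE)
  have e_dom [simp]: "Dom C e = Dom C D"
    using comp_typing(2)[of e y] by simp
  define t where "t g a = fst (prod_pair S \<gamma> f (g, \<gamma>) (a, f))" for g a
  have t: "prod_pair S \<gamma> f (g, \<gamma>) (a, f) = (t g a, D)" "t g a \<in> Arr C" "Cod C (t g a) = Dom C D"
    "D \<cdot> t g a = f \<cdot> a" "Dom C (t g a) = Dom C a"
    if "g \<in> Arr C" "a \<in> Arr C" "Cod C g = Dom C \<gamma>" "Cod C a = Dom C f" "Dom C g = Dom C a"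
      "\<gamma> \<cdot> g = f \<cdot> a" for g a
  proof -
    have "prod_pair S \<gamma> f (g, \<gamma>) (a, f) \<in> hom S (f \<cdot> a) D"
      using S.prod_pair(1-3)[of \<gamma> f "(g, \<gamma>)" "(a, f)"] that by (simp add: SA in_hom_iff D_def)
    then show *: "prod_pair S \<gamma> f (g, \<gamma>) (a, f) = (t g a, D)" "t g a \<in> Arr C" "Cod C (t g a) = Dom C D"
      "D \<cdot> t g a = f \<cdot> a"
      by (simp_all add: t_def S_def in_hom_sliceE split: prod.splits) (metis in_hom_sliceE prod.sel(1))+
    show "Dom C (t g a) = Dom C a"
      using comp_typing(2)[of "t g a" D] comp_typing(2)[of a f] that * by simp
  qed
  have t_comp: "t g a \<cdot> m = t (g \<cdot> m) (a \<cdot> m)"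
    if ga: "g \<in> Arr C" "a \<in> Arr C" "Cod C g = Dom C \<gamma>" "Cod C a = Dom C f" "Dom C g = Dom C a"
      "\<gamma> \<cdot> g = f \<cdot> a" and m: "m \<in> Arr C" "Cod C m = Dom C a" for g a m
  proof -
    have "\<gamma> \<cdot> (g \<cdot> m) = f \<cdot> (a \<cdot> m)"
      by (rule comp_right_cong) (use that in simp_all)
    then have "prod_pair S \<gamma> f (g, \<gamma>) (a, f) \<cdot>\<^bsub>S\<^esub> (m, f \<cdot> a) = prod_pair S \<gamma> f (g \<cdot> m, \<gamma>) (a \<cdot> m, f)"
      using S.prod_pair_comp[of \<gamma> f "(g, \<gamma>)" "(a, f)" "(m, f \<cdot> a)"] that by (simp add: SA)
    then show ?thesis
      using t(1)[OF ga] t(1)[of "g \<cdot> m" "a \<cdot> m"] \<open>\<gamma> \<cdot> (g \<cdot> m) = f \<cdot> (a \<cdot> m)\<close> that by (simp add: SA)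
  qed
  define \<alpha> where "\<alpha> g a = e \<cdot> t g a" for g a
  have \<alpha>: "\<alpha> g a \<in> Arr C" "Dom C (\<alpha> g a) = Dom C a" "Cod C (\<alpha> g a) = Dom C y" "y \<cdot> \<alpha> g a = f \<cdot> a"
    if "g \<in> Arr C" "a \<in> Arr C" "Cod C g = Dom C \<gamma>" "Cod C a = Dom C f" "Dom C g = Dom C a"
      "\<gamma> \<cdot> g = f \<cdot> a" for g a
    using t[OF that] comp_right_cong1[OF e(3), of "t g a"] by (simp_all add: \<alpha>_def)
  have \<alpha>_comp: "\<alpha> g a \<cdot> m = \<alpha> (g \<cdot> m) (a \<cdot> m)"
    if "g \<in> Arr C" "a \<in> Arr C" "Cod C g = Dom C \<gamma>" "Cod C a = Dom C f" "Dom C g = Dom C a"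
      "\<gamma> \<cdot> g = f \<cdot> a" "m \<in> Arr C" "Cod C m = Dom C a" for g a m
    using t[OF that(1-6)] t_comp[OF that] that(7,8) by (simp add: \<alpha>_def)
  have univ: "\<exists>!g. g \<in> hom C (Dom C z) (Dom C \<gamma>) \<and> \<gamma> \<cdot> g = z \<and>
      \<alpha> (g \<cdot> pb_proj2 C f z) (pb_proj1 C f z) = k"
    if z [simp]: "z \<in> Arr C" "Cod C z = X"
      and k [simp]: "k \<in> Arr C" "Dom C k = pb_obj C f z" "Cod C k = Dom C y" "y \<cdot> k = f \<cdot> pb_proj1 C f z" for z k
  proof -
    define D' where "D' = prod_obj S z f"
    define p\<^sub>1 p\<^sub>2 where "p\<^sub>1 = fst (prod_proj1 S z f)" and "p\<^sub>2 = fst (prod_proj2 S z f)"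
    have pr: "is_product S z f D' (prod_proj1 S z f) (prod_proj2 S z f)"
      unfolding D'_def by (rule S.is_product_prod_obj) simp_all
    have D' [simp]: "D' \<in> Arr C" "Cod C D' = X"
      using S.prod_typing(1)[of z f] by (simp_all add: D'_def)
    have pb: "is_pullback C z f (Dom C D') p\<^sub>1 p\<^sub>2"
      using slice_product_is_pullback[OF z(1) f z(2) X(1)] pr unfolding S_def p\<^sub>1_def p\<^sub>2_def by blast
    have "prod_proj1 S z f \<in> hom S D' z" "prod_proj2 S z f \<in> hom S D' f"
      using pr by (simp_all add: is_product_def)
    then have pS: "prod_proj1 S z f = (p\<^sub>1, z)" "prod_proj2 S z f = (p\<^sub>2, f)"
      and p [simp]: "p\<^sub>1 \<in> Arr C" "Cod C p\<^sub>1 = Dom C z" "z \<cdot> p\<^sub>1 = D'" 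
        "p\<^sub>2 \<in> Arr C" "Cod C p\<^sub>2 = Dom C f" "f \<cdot> p\<^sub>2 = D'" 
      unfolding p\<^sub>1_def p\<^sub>2_def S_def by (metis in_hom_sliceE prod.sel(1))+
    have p_dom [simp]: "Dom C p\<^sub>1 = Dom C D'" "Dom C p\<^sub>2 = Dom C D'"
      using comp_typing(2)[of p\<^sub>1 z] comp_typing(2)[of p\<^sub>2 f] by simp_all
    let ?a = "pb_proj1 C f z" and ?m = "pb_proj2 C f z"
    have am: "z \<cdot> ?m = f \<cdot> ?a" using pb_comm[of f z] by simp
    \<comment> \<open>\<open>\<tau>\<close> and \<open>\<sigma>\<close> compare the two choices of
      fibre product. The factors are swapped: the product functor has \<open>z\<close> on the left,
      the pullback has \<open>f\<close> there.\<close>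
    define \<tau> where "\<tau> = pb_pair C f z p\<^sub>2 p\<^sub>1"
    have \<tau> [simp]: "\<tau> \<in> Arr C" "Dom C \<tau> = Dom C D'" "Cod C \<tau> = pb_obj C f z" "?a \<cdot> \<tau> = p\<^sub>2" "?m \<cdot> \<tau> = p\<^sub>1"
      by (simp_all add: \<tau>_def)
    have "?m \<in> hom C (pb_obj C f z) (Dom C z)" "?a \<in> hom C (pb_obj C f z) (Dom C f)" "pb_obj C f z \<in> Obj C"
      by (simp_all add: in_hom_iff)
    then obtain \<sigma> where "\<sigma> \<in> hom C (pb_obj C f z) (Dom C D')" and \<sigma>: "p\<^sub>1 \<cdot> \<sigma> = ?m" "p\<^sub>2 \<cdot> \<sigma> = ?a"
      using pb am unfolding is_pullback_def by blast
    then have \<sigma>' [simp]: "\<sigma> \<in> Arr C" "Dom C \<sigma> = pb_obj C f z" "Cod C \<sigma> = Dom C D'"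
      by (simp_all add: in_hom_iff)
    \<comment> \<open>Naturality of \<open>\<alpha>\<close> along \<open>\<sigma>\<close> and
      \<open>\<tau>\<close> carries either side to the other; passing from left to right also uses
      that \<open>\<tau> \<cdot> \<sigma>\<close> is an identity.\<close>
    have eq: "\<alpha> (g \<cdot> p\<^sub>1) p\<^sub>2 = k \<cdot> \<tau> \<longleftrightarrow> \<alpha> (g \<cdot> ?m) ?a = k"
      if g [simp]: "g \<in> Arr C" "Dom C g = Dom C z" "Cod C g = Dom C \<gamma>" "\<gamma> \<cdot> g = z" for g
    proof -
      have "\<gamma> \<cdot> (g \<cdot> p\<^sub>1) = f \<cdot> p\<^sub>2"
        using comp_right_cong1[OF g(4), of p\<^sub>1] by simp
      then have 1: "\<alpha> (g \<cdot> p\<^sub>1) p\<^sub>2 \<cdot> \<sigma> = \<alpha> (g \<cdot> ?m) ?a"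
        by (subst \<alpha>_comp) (simp_all add: \<sigma>)
      have "\<gamma> \<cdot> (g \<cdot> ?m) = f \<cdot> ?a"
        using comp_right_cong1[OF g(4), of ?m] am by simp
      then have 2: "\<alpha> (g \<cdot> ?m) ?a \<cdot> \<tau> = \<alpha> (g \<cdot> p\<^sub>1) p\<^sub>2"
        by (subst \<alpha>_comp) simp_all
      have "\<tau> \<cdot> \<sigma> = Ident C (pb_obj C f z)"
        unfolding \<tau>_def by (subst pb_pair_comp) (simp_all add: \<sigma>)
      then have "(k \<cdot> \<tau>) \<cdot> \<sigma> = k" by simp
      with 1 2 show ?thesis by metis
    qed
    have "D' \<in> Obj S" "(k \<cdot> \<tau>, y) \<in> hom S D' y"
      using comp_right_cong1[OF k(4), of \<tau>] by (simp_all add: SA)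
    moreover have "omap (prod_functor S f) z = D'"
      by (simp add: prod_functor_def D'_def)
    ultimately have ex1: "\<exists>!h. h \<in> hom S z \<gamma> \<and> \<epsilon> y \<cdot>\<^bsub>S\<^esub> amap (prod_functor S f) h = (k \<cdot> \<tau>, y)"
      using adj y X z unfolding adjunction_def \<gamma>_def by (metis (no_types, lifting) SO)
    have amap: "\<epsilon> y \<cdot>\<^bsub>S\<^esub> amap (prod_functor S f) (g, \<gamma>) = (\<alpha> (g \<cdot> p\<^sub>1) p\<^sub>2, y)"
      if g [simp]: "g \<in> Arr C" "Dom C g = Dom C z" "Cod C g = Dom C \<gamma>" "\<gamma> \<cdot> g = z" for g
    proof -
      have "\<gamma> \<cdot> (g \<cdot> p\<^sub>1) = f \<cdot> p\<^sub>2"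
        using comp_right_cong1[OF g(4), of p\<^sub>1] by simp
      then show ?thesis
        by (simp add: prod_functor_def SA pS ey \<alpha>_def t)
    qed
    from ex1 obtain h where h: "h \<in> hom S z \<gamma>" "\<epsilon> y \<cdot>\<^bsub>S\<^esub> amap (prod_functor S f) h = (k \<cdot> \<tau>, y)"
      by blast
    obtain g where g: "h = (g, \<gamma>)" "g \<in> Arr C" "Cod C g = Dom C \<gamma>" "\<gamma> \<cdot> g = z"
      using h(1) unfolding S_def by (metis in_hom_sliceE)
    have dg: "Dom C g = Dom C z"
      using comp_typing(2)[of g \<gamma>] g by simp
    show ?thesis
    proof (rule ex1I[of _ g])
      show "g \<in> hom C (Dom C z) (Dom C \<gamma>) \<and> \<gamma> \<cdot> g = z \<and> \<alpha> (g \<cdot> ?m) ?a = k"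
        using h(2) g dg amap[of g] eq[of g] by (simp add: in_hom_iff)
      fix g' assume g': "g' \<in> hom C (Dom C z) (Dom C \<gamma>) \<and> \<gamma> \<cdot> g' = z \<and> \<alpha> (g' \<cdot> ?m) ?a = k"
      then have "(g', \<gamma>) \<in> hom S z \<gamma>" "\<epsilon> y \<cdot>\<^bsub>S\<^esub> amap (prod_functor S f) (g', \<gamma>) = (k \<cdot> \<tau>, y)"
        using amap[of g'] eq[of g'] by (simp_all add: in_hom_iff SA)
      with ex1 h g(1) have "(g', \<gamma>) = (g, \<gamma>)" by blast
      then show "g' = g" by simp
    qed
  qed
  show ?thesis
    unfolding is_slice_exponential_def
    using \<alpha> \<alpha>_comp univ by (intro exI[of _ \<gamma>] exI[of _ \<alpha>] conjI allI impI) simp_all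
qed

text \<open>A universal arrow from the pullback functor along \<open>f\<close> to \<open>q\<close>,
  with the slices unfolded: \<open>e\<close> is the underlying map of the counit component, and
  \<open>pb_pair\<close> is the action of the pullback functor on \<open>w\<close>.\<close>

definition is_dependent_product where
  "is_dependent_product f q \<pi> e \<longleftrightarrow> \<pi> \<in> Arr C \<and> Cod C \<pi> = Cod C f \<and>
    e \<in> Arr C \<and> Dom C e = pb_obj C f \<pi> \<and> Cod C e = Dom C q \<and> q \<cdot> e = pb_proj1 C f \<pi> \<and>
    (\<forall>z k. z \<in> Arr C \<longrightarrow> Cod C z = Cod C f \<longrightarrow> k \<in> Arr C \<longrightarrow> Dom C k = pb_obj C f z \<longrightarrow>
      Cod C k = Dom C q \<longrightarrow> q \<cdot> k = pb_proj1 C f z \<longrightarrow>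
      (\<exists>!w. w \<in> hom C (Dom C z) (Dom C \<pi>) \<and> \<pi> \<cdot> w = z \<and>
        e \<cdot> pb_pair C f \<pi> (pb_proj1 C f z) (w \<cdot> pb_proj2 C f z) = k))"

lemma ex_dependent_product:
  assumes f [simp]: "f \<in> Arr C" and q [simp]: "q \<in> Arr C" and qf [simp]: "Cod C q = Dom C f"
  shows "\<exists>\<pi> e. is_dependent_product f q \<pi> e"
proof -
  txt \<open>The dependent product is the pullback of \<open>Q = q\<^sup>f : (f q)\<^sup>f \<rightarrow> f\<^sup>f\<close> along the name \<open>N\<close> of the
    identity of \<open>f\<close>.\<close>
  define X where "X = Cod C f"
  have X [simp]: "Cod C f = X" by (simp add: X_def)
  have XO [simp]: "X \<in> Obj C" using Dom_Cod_Obj(2)[OF f] by simp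
  obtain \<gamma> \<alpha> where \<alpha>: "is_slice_exponential f (f \<cdot> q) \<gamma> \<alpha>"
    using ex_slice_exponential[of f "f \<cdot> q"] by auto
  have \<gamma> [simp]: "\<gamma> \<in> Arr C" "Cod C \<gamma> = X"
    using \<alpha> by (simp_all add: is_slice_exponential_def)
  have \<alpha>_typing [simp]: "\<alpha> g a \<in> Arr C" "Dom C (\<alpha> g a) = Dom C a" "Cod C (\<alpha> g a) = Dom C q"
    and \<alpha>_over0: "(f \<cdot> q) \<cdot> \<alpha> g a = f \<cdot> a"
    and \<alpha>_comp: "\<And>m. \<lbrakk>m \<in> Arr C; Cod C m = Dom C a\<rbrakk> \<Longrightarrow> \<alpha> g a \<cdot> m = \<alpha> (g \<cdot> m) (a \<cdot> m)"
    if "g \<in> Arr C" "a \<in> Arr C" "Cod C g = Dom C \<gamma>" "Cod C a = Dom C f" "Dom C g = Dom C a"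
      "\<gamma> \<cdot> g = f \<cdot> a" for g a
    using \<alpha> that by (simp_all add: is_slice_exponential_def del: comp_assoc)
  have \<alpha>_over [simp]: "f \<cdot> (q \<cdot> \<alpha> g a) = f \<cdot> a"
    if "g \<in> Arr C" "a \<in> Arr C" "Cod C g = Dom C \<gamma>" "Cod C a = Dom C f" "Dom C g = Dom C a"
      "\<gamma> \<cdot> g = f \<cdot> a" for g a
    using \<alpha>_over0[OF that] that by simp
  have \<alpha>_univ: "\<exists>!g. g \<in> hom C (Dom C z) (Dom C \<gamma>) \<and> \<gamma> \<cdot> g = z \<and>
      \<alpha> (g \<cdot> pb_proj2 C f z) (pb_proj1 C f z) = k"
    if "z \<in> Arr C" "Cod C z = X" "k \<in> Arr C" "Dom C k = pb_obj C f z"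
      "Cod C k = Dom C q" "(f \<cdot> q) \<cdot> k = f \<cdot> pb_proj1 C f z" for z k
    using \<alpha> that by (simp add: is_slice_exponential_def)
  obtain \<eta> \<theta> where \<theta>: "is_slice_exponential f f \<eta> \<theta>"
    using ex_slice_exponential[of f f] by auto
  have \<eta> [simp]: "\<eta> \<in> Arr C" "Cod C \<eta> = X"
    using \<theta> by (simp_all add: is_slice_exponential_def)
  have \<theta>_typing [simp]: "\<theta> g a \<in> Arr C" "Dom C (\<theta> g a) = Dom C a" "Cod C (\<theta> g a) = Dom C f"
    "f \<cdot> \<theta> g a = f \<cdot> a"
    and \<theta>_comp: "\<And>m. \<lbrakk>m \<in> Arr C; Cod C m = Dom C a\<rbrakk> \<Longrightarrow> \<theta> g a \<cdot> m = \<theta> (g \<cdot> m) (a \<cdot> m)"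
    if "g \<in> Arr C" "a \<in> Arr C" "Cod C g = Dom C \<eta>" "Cod C a = Dom C f" "Dom C g = Dom C a"
      "\<eta> \<cdot> g = f \<cdot> a" for g a
    using \<theta> that by (simp_all add: is_slice_exponential_def)
  have \<theta>_univ: "\<exists>!g. g \<in> hom C (Dom C z) (Dom C \<eta>) \<and> \<eta> \<cdot> g = z \<and>
      \<theta> (g \<cdot> pb_proj2 C f z) (pb_proj1 C f z) = k"
    if "z \<in> Arr C" "Cod C z = X" "k \<in> Arr C" "Dom C k = pb_obj C f z"
      "Cod C k = Dom C f" "f \<cdot> k = f \<cdot> pb_proj1 C f z" for z k
    using \<theta> that by (simp add: is_slice_exponential_def)
  have c: "\<gamma> \<cdot> pb_proj2 C f \<gamma> = f \<cdot> pb_proj1 C f \<gamma>"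
    by (simp add: pb_comm)
  \<comment> \<open>The transpose of \<open>q\<close> applied to the generic value, that is,
    postcomposition with \<open>q\<close>.\<close>
  obtain Q where "Q \<in> hom C (Dom C \<gamma>) (Dom C \<eta>)" and \<eta>Q: "\<eta> \<cdot> Q = \<gamma>"
    and Q_gen: "\<theta> (Q \<cdot> pb_proj2 C f \<gamma>) (pb_proj1 C f \<gamma>) = q \<cdot> \<alpha> (pb_proj2 C f \<gamma>) (pb_proj1 C f \<gamma>)"
    using \<theta>_univ[of \<gamma> "q \<cdot> \<alpha> (pb_proj2 C f \<gamma>) (pb_proj1 C f \<gamma>)"] c by auto
  then have Q [simp]: "Q \<in> Arr C" "Dom C Q = Dom C \<gamma>" "Cod C Q = Dom C \<eta>"
    by (simp_all add: in_hom_iff)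
  \<comment> \<open>Any compatible \<open>g\<close> and \<open>a\<close> factor through the generic
    pair by \<open>?m\<close>, so naturality of both evaluations extends the defining equation to
    all stages.\<close>
  have Q_eq: "\<theta> (Q \<cdot> g) a = q \<cdot> \<alpha> g a"
    if g [simp]: "g \<in> Arr C" "a \<in> Arr C" "Cod C g = Dom C \<gamma>" "Cod C a = Dom C f" "Dom C g = Dom C a"
      and ga: "\<gamma> \<cdot> g = f \<cdot> a" for g a
  proof -
    let ?m = "pb_pair C f \<gamma> a g"
    have 1: "\<eta> \<cdot> (Q \<cdot> pb_proj2 C f \<gamma>) = f \<cdot> pb_proj1 C f \<gamma>"
      using comp_right_cong1[OF \<eta>Q, of "pb_proj2 C f \<gamma>"] c by simp
    have "\<theta> (Q \<cdot> g) a = \<theta> (Q \<cdot> pb_proj2 C f \<gamma>) (pb_proj1 C f \<gamma>) \<cdot> ?m"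
      using ga 1 by (subst \<theta>_comp) simp_all
    also have "\<dots> = q \<cdot> \<alpha> g a"
      unfolding Q_gen using ga c \<alpha>_comp[of "pb_proj2 C f \<gamma>" "pb_proj1 C f \<gamma>" ?m] by simp
    finally show ?thesis .
  qed
  \<comment> \<open>The transpose of the identity at stage \<open>X\<close>. An equation
    \<open>Q \<cdot> g = N \<cdot> z\<close> then says that the family \<open>g\<close> consists of
    sections of \<open>q\<close>.\<close>
  obtain N where "N \<in> hom C X (Dom C \<eta>)" and \<eta>N: "\<eta> \<cdot> N = Ident C X"
    and N_gen: "\<theta> (N \<cdot> pb_proj2 C f (Ident C X)) (pb_proj1 C f (Ident C X)) = pb_proj1 C f (Ident C X)"
    using \<theta>_univ[of "Ident C X" "pb_proj1 C f (Ident C X)"] by auto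
  then have N [simp]: "N \<in> Arr C" "Dom C N = X" "Cod C N = Dom C \<eta>"
    by (simp_all add: in_hom_iff)
  have N_eq: "\<theta> (N \<cdot> z) a = a"
    if g [simp]: "z \<in> Arr C" "a \<in> Arr C" "Cod C z = X" "Cod C a = Dom C f" "Dom C z = Dom C a"
      and za: "z = f \<cdot> a" for z a
  proof -
    let ?I = "Ident C X"
    let ?m = "pb_pair C f ?I a z"
    have 1: "\<eta> \<cdot> (N \<cdot> pb_proj2 C f ?I) = f \<cdot> pb_proj1 C f ?I"
      using comp_right_cong1[OF \<eta>N, of "pb_proj2 C f ?I"] pb_comm[of f ?I] by simp
    \<comment> \<open>The identity is kept in place, since the rules for \<open>pb_pair\<close> ask
      for this form; hence the deletions of \<open>comp_ident\<close>.\<close>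
    have 2: "f \<cdot> a = ?I \<cdot> z" using za by simp
    have "\<theta> (N \<cdot> z) a = \<theta> (N \<cdot> pb_proj2 C f ?I) (pb_proj1 C f ?I) \<cdot> ?m"
      using pb_pair[of f ?I a z] 1 2 by (subst \<theta>_comp) (simp_all del: comp_ident pb_pair)
    also have "\<dots> = a"
      unfolding N_gen using pb_pair(4)[of f ?I a z] 2 by (simp del: comp_ident pb_pair)
    finally show ?thesis .
  qed
  define \<pi> where "\<pi> = pb_proj2 C Q N"
  define \<rho> where "\<rho> = pb_proj1 C Q N"
  have \<pi> [simp]: "\<pi> \<in> Arr C" "Cod C \<pi> = X" "Dom C \<pi> = pb_obj C Q N"
    and \<rho> [simp]: "\<rho> \<in> Arr C" "Cod C \<rho> = Dom C \<gamma>" "Dom C \<rho> = pb_obj C Q N"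
    and Q\<rho>: "Q \<cdot> \<rho> = N \<cdot> \<pi>"
    by (simp_all add: \<pi>_def \<rho>_def pb_comm)
  have \<gamma>\<rho>: "\<gamma> \<cdot> \<rho> = \<pi>"
    using comp_right_cong1[OF \<eta>Q, of \<rho>] comp_right_cong1[OF \<eta>N, of \<pi>] Q\<rho> by simp
  have cp: "\<pi> \<cdot> pb_proj2 C f \<pi> = f \<cdot> pb_proj1 C f \<pi>"
    by (simp add: pb_comm)
  have c\<rho>: "\<gamma> \<cdot> (\<rho> \<cdot> pb_proj2 C f \<pi>) = f \<cdot> pb_proj1 C f \<pi>"
    using comp_right_cong1[OF \<gamma>\<rho>, of "pb_proj2 C f \<pi>"] cp by simp
  \<comment> \<open>The counit evaluates the family underlying a section at the point of the fibre;
    the equations for \<open>Q\<close> and \<open>N\<close> put the result over that point.\<close>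
  define e where "e = \<alpha> (\<rho> \<cdot> pb_proj2 C f \<pi>) (pb_proj1 C f \<pi>)"
  have e [simp]: "e \<in> Arr C" "Dom C e = pb_obj C f \<pi>" "Cod C e = Dom C q"
    using c\<rho> by (simp_all add: e_def)
  have "q \<cdot> e = \<theta> (Q \<cdot> (\<rho> \<cdot> pb_proj2 C f \<pi>)) (pb_proj1 C f \<pi>)"
    unfolding e_def using c\<rho> by (simp add: Q_eq)
  also have "\<dots> = \<theta> (N \<cdot> (\<pi> \<cdot> pb_proj2 C f \<pi>)) (pb_proj1 C f \<pi>)"
    using comp_right_cong[OF Q\<rho>, of "pb_proj2 C f \<pi>"] by simp
  also have "\<dots> = pb_proj1 C f \<pi>"
    using cp by (intro N_eq) simp_all
  finally have qe: "q \<cdot> e = pb_proj1 C f \<pi>" .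
  have univ: "\<exists>!w. w \<in> hom C (Dom C z) (Dom C \<pi>) \<and> \<pi> \<cdot> w = z \<and>
        e \<cdot> pb_pair C f \<pi> (pb_proj1 C f z) (w \<cdot> pb_proj2 C f z) = k"
    if z [simp]: "z \<in> Arr C" "Cod C z = X"
      and k [simp]: "k \<in> Arr C" "Dom C k = pb_obj C f z" "Cod C k = Dom C q" "q \<cdot> k = pb_proj1 C f z" for z k
  proof -
    let ?a = "pb_proj1 C f z" and ?m = "pb_proj2 C f z"
    have am: "f \<cdot> ?a = z \<cdot> ?m" by (simp add: pb_comm)
    have e_pair: "e \<cdot> pb_pair C f \<pi> ?a (w \<cdot> ?m) = \<alpha> (\<rho> \<cdot> (w \<cdot> ?m)) ?a"
      if w [simp]: "w \<in> Arr C" "Dom C w = Dom C z" "Cod C w = Dom C \<pi>" "\<pi> \<cdot> w = z" for w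
    proof -
      have "f \<cdot> ?a = \<pi> \<cdot> (w \<cdot> ?m)"
        using comp_right_cong1[OF w(4), of ?m] am by simp
      then show ?thesis
        unfolding e_def using c\<rho> w by (subst \<alpha>_comp) simp_all
    qed
    have ex1: "\<exists>!g. g \<in> hom C (Dom C z) (Dom C \<gamma>) \<and> \<gamma> \<cdot> g = z \<and> \<alpha> (g \<cdot> ?m) ?a = k"
      by (rule \<alpha>_univ) simp_all
    then obtain g where "g \<in> hom C (Dom C z) (Dom C \<gamma>)" and \<gamma>g: "\<gamma> \<cdot> g = z" and g_eq: "\<alpha> (g \<cdot> ?m) ?a = k"
      by blast
    then have g [simp]: "g \<in> Arr C" "Dom C g = Dom C z" "Cod C g = Dom C \<gamma>"
      by (simp_all add: in_hom_iff)
    have c1: "\<gamma> \<cdot> (g \<cdot> ?m) = f \<cdot> ?a"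
      using comp_right_cong1[OF \<gamma>g, of ?m] am by simp
    \<comment> \<open>Both \<open>Q \<cdot> g\<close> and \<open>N \<cdot> z\<close> have the value
      \<open>?a\<close> at \<open>?a\<close>, so uniqueness for \<open>\<theta>\<close> identifies
      them and \<open>g\<close> lifts to the pullback.\<close>
    have "\<theta> ((Q \<cdot> g) \<cdot> ?m) ?a = ?a"
      using c1 g_eq by (simp add: Q_eq)
    moreover have "\<theta> ((N \<cdot> z) \<cdot> ?m) ?a = ?a"
      by (subst comp_assoc, simp_all, rule N_eq) (simp_all flip: am)
    moreover have "\<eta> \<cdot> (Q \<cdot> g) = z" "\<eta> \<cdot> (N \<cdot> z) = z"
      using comp_right_cong1[OF \<eta>Q, of g] comp_right_cong1[OF \<eta>N, of z] \<gamma>g by simp_all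
    moreover have "Q \<cdot> g \<in> hom C (Dom C z) (Dom C \<eta>)" "N \<cdot> z \<in> hom C (Dom C z) (Dom C \<eta>)"
      by (simp_all add: in_hom_iff)
    moreover have "\<exists>!h. h \<in> hom C (Dom C z) (Dom C \<eta>) \<and> \<eta> \<cdot> h = z \<and> \<theta> (h \<cdot> ?m) ?a = ?a"
      by (rule \<theta>_univ) simp_all
    ultimately have Qg: "Q \<cdot> g = N \<cdot> z" by blast
    define w where "w = pb_pair C Q N g z"
    have w [simp]: "w \<in> Arr C" "Dom C w = Dom C z" "Cod C w = pb_obj C Q N" "\<rho> \<cdot> w = g" "\<pi> \<cdot> w = z"
      using Qg by (simp_all add: w_def \<rho>_def \<pi>_def)
    show ?thesis
    proof (rule ex1I[of _ w])
      show "w \<in> hom C (Dom C z) (Dom C \<pi>) \<and> \<pi> \<cdot> w = z \<and> e \<cdot> pb_pair C f \<pi> ?a (w \<cdot> ?m) = k"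
        using comp_right_cong1[OF w(4), of ?m] g_eq by (simp add: in_hom_iff e_pair)
      fix v assume "v \<in> hom C (Dom C z) (Dom C \<pi>) \<and> \<pi> \<cdot> v = z \<and> e \<cdot> pb_pair C f \<pi> ?a (v \<cdot> ?m) = k"
      then have v [simp]: "v \<in> Arr C" "Dom C v = Dom C z" "Cod C v = pb_obj C Q N" and \<pi>v: "\<pi> \<cdot> v = z"
        and ve: "e \<cdot> pb_pair C f \<pi> ?a (v \<cdot> ?m) = k"
        by (simp_all add: in_hom_iff)
      \<comment> \<open>The first component of a competitor is forced by uniqueness of
        \<open>g\<close>, the second by the triangle over \<open>z\<close>.\<close>
      have "\<alpha> ((\<rho> \<cdot> v) \<cdot> ?m) ?a = k"
        using e_pair[of v] \<pi>v ve by simp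
      moreover have "\<gamma> \<cdot> (\<rho> \<cdot> v) = z"
        using comp_right_cong1[OF \<gamma>\<rho>, of v] \<pi>v by simp
      moreover have "\<rho> \<cdot> v \<in> hom C (Dom C z) (Dom C \<gamma>)" "g \<in> hom C (Dom C z) (Dom C \<gamma>)"
        by (simp_all add: in_hom_iff)
      ultimately have "\<rho> \<cdot> v = g"
        using ex1 \<gamma>g g_eq by blast
      then show "v = w"
        using \<pi>v w(4,5) by (rule_tac pb_ext[of Q N]) (simp_all flip: \<rho>_def \<pi>_def)
    qed
  qed
  show ?thesis
    unfolding is_dependent_product_def
    using qe univ by (intro exI[of _ \<pi>] exI[of _ e] conjI allI impI) simp_all
qed

text \<open>Dependent products are universal arrows from the pullback functor; what remains is to
  translate slice arrows, encoded as pairs, into underlying maps, which is the equivalence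
  \<open>*\<close>.\<close>

lemma ex_pushforward_adjunction:
  assumes p [simp]: "p \<in> Arr C"
  shows "\<exists>G \<epsilon>. adjunction (slice C (Cod C p)) (slice C (Dom C p)) (pullback_functor C p) G \<epsilon>"
proof -
  interpret S: binary_products "slice C (Cod C p)" by (rule binary_products_slice) simp
  interpret S': binary_products "slice C (Dom C p)" by (rule binary_products_slice) simp
  show ?thesis
  proof (rule adjunction_exI[OF S.category_axioms S'.category_axioms is_functor_pullback_functor[OF p]])
    fix q assume "q \<in> Obj (slice C (Dom C p))"
    then have q [simp]: "q \<in> Arr C" "Cod C q = Dom C p" by simp_all
    obtain \<pi> e where dp: "is_dependent_product p q \<pi> e"
      using ex_dependent_product[OF p q] by auto
    have \<pi> [simp]: "\<pi> \<in> Arr C" "Cod C \<pi> = Cod C p"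
      and e [simp]: "e \<in> Arr C" "Dom C e = pb_obj C p \<pi>" "Cod C e = Dom C q" "q \<cdot> e = pb_proj1 C p \<pi>"
      using dp by (simp_all add: is_dependent_product_def)
    have univ: "\<exists>!w. w \<in> hom C (Dom C z) (Dom C \<pi>) \<and> \<pi> \<cdot> w = z \<and>
        e \<cdot> pb_pair C p \<pi> (pb_proj1 C p z) (w \<cdot> pb_proj2 C p z) = k"
      if "z \<in> Arr C" "Cod C z = Cod C p" "k \<in> Arr C" "Dom C k = pb_obj C p z"
        "Cod C k = Dom C q" "q \<cdot> k = pb_proj1 C p z" for z k
      using dp that by (simp add: is_dependent_product_def)
    show "\<exists>g\<in>Obj (slice C (Cod C p)). \<exists>e\<in>hom (slice C (Dom C p)) (omap (pullback_functor C p) g) q.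
      \<forall>z\<in>Obj (slice C (Cod C p)). \<forall>f\<in>hom (slice C (Dom C p)) (omap (pullback_functor C p) z) q.
      \<exists>!h. h \<in> hom (slice C (Cod C p)) z g \<and> e \<cdot>\<^bsub>slice C (Dom C p)\<^esub> amap (pullback_functor C p) h = f"
    proof (intro bexI[of _ \<pi>] bexI[of _ "(e, q)"] ballI)
      fix z k' assume z: "z \<in> Obj (slice C (Cod C p))"
        and k': "k' \<in> hom (slice C (Dom C p)) (omap (pullback_functor C p) z) q"
      have z [simp]: "z \<in> Arr C" "Cod C z = Cod C p" using z by simp_all
      obtain k where k: "k' = (k, q)" and k1 [simp]: "k \<in> Arr C" "Cod C k = Dom C q" "q \<cdot> k = pb_proj1 C p z"
        using k' by (elim in_hom_sliceE) (simp add: pullback_functor_def)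
      have k2 [simp]: "Dom C k = pb_obj C p z"
        using comp_typing(2)[of k q] by simp
      let ?P = "\<lambda>w. w \<in> hom C (Dom C z) (Dom C \<pi>) \<and> \<pi> \<cdot> w = z \<and>
          e \<cdot> pb_pair C p \<pi> (pb_proj1 C p z) (w \<cdot> pb_proj2 C p z) = k"
      have *: "?P w \<longleftrightarrow> (w, \<pi>) \<in> hom (slice C (Cod C p)) z \<pi> \<and>
          (e, q) \<cdot>\<^bsub>slice C (Dom C p)\<^esub> amap (pullback_functor C p) (w, \<pi>) = k'" for w
        using comp_typing(2)[of w \<pi>] by (auto simp: in_hom_iff pullback_functor_def k)
      have "\<exists>!w. ?P w" by (rule univ) simp_all
      then obtain w where w: "?P w" and w_unique: "\<And>v. ?P v \<Longrightarrow> v = w"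
        by (elim ex1E) blast
      show "\<exists>!h. h \<in> hom (slice C (Cod C p)) z \<pi> \<and>
          (e, q) \<cdot>\<^bsub>slice C (Dom C p)\<^esub> amap (pullback_functor C p) h = k'"
      proof (rule ex1I[of _ "(w, \<pi>)"])
        fix h assume h: "h \<in> hom (slice C (Cod C p)) z \<pi> \<and>
          (e, q) \<cdot>\<^bsub>slice C (Dom C p)\<^esub> amap (pullback_functor C p) h = k'"
        then obtain v where "h = (v, \<pi>)" by (elim conjE in_hom_sliceE)
        then show "h = (w, \<pi>)" using w_unique[of v] h * by simp
      qed (use w * in blast)
    qed (simp_all add: pullback_functor_def)
  qed
qed

end

section \<open>Products and exponentials of the whole category\<close>

sublocale lccc \<subseteq> binary_products
proof
  fix a b assume [simp]: "a \<in> Obj C" "b \<in> Obj C"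
  obtain t where t: "t \<in> Obj C" "\<And>a. a \<in> Obj C \<Longrightarrow> \<exists>!f. f \<in> hom C a t"
    using ex_terminal unfolding is_terminal_def by blast
  obtain f g where f: "f \<in> hom C a t" and g: "g \<in> hom C b t"
    using t(2)[of a] t(2)[of b] by auto
  have fg [simp]: "f \<in> Arr C" "g \<in> Arr C" "Dom C f = a" "Dom C g = b" "Cod C f = t" "Cod C g = t"
    using f g by (simp_all add: in_hom_iff)
  \<comment> \<open>Over a terminal object any two arrows are compatible, so the pullback of the two
    arrows to \<open>t\<close> is a product.\<close>
  have "f \<cdot> u = g \<cdot> v" if "u \<in> hom C c a" "v \<in> hom C c b" "c \<in> Obj C" for c u v
  proof -
    have "f \<cdot> u \<in> hom C c t" "g \<cdot> v \<in> hom C c t"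
      using that by (simp_all add: in_hom_iff)
    then show ?thesis using t(2)[OF that(3)] by blast
  qed
  then have "is_product C a b (pb_obj C f g) (pb_proj1 C f g) (pb_proj2 C f g)"
    using is_pullback_pb_obj[of f g] by (simp add: is_pullback_def is_product_def)
  then show "\<exists>P \<pi>\<^sub>1 \<pi>\<^sub>2. is_product C a b P \<pi>\<^sub>1 \<pi>\<^sub>2" by (intro exI)
qed

text \<open>The slice over a terminal object \<open>t\<close> is the category itself up to
  equivalence, and it has exponentials. The object of paths in \<open>Y\<close> is
  \<open>Dom C \<gamma>\<close>; every condition of lying over \<open>t\<close> holds by
  \<open>b_eq\<close>.\<close>

lemma (in lccc) ex_exponential_adjunction:
  assumes I [simp]: "I \<in> Obj C"
  shows "\<exists>G \<epsilon>. adjunction C C (prod_functor C I) G \<epsilon>"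
proof (rule adjunction_exI[OF category_axioms category_axioms is_functor_prod_functor[OF I]])
  fix Y assume Y [simp]: "Y \<in> Obj C"
  obtain t where t: "t \<in> Obj C" "\<And>a. a \<in> Obj C \<Longrightarrow> \<exists>!f. f \<in> hom C a t"
    using ex_terminal unfolding is_terminal_def by blast
  define b where "b a = (THE f. f \<in> hom C a t)" for a
  have b [simp]: "b a \<in> Arr C" "Dom C (b a) = a" "Cod C (b a) = t" if "a \<in> Obj C" for a
    using theI'[OF t(2)[OF that]] by (simp_all add: b_def in_hom_iff)
  have b_eq: "f = f'" if "f \<in> Arr C" "f' \<in> Arr C" "Dom C f = Dom C f'" "Cod C f = t" "Cod C f' = t" for f f'
    using t(2)[of "Dom C f"] that by (auto simp: in_hom_iff)
  obtain \<gamma> \<alpha> where se: "is_slice_exponential (b I) (b Y) \<gamma> \<alpha>"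
    using ex_slice_exponential[of "b I" "b Y"] by auto
  have \<gamma> [simp]: "\<gamma> \<in> Arr C" "Cod C \<gamma> = t"
    using se by (simp_all add: is_slice_exponential_def)
  have \<alpha> [simp]: "\<alpha> g a \<in> Arr C" "Dom C (\<alpha> g a) = Dom C a" "Cod C (\<alpha> g a) = Y"
    "\<And>m. \<lbrakk>m \<in> Arr C; Cod C m = Dom C a\<rbrakk> \<Longrightarrow> \<alpha> g a \<cdot> m = \<alpha> (g \<cdot> m) (a \<cdot> m)"
    if "g \<in> Arr C" "a \<in> Arr C" "Cod C g = Dom C \<gamma>" "Cod C a = I" "Dom C g = Dom C a" for g a
    using se that b_eq[of "\<gamma> \<cdot> g" "b I \<cdot> a"] by (simp_all add: is_slice_exponential_def)
  have univ: "\<exists>!g. g \<in> hom C Z (Dom C \<gamma>) \<and> \<gamma> \<cdot> g = b Z \<and>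
      \<alpha> (g \<cdot> pb_proj2 C (b I) (b Z)) (pb_proj1 C (b I) (b Z)) = k"
    if "Z \<in> Obj C" "k \<in> Arr C" "Dom C k = pb_obj C (b I) (b Z)" "Cod C k = Y" for Z k
    using slice_exponential_univ[OF se, of "b Z" k] that b_eq[of "b Y \<cdot> k" "b I \<cdot> pb_proj1 C (b I) (b Z)"] by simp
  let ?G = "Dom C \<gamma>"
  define e where "e = \<alpha> (prod_proj1 C ?G I) (prod_proj2 C ?G I)"
  have e [simp]: "e \<in> Arr C" "Dom C e = prod_obj C ?G I" "Cod C e = Y"
    by (simp_all add: e_def)
  show "\<exists>g\<in>Obj C. \<exists>e\<in>hom C (omap (prod_functor C I) g) Y. \<forall>Z\<in>Obj C.
      \<forall>h\<in>hom C (omap (prod_functor C I) Z) Y. \<exists>!u. u \<in> hom C Z g \<and> e \<cdot> amap (prod_functor C I) u = h"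
  proof (intro bexI[of _ ?G] bexI[of _ e] ballI)
    fix Z h assume Z [simp]: "Z \<in> Obj C" and "h \<in> hom C (omap (prod_functor C I) Z) Y"
    then have h [simp]: "h \<in> Arr C" "Dom C h = prod_obj C Z I" "Cod C h = Y"
      by (simp_all add: in_hom_iff prod_functor_def)
    let ?p1 = "prod_proj1 C Z I" and ?p2 = "prod_proj2 C Z I"
    let ?a = "pb_proj1 C (b I) (b Z)" and ?m = "pb_proj2 C (b I) (b Z)"
    \<comment> \<open>Two models of the product of \<open>Z\<close> and \<open>I\<close> are
      compared: the chosen product and the chosen pullback over \<open>t\<close>.\<close>
    define \<tau> where "\<tau> = pb_pair C (b I) (b Z) ?p2 ?p1"
    define \<sigma> where "\<sigma> = prod_pair C Z I ?m ?a"
    have "b I \<cdot> ?p2 = b Z \<cdot> ?p1" by (rule b_eq) simp_all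
    then have \<tau> [simp]: "\<tau> \<in> Arr C" "Dom C \<tau> = prod_obj C Z I" "Cod C \<tau> = pb_obj C (b I) (b Z)"
      "?a \<cdot> \<tau> = ?p2" "?m \<cdot> \<tau> = ?p1"
      by (simp_all add: \<tau>_def)
    have \<sigma> [simp]: "\<sigma> \<in> Arr C" "Dom C \<sigma> = pb_obj C (b I) (b Z)" "Cod C \<sigma> = prod_obj C Z I"
      "?p1 \<cdot> \<sigma> = ?m" "?p2 \<cdot> \<sigma> = ?a"
      by (simp_all add: \<sigma>_def)
    have \<sigma>\<tau>: "\<sigma> \<cdot> \<tau> = Ident C (prod_obj C Z I)"
      by (simp add: \<sigma>_def)
    have iff: "e \<cdot> amap (prod_functor C I) u = h \<longleftrightarrow> \<gamma> \<cdot> u = b Z \<and> \<alpha> (u \<cdot> ?m) ?a = h \<cdot> \<sigma>"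
      if u: "u \<in> hom C Z ?G" for u
    proof -
      have u [simp]: "u \<in> Arr C" "Dom C u = Z" "Cod C u = ?G" using u by (simp_all add: in_hom_iff)
      have "\<gamma> \<cdot> u = b Z" by (rule b_eq) simp_all
      moreover have "e \<cdot> amap (prod_functor C I) u = \<alpha> (u \<cdot> ?p1) ?p2"
        by (simp add: e_def prod_functor_def)
      moreover have "\<alpha> (u \<cdot> ?p1) ?p2 \<cdot> \<sigma> = \<alpha> (u \<cdot> ?m) ?a" "\<alpha> (u \<cdot> ?m) ?a \<cdot> \<tau> = \<alpha> (u \<cdot> ?p1) ?p2"
        by simp_all
      moreover have "(h \<cdot> \<sigma>) \<cdot> \<tau> = h"
        using \<sigma>\<tau> by simp
      ultimately show ?thesis by metis
    qed
    have "\<exists>!u. u \<in> hom C Z ?G \<and> \<gamma> \<cdot> u = b Z \<and> \<alpha> (u \<cdot> ?m) ?a = h \<cdot> \<sigma>"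
      by (rule univ) simp_all
    then show "\<exists>!u. u \<in> hom C Z ?G \<and> e \<cdot> amap (prod_functor C I) u = h"
      using iff by metis
  qed (simp_all add: in_hom_iff prod_functor_def)
qed

lemma adjunction_right_adjoint:
  assumes "\<exists>G \<epsilon>. adjunction C D F G \<epsilon>"
  shows "adjunction C D F (fst (right_adjoint C D F)) (snd (right_adjoint C D F))"
proof -
  have "\<exists>t. adjunction C D F (fst t) (snd t)"
    using assms by auto
  from someI_ex[OF this] show ?thesis
    by (simp add: right_adjoint_def case_prod_unfold)
qed

section \<open>Generalised elements of path objects and pushforwards\<close>

locale lccc_interval = lccc +
  fixes I :: 'a
  assumes I_Obj [simp]: "I \<in> Obj C"
begin

section \<open>Values and abstraction of paths\<close>

abbreviation Exp :: "'a \<Rightarrow> 'a" where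
  "Exp X \<equiv> omap (exp_functor C I) X"

abbreviation exp_map :: "'b \<Rightarrow> 'b" where
  "exp_map f \<equiv> amap (exp_functor C I) f"

abbreviation times_I :: "'b \<Rightarrow> 'b" where
  "times_I f \<equiv> amap (prod_functor C I) f"

abbreviation fst_I :: "'a \<Rightarrow> 'b" where
  "fst_I X \<equiv> prod_proj1 C X I"

abbreviation snd_I :: "'a \<Rightarrow> 'b" where
  "snd_I X \<equiv> prod_proj2 C X I"

definition ap :: "'a \<Rightarrow> 'b \<Rightarrow> 'b \<Rightarrow> 'b" where
  "ap X w j = eval_map C I X \<cdot> prod_pair C (Exp X) I w j"

lemma exp_adjunction: "adjunction C C (prod_functor C I) (exp_functor C I) (eval_map C I)"
  unfolding exp_functor_def eval_map_def
  by (rule adjunction_right_adjoint[OF ex_exponential_adjunction[OF I_Obj]])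

lemma times_I_typing [simp]:
  assumes "f \<in> Arr C"
  shows "times_I f \<in> Arr C" "Dom C (times_I f) = prod_obj C (Dom C f) I" "Cod C (times_I f) = prod_obj C (Cod C f) I"
  using assms by (simp_all add: prod_functor_def)

lemma times_I_proj [simp]:
  assumes "f \<in> Arr C" "Cod C f = b"
  shows "fst_I b \<cdot> times_I f = f \<cdot> fst_I (Dom C f)" "snd_I b \<cdot> times_I f = snd_I (Dom C f)"
  using assms by (auto simp add: prod_functor_def)

lemma times_I_proj_comp [simp]:
  assumes "f \<in> Arr C" "Cod C f = b" "w \<in> Arr C" "Cod C w = prod_obj C (Dom C f) I"
  shows "fst_I b \<cdot> (times_I f \<cdot> w) = f \<cdot> (fst_I (Dom C f) \<cdot> w)" "snd_I b \<cdot> (times_I f \<cdot> w) = snd_I (Dom C f) \<cdot> w"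
  using assms comp_right_cong1[OF times_I_proj(1)[OF assms(1,2)], of w]
    comp_right_cong1[OF times_I_proj(2)[OF assms(1,2)], of w] by auto

lemma Exp_Obj [simp]: "X \<in> Obj C \<Longrightarrow> Exp X \<in> Obj C"
  using exp_adjunction by (simp add: adjunction_def is_functor_def)

lemma exp_map_typing [simp]:
  assumes "f \<in> Arr C"
  shows "exp_map f \<in> Arr C" "Dom C (exp_map f) = Exp (Dom C f)" "Cod C (exp_map f) = Exp (Cod C f)"
  using exp_adjunction assms by (simp_all add: adjunction_def is_functor_def in_hom_iff)

lemma eval_typing [simp]:
  assumes "X \<in> Obj C"
  shows "eval_map C I X \<in> Arr C" "Dom C (eval_map C I X) = prod_obj C (Exp X) I" "Cod C (eval_map C I X) = X"
  using exp_adjunction assms by (simp_all add: adjunction_def in_hom_iff prod_functor_def)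

lemma eval_natural:
  assumes "f \<in> Arr C"
  shows "eval_map C I (Cod C f) \<cdot> times_I (exp_map f) = f \<cdot> eval_map C I (Dom C f)"
  using exp_adjunction assms by (simp add: adjunction_def)

text \<open>Brings every evaluation into the form with separate path and point, on which the rules
  for \<open>ap\<close> act.\<close>

lemma eval_comp:
  assumes "X \<in> Obj C" "w \<in> Arr C" "Cod C w = prod_obj C (Exp X) I"
  shows "eval_map C I X \<cdot> w = ap X (fst_I (Exp X) \<cdot> w) (snd_I (Exp X) \<cdot> w)"
  using assms by (simp add: ap_def prod_pair_eta)

lemma ap_typing [simp]:
  assumes "X \<in> Obj C" "w \<in> Arr C" "j \<in> Arr C" "Dom C w = Dom C j" "Cod C w = Exp X" "Cod C j = I"
  shows "ap X w j \<in> Arr C" "Dom C (ap X w j) = Dom C j" "Cod C (ap X w j) = X"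
  using assms by (simp_all add: ap_def)

lemma ap_comp [simp]:
  assumes "X \<in> Obj C" "w \<in> Arr C" "j \<in> Arr C" "Dom C w = Dom C j" "Cod C w = Exp X" "Cod C j = I"
    "m \<in> Arr C" "Cod C m = Dom C j"
  shows "ap X w j \<cdot> m = ap X (w \<cdot> m) (j \<cdot> m)"
  using assms by (simp add: ap_def)

text \<open>Naturality of the counit at a generalised element: a path is mapped by mapping its
  values.\<close>

lemma ap_exp_map [simp]:
  assumes "f \<in> Arr C" "Cod C f = X" "w \<in> Arr C" "j \<in> Arr C" "Dom C w = Dom C j" "Cod C w = Exp (Dom C f)" "Cod C j = I"
  shows "ap X (exp_map f \<cdot> w) j = f \<cdot> ap (Dom C f) w j"
proof -
  let ?w = "prod_pair C (Exp (Dom C f)) I w j"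
  have X: "X \<in> Obj C" using assms(1,2) by auto
  have "ap X (exp_map f \<cdot> w) j = eval_map C I X \<cdot> (times_I (exp_map f) \<cdot> ?w)"
    using assms X by (simp add: eval_comp)
  also have "\<dots> = f \<cdot> (eval_map C I (Dom C f) \<cdot> ?w)"
    using assms X eval_natural[of f] by (intro comp_right_cong) simp_all
  finally show ?thesis by (simp add: ap_def)
qed

lemma ex1_curry:
  assumes "Z \<in> Obj C" "X \<in> Obj C" "h \<in> hom C (prod_obj C Z I) X"
  shows "\<exists>!w. w \<in> hom C Z (Exp X) \<and> eval_map C I X \<cdot> times_I w = h"
proof -
  have "h \<in> hom C (omap (prod_functor C I) Z) X"
    using assms(3) by (simp add: prod_functor_def)
  with exp_adjunction assms(1,2) show ?thesis
    unfolding adjunction_def by blast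
qed

text \<open>The uniqueness half of currying. A single value suffices, that at the generic point
  \<open>snd_I Z\<close> after enlarging the stage from \<open>Z\<close> to its product with
  \<open>I\<close>.\<close>

lemma exp_ext:
  assumes "X \<in> Obj C" "w \<in> Arr C" "w' \<in> Arr C" "Dom C w = Z" "Dom C w' = Z" "Cod C w = Exp X" "Cod C w' = Exp X"
    "ap X (w \<cdot> fst_I Z) (snd_I Z) = ap X (w' \<cdot> fst_I Z) (snd_I Z)"
  shows "w = w'"
proof -
  have Z: "Z \<in> Obj C" using assms(2,4) by auto
  have "eval_map C I X \<cdot> times_I v = ap X (v \<cdot> fst_I Z) (snd_I Z)"
    if "v \<in> Arr C" "Dom C v = Z" "Cod C v = Exp X" for v
    using assms(1) that by (simp add: eval_comp)
  moreover have "w \<in> hom C Z (Exp X)" "w' \<in> hom C Z (Exp X)" 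
      "ap X (w \<cdot> fst_I Z) (snd_I Z) \<in> hom C (prod_obj C Z I) X"
    using assms Z by (simp_all add: in_hom_iff)
  ultimately show ?thesis
    using ex1_curry[OF Z assms(1)] assms by metis
qed

text \<open>The existence half of currying, with its equation already extended from the generic
  point to all points at all stages.\<close>

lemma exp_lambda:
  assumes [simp]: "Z \<in> Obj C" "X \<in> Obj C" "h \<in> Arr C" "Dom C h = prod_obj C Z I" "Cod C h = X"
  obtains w where "w \<in> Arr C" "Dom C w = Z" "Cod C w = Exp X"
    "\<And>m j. \<lbrakk>m \<in> Arr C; j \<in> Arr C; Cod C m = Z; Dom C m = Dom C j; Cod C j = I\<rbrakk> \<Longrightarrow>
      ap X (w \<cdot> m) j = h \<cdot> prod_pair C Z I m j"
proof -
  obtain w where "w \<in> hom C Z (Exp X)" and eq: "eval_map C I X \<cdot> times_I w = h"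
    using ex1_curry[of Z X h] by (auto simp: in_hom_iff)
  then have w [simp]: "w \<in> Arr C" "Dom C w = Z" "Cod C w = Exp X" by (simp_all add: in_hom_iff)
  have "ap X (w \<cdot> m) j = h \<cdot> prod_pair C Z I m j"
    if [simp]: "m \<in> Arr C" "j \<in> Arr C" "Cod C m = Z" "Dom C m = Dom C j" "Cod C j = I" for m j
    using comp_right_cong1[OF eq, of "prod_pair C Z I m j"] by (simp add: eval_comp)
  with w show thesis by (rule that)
qed

section \<open>Application and abstraction of sections\<close>

abbreviation Pi :: "'b \<Rightarrow> 'b \<Rightarrow> 'b" where
  "Pi f q \<equiv> omap (pushforward C f) q"

definition push_counit :: "'b \<Rightarrow> 'b \<Rightarrow> 'b \<times> 'b" where
  "push_counit f = snd (right_adjoint (slice C (Cod C f)) (slice C (Dom C f)) (pullback_functor C f))"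

text \<open>A generalised element \<open>w\<close> of \<open>\<Pi>\<^sub>A B\<close> over \<open>x\<close> is a section of \<open>q\<close> over the fibre of \<open>f\<close> at
  \<open>x\<close>; \<open>App f q w a\<close> is its value at a generalised element \<open>a\<close> of that fibre.\<close>

definition App :: "'b \<Rightarrow> 'b \<Rightarrow> 'b \<Rightarrow> 'b \<Rightarrow> 'b" where
  "App f q w a = fst (push_counit f q) \<cdot> pb_pair C f (Pi f q) a w"

lemma pushforward_adjunction:
  assumes "f \<in> Arr C"
  shows "adjunction (slice C (Cod C f)) (slice C (Dom C f)) (pullback_functor C f) (pushforward C f) (push_counit f)"
  unfolding pushforward_def push_counit_def
  by (rule adjunction_right_adjoint[OF ex_pushforward_adjunction[OF assms]])

lemma Pi_typing [simp]:
  assumes "f \<in> Arr C" "q \<in> Arr C" "Cod C q = Dom C f"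
  shows "Pi f q \<in> Arr C" "Cod C (Pi f q) = Cod C f"
  using pushforward_adjunction[OF assms(1)] assms by (simp_all add: adjunction_def is_functor_def)

lemma push_counit:
  assumes "f \<in> Arr C" "q \<in> Arr C" "Cod C q = Dom C f"
  shows "push_counit f q = (fst (push_counit f q), q)"
    "fst (push_counit f q) \<in> Arr C" "Dom C (fst (push_counit f q)) = pb_obj C f (Pi f q)"
    "Cod C (fst (push_counit f q)) = Dom C q" "q \<cdot> fst (push_counit f q) = pb_proj1 C f (Pi f q)"
proof -
  have "push_counit f q \<in> hom (slice C (Dom C f)) (pb_proj1 C f (Pi f q)) q"
    using pushforward_adjunction[OF assms(1)] assms(2,3) by (simp add: adjunction_def pullback_functor_def)
  then show *: "push_counit f q = (fst (push_counit f q), q)" "fst (push_counit f q) \<in> Arr C"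
    "Cod C (fst (push_counit f q)) = Dom C q" "q \<cdot> fst (push_counit f q) = pb_proj1 C f (Pi f q)"
    by (metis in_hom_sliceE prod.sel(1))+
  show "Dom C (fst (push_counit f q)) = pb_obj C f (Pi f q)"
    using comp_typing(2)[of "fst (push_counit f q)" q] * assms by simp
qed

lemma App_typing [simp]:
  assumes "f \<in> Arr C" "q \<in> Arr C" "Cod C q = Dom C f" "w \<in> Arr C" "a \<in> Arr C"
    "Cod C w = Dom C (Pi f q)" "Cod C a = Dom C f" "Dom C w = Dom C a" "f \<cdot> a = Pi f q \<cdot> w"
  shows "App f q w a \<in> Arr C" "Dom C (App f q w a) = Dom C a" "Cod C (App f q w a) = Dom C q"
    "q \<cdot> App f q w a = a"
  using assms push_counit(2-5)[OF assms(1-3)]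
    comp_right_cong1[OF push_counit(5)[OF assms(1-3)], of "pb_pair C f (Pi f q) a w"]
  by (simp_all add: App_def)

lemma App_comp:
  assumes "f \<in> Arr C" "q \<in> Arr C" "Cod C q = Dom C f" "w \<in> Arr C" "a \<in> Arr C"
    "Cod C w = Dom C (Pi f q)" "Cod C a = Dom C f" "Dom C w = Dom C a" "f \<cdot> a = Pi f q \<cdot> w"
    "m \<in> Arr C" "Cod C m = Dom C a"
  shows "App f q w a \<cdot> m = App f q (w \<cdot> m) (a \<cdot> m)"
  using assms push_counit(2-5)[OF assms(1-3)] by (simp add: App_def)

text \<open>The universal property of the counit of the pushforward, with slice arrows replaced by
  underlying maps and the counit absorbed into \<open>App\<close>.\<close>

lemma ex1_push_curry:
  assumes f [simp]: "f \<in> Arr C" "q \<in> Arr C" "Cod C q = Dom C f" and z [simp]: "z \<in> Arr C" "Cod C z = Cod C f"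
    and k [simp]: "k \<in> Arr C" "Cod C k = Dom C q" "q \<cdot> k = pb_proj1 C f z"
  shows "\<exists>!w. w \<in> Arr C \<and> Dom C w = Dom C z \<and> Cod C w = Dom C (Pi f q) \<and> Pi f q \<cdot> w = z \<and>
    App f q (w \<cdot> pb_proj2 C f z) (pb_proj1 C f z) = k"
proof -
  let ?S = "slice C (Cod C f)" and ?S' = "slice C (Dom C f)"
  have "z \<in> Obj ?S" "q \<in> Obj ?S'" "(k, q) \<in> hom ?S' (omap (pullback_functor C f) z) q"
    by (simp_all add: pullback_functor_def)
  then have ex1: "\<exists>!h. h \<in> hom ?S z (Pi f q) \<and> push_counit f q \<cdot>\<^bsub>?S'\<^esub> amap (pullback_functor C f) h = (k, q)"
    using pushforward_adjunction[OF f(1)] unfolding adjunction_def by blast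
  have *: "(w, Pi f q) \<in> hom ?S z (Pi f q) \<and>
      push_counit f q \<cdot>\<^bsub>?S'\<^esub> amap (pullback_functor C f) (w, Pi f q) = (k, q) \<longleftrightarrow>
    w \<in> Arr C \<and> Dom C w = Dom C z \<and> Cod C w = Dom C (Pi f q) \<and> Pi f q \<cdot> w = z \<and>
    App f q (w \<cdot> pb_proj2 C f z) (pb_proj1 C f z) = k" for w
    using comp_typing(2)[of w "Pi f q"]
    by (subst push_counit(1)[OF f]) (auto simp: pullback_functor_def App_def)
  obtain h where h: "h \<in> hom ?S z (Pi f q)" "push_counit f q \<cdot>\<^bsub>?S'\<^esub> amap (pullback_functor C f) h = (k, q)"
    using ex1 by blast
  then obtain w where w: "h = (w, Pi f q)" by (elim in_hom_sliceE)
  show ?thesis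
  proof (rule ex1I[of _ w])
    fix w' assume "w' \<in> Arr C \<and> Dom C w' = Dom C z \<and> Cod C w' = Dom C (Pi f q) \<and> Pi f q \<cdot> w' = z \<and>
      App f q (w' \<cdot> pb_proj2 C f z) (pb_proj1 C f z) = k"
    then show "w' = w"
      using ex1 h w *[of w'] by (metis prod.inject)
  qed (use h w * in blast)
qed

text \<open>Taking the last premise at the projections of the pullback of \<open>f\<close> and
  \<open>Pi f q \<cdot> w'\<close>, the generic point of the fibre, reduces the claim to uniqueness
  of transposes.\<close>

lemma push_ext:
  assumes f: "f \<in> Arr C" "q \<in> Arr C" "Cod C q = Dom C f"
    and w [simp]: "w \<in> Arr C" "w' \<in> Arr C" "Dom C w = Dom C w'" "Cod C w = Dom C (Pi f q)" "Cod C w' = Dom C (Pi f q)"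
    and over: "Pi f q \<cdot> w = Pi f q \<cdot> w'"
    and eq: "\<And>m a. \<lbrakk>m \<in> Arr C; a \<in> Arr C; Cod C m = Dom C w'; Dom C m = Dom C a; Cod C a = Dom C f;
      f \<cdot> a = Pi f q \<cdot> (w' \<cdot> m)\<rbrakk> \<Longrightarrow> App f q (w \<cdot> m) a = App f q (w' \<cdot> m) a"
  shows "w = w'"
proof -
  note f [simp]
  define z where "z = Pi f q \<cdot> w'"
  have z [simp]: "z \<in> Arr C" "Cod C z = Cod C f" "Dom C z = Dom C w'" by (simp_all add: z_def)
  let ?a = "pb_proj1 C f z" and ?m = "pb_proj2 C f z"
  have am: "f \<cdot> ?a = Pi f q \<cdot> (w' \<cdot> ?m)"
    using pb_comm[of f z] by (simp add: z_def)
  have "App f q (w \<cdot> ?m) ?a = App f q (w' \<cdot> ?m) ?a"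
    using am by (intro eq) simp_all
  moreover have "Pi f q \<cdot> w = z" "Pi f q \<cdot> w' = z"
    using over by (simp_all add: z_def)
  moreover have "\<exists>!v. v \<in> Arr C \<and> Dom C v = Dom C z \<and> Cod C v = Dom C (Pi f q) \<and> Pi f q \<cdot> v = z \<and>
      App f q (v \<cdot> ?m) ?a = App f q (w' \<cdot> ?m) ?a"
    using am by (intro ex1_push_curry[OF f z(1,2)]) simp_all
  ultimately show ?thesis
    using w z(3) by metis
qed

lemma push_lambda:
  assumes f [simp]: "f \<in> Arr C" "q \<in> Arr C" "Cod C q = Dom C f" and z [simp]: "z \<in> Arr C" "Cod C z = Cod C f"
    and k [simp]: "k \<in> Arr C" "Cod C k = Dom C q" "q \<cdot> k = pb_proj1 C f z"
  obtains w where "w \<in> Arr C" "Dom C w = Dom C z" "Cod C w = Dom C (Pi f q)" "Pi f q \<cdot> w = z"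
    "\<And>m a. \<lbrakk>m \<in> Arr C; a \<in> Arr C; Cod C m = Dom C z; Dom C m = Dom C a; Cod C a = Dom C f;
      f \<cdot> a = z \<cdot> m\<rbrakk> \<Longrightarrow> App f q (w \<cdot> m) a = k \<cdot> pb_pair C f z a m"
proof -
  obtain w where w [simp]: "w \<in> Arr C" "Dom C w = Dom C z" "Cod C w = Dom C (Pi f q)" and wz: "Pi f q \<cdot> w = z"
    and wk: "App f q (w \<cdot> pb_proj2 C f z) (pb_proj1 C f z) = k"
    using ex1_push_curry[OF f z k] by (elim ex1E conjE)
  have "App f q (w \<cdot> m) a = k \<cdot> pb_pair C f z a m"
    if [simp]: "m \<in> Arr C" "a \<in> Arr C" "Cod C m = Dom C z" "Dom C m = Dom C a" "Cod C a = Dom C f"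
      "f \<cdot> a = z \<cdot> m" for m a
  proof -
    have "f \<cdot> pb_proj1 C f z = Pi f q \<cdot> (w \<cdot> pb_proj2 C f z)"
      using comp_right_cong1[OF wz, of "pb_proj2 C f z"] pb_comm[of f z] by simp
    then show ?thesis
      unfolding wk[symmetric] by (subst App_comp) simp_all
  qed
  with w wz show thesis by (rule that)
qed

lemma push_map_typing:
  assumes "f \<in> Arr C" "q \<in> Arr C" "r \<in> Arr C" "Cod C r = Dom C q" "Cod C q = Dom C f"
  defines "t \<equiv> fst (amap (pushforward C f) (r, q))"
  shows "t \<in> Arr C" "Dom C t = Dom C (Pi f (q \<cdot> r))" "Cod C t = Dom C (Pi f q)" "Pi f q \<cdot> t = Pi f (q \<cdot> r)"
    "amap (pushforward C f) (r, q) = (t, Pi f q)"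
proof -
  have "(r, q) \<in> Arr (slice C (Dom C f))" using assms by simp
  then have "amap (pushforward C f) (r, q) \<in> hom (slice C (Cod C f)) (Pi f (q \<cdot> r)) (Pi f q)"
    using pushforward_adjunction[OF assms(1)] unfolding adjunction_def is_functor_def
    by (metis slice_simps(3,4))
  then show *: "t \<in> Arr C" "Cod C t = Dom C (Pi f q)" "Pi f q \<cdot> t = Pi f (q \<cdot> r)"
    "amap (pushforward C f) (r, q) = (t, Pi f q)"
    unfolding t_def by (metis in_hom_sliceE prod.sel(1))+
  show "Dom C t = Dom C (Pi f (q \<cdot> r))"
    using comp_typing(2)[of t "Pi f q"] * assms(1-5) by simp
qed

lemmas push_map_simps [simp] = push_map_typing(1-4)

text \<open>Naturality of the counit: the pushforward of \<open>r\<close> acts on sections by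
  composing their values with \<open>r\<close>.\<close>

lemma App_push_map:
  assumes [simp]: "f \<in> Arr C" "q \<in> Arr C" "r \<in> Arr C" "Cod C r = Dom C q" "Cod C q = Dom C f"
    "w \<in> Arr C" "a \<in> Arr C" "Cod C w = Dom C (Pi f (q \<cdot> r))" "Cod C a = Dom C f" "Dom C w = Dom C a"
    and fa: "f \<cdot> a = Pi f (q \<cdot> r) \<cdot> w"
  shows "App f q (fst (amap (pushforward C f) (r, q)) \<cdot> w) a = r \<cdot> App f (q \<cdot> r) w a"
proof -
  let ?S' = "slice C (Dom C f)" and ?t = "fst (amap (pushforward C f) (r, q))" and ?q = "q \<cdot> r"
  let ?\<epsilon> = "fst (push_counit f q)" and ?\<epsilon>' = "fst (push_counit f ?q)"
  have "(r, q) \<in> Arr ?S'" by simp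
  then have "(r, q) \<cdot>\<^bsub>?S'\<^esub> push_counit f ?q =
      push_counit f q \<cdot>\<^bsub>?S'\<^esub> amap (pullback_functor C f) (amap (pushforward C f) (r, q))"
    using pushforward_adjunction[of f] unfolding adjunction_def by (metis assms(1) slice_simps(3,4))
  moreover have "push_counit f ?q = (?\<epsilon>', ?q)" "push_counit f q = (?\<epsilon>, q)"
    "amap (pushforward C f) (r, q) = (?t, Pi f q)"
    by (rule push_counit push_map_typing; simp)+
  ultimately have "(r, q) \<cdot>\<^bsub>?S'\<^esub> (?\<epsilon>', ?q) = (?\<epsilon>, q) \<cdot>\<^bsub>?S'\<^esub> amap (pullback_functor C f) (?t, Pi f q)"
    by metis
  then have nat: "r \<cdot> ?\<epsilon>' = ?\<epsilon> \<cdot> pb_pair C f (Pi f q) (pb_proj1 C f (Pi f ?q)) (?t \<cdot> pb_proj2 C f (Pi f ?q))"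
    by (simp add: pullback_functor_def)
  have c1: "f \<cdot> pb_proj1 C f (Pi f ?q) = Pi f q \<cdot> (?t \<cdot> pb_proj2 C f (Pi f ?q))"
    using comp_right_cong1[of "Pi f q" ?t "Pi f ?q" "pb_proj2 C f (Pi f ?q)"] by (simp add: pb_comm)
  have "r \<cdot> App f ?q w a = (r \<cdot> ?\<epsilon>') \<cdot> pb_pair C f (Pi f ?q) a w"
    using fa push_counit[of f ?q] by (simp add: App_def)
  also have "\<dots> = App f q (?t \<cdot> w) a"
    unfolding nat App_def using fa c1 push_counit[of f q] by simp
  finally show ?thesis by simp
qed

lemma delta_imp:
  assumes p [simp]: "p \<in> Arr C"
  shows "delta_imp C I p \<in> Arr C" "Dom C (delta_imp C I p) = prod_obj C (Exp (Dom C p)) I"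
    "Cod C (delta_imp C I p) = pb_obj C (eval_map C I (Cod C p)) p"
    "pb_proj1 C (eval_map C I (Cod C p)) p \<cdot> delta_imp C I p = times_I (exp_map p)"
    "pb_proj2 C (eval_map C I (Cod C p)) p \<cdot> delta_imp C I p = eval_map C I (Dom C p)"
  by (simp_all add: delta_imp_def eval_natural)

end

section \<open>The retract diagram\<close>

locale pushforward_setup = lccc_interval +
  fixes p q s :: 'b
  assumes p [simp]: "p \<in> Arr C" and q [simp]: "q \<in> Arr C" "Cod C q = Dom C p"
    and s [simp]: "s \<in> Arr C" "Dom C s = pb_obj C (eval_map C I (Cod C p)) p" "Cod C s = prod_obj C (Exp (Dom C p)) I"
    and delta_s: "delta_imp C I p \<cdot> s = Ident C (pb_obj C (eval_map C I (Cod C p)) p)"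
begin

section \<open>The maps to be compared, and the lifting given by \<open>s\<close>\<close>

abbreviation A where "A \<equiv> Dom C p"
abbreviation X where "X \<equiv> Cod C p"
abbreviation B where "B \<equiv> Dom C q"
abbreviation \<pi> where "\<pi> \<equiv> Pi p q"
abbreviation P where "P \<equiv> Dom C (Pi p q)"
abbreviation f where "f \<equiv> times_I (exp_map p)"
abbreviation \<kappa> where "\<kappa> \<equiv> times_I (exp_map q)"
abbreviation \<zeta> where "\<zeta> \<equiv> times_I (exp_map (Pi p q))"
text \<open>Since \<open>\<kappa>\<close> is the composite of \<open>delta_imp C I q\<close> with
  \<open>\<beta>\<close>, that map is an arrow from \<open>\<kappa>\<close> to
  \<open>\<beta>\<close> in the slice over the domain of \<open>f\<close>, and can be pushed forward
  along \<open>f\<close>.\<close>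

abbreviation \<beta> where "\<beta> \<equiv> pb_proj1 C (eval_map C I A) q"
abbreviation ev\<^sub>A where "ev\<^sub>A \<equiv> eval_map C I A"
abbreviation ev\<^sub>X where "ev\<^sub>X \<equiv> eval_map C I X"

text \<open>Here \<open>x\<close> carries both a path in \<open>X\<close> and a point of
  \<open>I\<close>. The result is a path in \<open>A\<close> over that path, with the same point,
  whose value there is \<open>a\<close>.\<close>

definition lift :: "'b \<Rightarrow> 'b \<Rightarrow> 'b" where
  "lift x a = s \<cdot> pb_pair C ev\<^sub>X p x a"

text \<open>The section equation says that \<open>delta_imp C I p\<close> maps
  \<open>lift x a\<close> to the pair of \<open>x\<close> and \<open>a\<close>; the two projections
  of the pullback give the base and the value.\<close>

lemma lift [simp]:
  assumes [simp]: "x \<in> Arr C" "a \<in> Arr C" "Cod C x = prod_obj C (Exp X) I" "Cod C a = A" "Dom C x = Dom C a"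
    and xa: "p \<cdot> a = ev\<^sub>X \<cdot> x"
  shows "lift x a \<in> Arr C" "Dom C (lift x a) = Dom C a" "Cod C (lift x a) = prod_obj C (Exp A) I"
    "f \<cdot> lift x a = x" "ev\<^sub>A \<cdot> lift x a = a"
    "snd_I (Exp A) \<cdot> lift x a = snd_I (Exp X) \<cdot> x"
    "exp_map p \<cdot> (fst_I (Exp A) \<cdot> lift x a) = fst_I (Exp X) \<cdot> x"
proof -
  let ?u = "pb_pair C ev\<^sub>X p x a"
  show typing: "lift x a \<in> Arr C" "Dom C (lift x a) = Dom C a" "Cod C (lift x a) = prod_obj C (Exp A) I"
    using xa by (simp_all add: lift_def)
  have "delta_imp C I p \<cdot> lift x a = ?u"
    using comp_right_cong1[OF delta_s, of ?u] xa by (simp add: lift_def delta_imp)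
  then show fl: "f \<cdot> lift x a = x" and "ev\<^sub>A \<cdot> lift x a = a"
    using comp_right_cong1[OF delta_imp(4), of p "lift x a"] comp_right_cong1[OF delta_imp(5), of p "lift x a"]
      typing xa by (simp_all add: delta_imp)
  show "snd_I (Exp A) \<cdot> lift x a = snd_I (Exp X) \<cdot> x" "exp_map p \<cdot> (fst_I (Exp A) \<cdot> lift x a) = fst_I (Exp X) \<cdot> x"
    using times_I_proj_comp[of "exp_map p" "Exp X" "lift x a"] typing fl by simp_all
qed

lemma lift_comp:
  assumes [simp]: "x \<in> Arr C" "a \<in> Arr C" "Cod C x = prod_obj C (Exp X) I" "Cod C a = A" "Dom C x = Dom C a"
    and xa: "p \<cdot> a = ev\<^sub>X \<cdot> x" and [simp]: "m \<in> Arr C" "Cod C m = Dom C a"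
  shows "lift x a \<cdot> m = lift (x \<cdot> m) (a \<cdot> m)"
  using xa by (simp add: lift_def)

lemma ap_lift:
  assumes [simp]: "x \<in> Arr C" "a \<in> Arr C" "Cod C x = prod_obj C (Exp X) I" "Cod C a = A" "Dom C x = Dom C a"
    and xa: "p \<cdot> a = ev\<^sub>X \<cdot> x"
  shows "ap A (fst_I (Exp A) \<cdot> lift x a) (snd_I (Exp X) \<cdot> x) = a"
  using lift(5)[OF assms] lift(1-3,6)[OF assms] by (simp add: eval_comp del: lift)

text \<open>The application is a preimage of \<open>a\<close> under \<open>\<kappa>\<close>, which
  acts on paths alone; so the point is kept and the path in \<open>B\<close> lies over that of
  \<open>a\<close>.\<close>

lemma App_\<kappa>:
  assumes [simp]: "w \<in> Arr C" "a \<in> Arr C" "Cod C w = Dom C (Pi f \<kappa>)" "Cod C a = prod_obj C (Exp A) I"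
      "Dom C w = Dom C a" and fa: "f \<cdot> a = Pi f \<kappa> \<cdot> w"
  shows "snd_I (Exp B) \<cdot> App f \<kappa> w a = snd_I (Exp A) \<cdot> a"
    "exp_map q \<cdot> (fst_I (Exp B) \<cdot> App f \<kappa> w a) = fst_I (Exp A) \<cdot> a"
proof -
  have "\<kappa> \<cdot> App f \<kappa> w a = a" "App f \<kappa> w a \<in> Arr C" "Cod C (App f \<kappa> w a) = prod_obj C (Exp B) I"
    using App_typing[of f \<kappa> w a] fa by simp_all
  then show "snd_I (Exp B) \<cdot> App f \<kappa> w a = snd_I (Exp A) \<cdot> a"
    "exp_map q \<cdot> (fst_I (Exp B) \<cdot> App f \<kappa> w a) = fst_I (Exp A) \<cdot> a"
    using times_I_proj_comp[of "exp_map q" "Exp A" "App f \<kappa> w a"] by simp_all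
qed

text \<open>The premise compares whole paths in \<open>X\<close>, so it yields compatible values at
  every \<open>j\<close>, not merely at the point that \<open>a\<close> and \<open>m\<close>
  carry.\<close>

lemma ap_over:
  assumes [simp]: "m \<in> Arr C" "a \<in> Arr C" "j \<in> Arr C" "Cod C m = prod_obj C (Exp P) I"
      "Cod C a = prod_obj C (Exp A) I" "Cod C j = I" "Dom C m = Dom C a" "Dom C j = Dom C a"
    and fa: "f \<cdot> a = \<zeta> \<cdot> m"
  shows "p \<cdot> ap A (fst_I (Exp A) \<cdot> a) j = \<pi> \<cdot> ap P (fst_I (Exp P) \<cdot> m) j"
proof -
  have "fst_I (Exp X) \<cdot> (f \<cdot> a) = fst_I (Exp X) \<cdot> (\<zeta> \<cdot> m)"
    by (simp only: fa)
  then have "ap X (exp_map p \<cdot> (fst_I (Exp A) \<cdot> a)) j = ap X (exp_map \<pi> \<cdot> (fst_I (Exp P) \<cdot> m)) j"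
    by simp
  then show ?thesis by simp
qed

section \<open>The four maps of the retract diagram\<close>

lemma obtain_domain_section:
  obtains i where "i \<in> Arr C" "Dom C i = prod_obj C (Exp P) I" "Cod C i = Dom C (Pi f \<kappa>)" "Pi f \<kappa> \<cdot> i = \<zeta>"
    "\<And>m a j. \<lbrakk>m \<in> Arr C; a \<in> Arr C; j \<in> Arr C; Cod C m = prod_obj C (Exp P) I;
      Cod C a = prod_obj C (Exp A) I; Cod C j = I; Dom C m = Dom C a; Dom C j = Dom C a; f \<cdot> a = \<zeta> \<cdot> m\<rbrakk> \<Longrightarrow>
      ap B (fst_I (Exp B) \<cdot> App f \<kappa> (i \<cdot> m) a) j
        = App p q (ap P (fst_I (Exp P) \<cdot> m) j) (ap A (fst_I (Exp A) \<cdot> a) j)"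
proof -
  \<comment> \<open>\<open>W\<close> is the stage of a generic path of sections
    \<open>m\<^sub>0\<close> and a generic path \<open>a\<^sub>0\<close> over the same base path and
    point.\<close>
  define W where "W = pb_obj C f \<zeta>"
  define a\<^sub>0 where "a\<^sub>0 = pb_proj1 C f \<zeta>"
  define m\<^sub>0 where "m\<^sub>0 = pb_proj2 C f \<zeta>"
  have W [simp]: "W \<in> Obj C"
    and a0 [simp]: "a\<^sub>0 \<in> Arr C" "Dom C a\<^sub>0 = W" "Cod C a\<^sub>0 = prod_obj C (Exp A) I"
    and m0 [simp]: "m\<^sub>0 \<in> Arr C" "Dom C m\<^sub>0 = W" "Cod C m\<^sub>0 = prod_obj C (Exp P) I"
    and am: "f \<cdot> a\<^sub>0 = \<zeta> \<cdot> m\<^sub>0"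
    by (simp_all add: W_def a\<^sub>0_def m\<^sub>0_def pb_comm)
  \<comment> \<open>The value \<open>g j (a j)\<close> with \<open>j\<close> the generic point of
    \<open>I\<close>, still to be abstracted over \<open>j\<close> and then over
    \<open>a\<close>.\<close>
  define h where "h = App p q (ap P (fst_I (Exp P) \<cdot> (m\<^sub>0 \<cdot> fst_I W)) (snd_I W))
    (ap A (fst_I (Exp A) \<cdot> (a\<^sub>0 \<cdot> fst_I W)) (snd_I W))"
  have am': "f \<cdot> (a\<^sub>0 \<cdot> n) = \<zeta> \<cdot> (m\<^sub>0 \<cdot> n)" if "n \<in> Arr C" "Cod C n = W" for n
    by (rule comp_right_cong[OF am]) (use that in simp_all)
  have over: "p \<cdot> ap A (fst_I (Exp A) \<cdot> (a\<^sub>0 \<cdot> n)) j = \<pi> \<cdot> ap P (fst_I (Exp P) \<cdot> (m\<^sub>0 \<cdot> n)) j"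
    if "n \<in> Arr C" "j \<in> Arr C" "Cod C n = W" "Dom C j = Dom C n" "Cod C j = I" for n j
    by (rule ap_over) (use that am' in simp_all)
  have h [simp]: "h \<in> Arr C" "Dom C h = prod_obj C W I" "Cod C h = B"
    unfolding h_def using over[of "fst_I W" "snd_I W"] by simp_all
  obtain \<psi> where \<psi> [simp]: "\<psi> \<in> Arr C" "Dom C \<psi> = W" "Cod C \<psi> = Exp B"
    and \<psi>_ap: "\<And>n j. \<lbrakk>n \<in> Arr C; j \<in> Arr C; Cod C n = W; Dom C n = Dom C j; Cod C j = I\<rbrakk> \<Longrightarrow>
      ap B (\<psi> \<cdot> n) j = h \<cdot> prod_pair C W I n j"
    by (rule exp_lambda[of W B h]) simp_all
  have \<psi>_App: "ap B (\<psi> \<cdot> n) j = App p q (ap P (fst_I (Exp P) \<cdot> (m\<^sub>0 \<cdot> n)) j) (ap A (fst_I (Exp A) \<cdot> (a\<^sub>0 \<cdot> n)) j)"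
    if [simp]: "n \<in> Arr C" "j \<in> Arr C" "Cod C n = W" "Dom C n = Dom C j" "Cod C j = I" for n j
    unfolding \<psi>_ap[OF that] h_def using over[of "fst_I W" "snd_I W"] by (subst App_comp) simp_all
  define k where "k = prod_pair C (Exp B) I \<psi> (snd_I (Exp A) \<cdot> a\<^sub>0)"
  have k [simp]: "k \<in> Arr C" "Dom C k = W" "Cod C k = prod_obj C (Exp B) I"
    by (simp_all add: k_def)
  \<comment> \<open>That \<open>j \<mapsto> g j (a j)\<close> lies over \<open>a\<close> is checked
    on values, where it holds because \<open>App\<close> yields sections of
    \<open>q\<close>.\<close>
  have "exp_map q \<cdot> \<psi> = fst_I (Exp A) \<cdot> a\<^sub>0"
    by (rule exp_ext[of A _ _ W]) (use over[of "fst_I W" "snd_I W"] \<psi>_App[of "fst_I W" "snd_I W"] in simp_all)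
  then have "\<kappa> \<cdot> k = a\<^sub>0"
    by (rule_tac prod_ext[of "Exp A" I]) (simp_all add: k_def)
  then have k_over: "\<kappa> \<cdot> k = pb_proj1 C f \<zeta>" by (simp add: a\<^sub>0_def)
  obtain i where i [simp]: "i \<in> Arr C" "Dom C i = prod_obj C (Exp P) I" "Cod C i = Dom C (Pi f \<kappa>)" "Pi f \<kappa> \<cdot> i = \<zeta>"
    and i_App: "\<And>m a. \<lbrakk>m \<in> Arr C; a \<in> Arr C; Cod C m = Dom C \<zeta>; Dom C m = Dom C a; Cod C a = Dom C f;
      f \<cdot> a = \<zeta> \<cdot> m\<rbrakk> \<Longrightarrow> App f \<kappa> (i \<cdot> m) a = k \<cdot> pb_pair C f \<zeta> a m"
    by (rule push_lambda[of f \<kappa> \<zeta> k]) (use k_over in simp_all)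
  show thesis
  proof (rule that[OF i])
    fix m a j assume [simp]: "m \<in> Arr C" "a \<in> Arr C" "j \<in> Arr C" "Cod C m = prod_obj C (Exp P) I"
      "Cod C a = prod_obj C (Exp A) I" "Cod C j = I" "Dom C m = Dom C a" "Dom C j = Dom C a" and fa: "f \<cdot> a = \<zeta> \<cdot> m"
    define n where "n = pb_pair C f \<zeta> a m"
    have n [simp]: "n \<in> Arr C" "Dom C n = Dom C a" "Cod C n = W" "a\<^sub>0 \<cdot> n = a" "m\<^sub>0 \<cdot> n = m"
      using fa by (simp_all add: n_def W_def a\<^sub>0_def m\<^sub>0_def)
    have "fst_I (Exp B) \<cdot> App f \<kappa> (i \<cdot> m) a = \<psi> \<cdot> n"
      using fa by (simp add: i_App k_def flip: n_def)
    then show "ap B (fst_I (Exp B) \<cdot> App f \<kappa> (i \<cdot> m) a) j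
        = App p q (ap P (fst_I (Exp P) \<cdot> m) j) (ap A (fst_I (Exp A) \<cdot> a) j)"
      by (simp add: \<psi>_App)
  qed
qed

text \<open>A section over the fibre of \<open>p\<close> at the value of \<open>x\<close> becomes
  one over all paths above \<open>x\<close> by restriction along the evaluation
  \<open>a \<mapsto> a i\<close>.\<close>

lemma obtain_codomain_section:
  obtains j where "j \<in> Arr C" "Dom C j = pb_obj C ev\<^sub>X \<pi>" "Cod C j = Dom C (Pi f \<beta>)" "Pi f \<beta> \<cdot> j = pb_proj1 C ev\<^sub>X \<pi>"
    "\<And>m a. \<lbrakk>m \<in> Arr C; a \<in> Arr C; Cod C m = pb_obj C ev\<^sub>X \<pi>; Cod C a = prod_obj C (Exp A) I;
      Dom C m = Dom C a; f \<cdot> a = pb_proj1 C ev\<^sub>X \<pi> \<cdot> m\<rbrakk> \<Longrightarrow>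
      pb_proj2 C ev\<^sub>A q \<cdot> App f \<beta> (j \<cdot> m) a = App p q (pb_proj2 C ev\<^sub>X \<pi> \<cdot> m) (ev\<^sub>A \<cdot> a)"
proof -
  let ?x = "pb_proj1 C ev\<^sub>X \<pi>" and ?w = "pb_proj2 C ev\<^sub>X \<pi>"
  have over: "p \<cdot> (ev\<^sub>A \<cdot> a) = \<pi> \<cdot> (?w \<cdot> m)"
    if [simp]: "m \<in> Arr C" "a \<in> Arr C" "Cod C m = pb_obj C ev\<^sub>X \<pi>" "Cod C a = prod_obj C (Exp A) I"
      "Dom C m = Dom C a" and fa: "f \<cdot> a = ?x \<cdot> m" for m a
  proof -
    have "p \<cdot> (ev\<^sub>A \<cdot> a) = ev\<^sub>X \<cdot> (f \<cdot> a)"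
      by (rule comp_right_cong) (simp_all add: eval_natural)
    also have "\<dots> = \<pi> \<cdot> (?w \<cdot> m)"
      unfolding fa by (rule comp_right_cong[OF pb_comm]) simp_all
    finally show ?thesis .
  qed
  define a\<^sub>0 where "a\<^sub>0 = pb_proj1 C f ?x"
  define m\<^sub>0 where "m\<^sub>0 = pb_proj2 C f ?x"
  have a0 [simp]: "a\<^sub>0 \<in> Arr C" "Dom C a\<^sub>0 = pb_obj C f ?x" "Cod C a\<^sub>0 = prod_obj C (Exp A) I"
    and m0 [simp]: "m\<^sub>0 \<in> Arr C" "Dom C m\<^sub>0 = pb_obj C f ?x" "Cod C m\<^sub>0 = pb_obj C ev\<^sub>X \<pi>"
    and am: "f \<cdot> a\<^sub>0 = ?x \<cdot> m\<^sub>0"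
    by (simp_all add: a\<^sub>0_def m\<^sub>0_def pb_comm)
  \<comment> \<open>An element of this pullback is a path with a point, together with an element of
    \<open>B\<close> over its value there; \<open>o\<close> makes the application available.\<close>
  define k where "k = pb_pair C ev\<^sub>A q a\<^sub>0 (App p q (?w \<cdot> m\<^sub>0) (ev\<^sub>A \<cdot> a\<^sub>0))"
  have o: "p \<cdot> (ev\<^sub>A \<cdot> a\<^sub>0) = \<pi> \<cdot> (?w \<cdot> m\<^sub>0)" by (rule over) (simp_all add: am)
  have k [simp]: "k \<in> Arr C" "Cod C k = pb_obj C ev\<^sub>A q" "\<beta> \<cdot> k = a\<^sub>0" "Dom C k = pb_obj C f ?x"
    and k2: "pb_proj2 C ev\<^sub>A q \<cdot> k = App p q (?w \<cdot> m\<^sub>0) (ev\<^sub>A \<cdot> a\<^sub>0)"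
    unfolding k_def using o by simp_all
  obtain j where j [simp]: "j \<in> Arr C" "Dom C j = pb_obj C ev\<^sub>X \<pi>" "Cod C j = Dom C (Pi f \<beta>)" "Pi f \<beta> \<cdot> j = ?x"
    and j_App: "\<And>m a. \<lbrakk>m \<in> Arr C; a \<in> Arr C; Cod C m = Dom C ?x; Dom C m = Dom C a; Cod C a = Dom C f;
      f \<cdot> a = ?x \<cdot> m\<rbrakk> \<Longrightarrow> App f \<beta> (j \<cdot> m) a = k \<cdot> pb_pair C f ?x a m"
    by (rule push_lambda[of f \<beta> ?x k]) (simp_all add: a\<^sub>0_def[symmetric])
  show thesis
  proof (rule that[OF j])
    fix m a assume [simp]: "m \<in> Arr C" "a \<in> Arr C" "Cod C m = pb_obj C ev\<^sub>X \<pi>" "Cod C a = prod_obj C (Exp A) I"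
      "Dom C m = Dom C a" and fa: "f \<cdot> a = ?x \<cdot> m"
    define n where "n = pb_pair C f ?x a m"
    have n [simp]: "n \<in> Arr C" "Dom C n = Dom C a" "Cod C n = pb_obj C f ?x" "a\<^sub>0 \<cdot> n = a" "m\<^sub>0 \<cdot> n = m"
      using fa by (simp_all add: n_def a\<^sub>0_def m\<^sub>0_def)
    have "pb_proj2 C ev\<^sub>A q \<cdot> App f \<beta> (j \<cdot> m) a = App p q (?w \<cdot> m\<^sub>0) (ev\<^sub>A \<cdot> a\<^sub>0) \<cdot> n"
      using fa comp_right_cong1[OF k2, of n] by (simp add: j_App flip: n_def)
    also have "\<dots> = App p q (?w \<cdot> m) (ev\<^sub>A \<cdot> a)"
      using o by (subst App_comp) simp_all
    finally show "pb_proj2 C ev\<^sub>A q \<cdot> App f \<beta> (j \<cdot> m) a = App p q (?w \<cdot> m) (ev\<^sub>A \<cdot> a)" .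
  qed
qed

text \<open>A family indexed by paths above \<open>x\<close> becomes a section over the fibre at the
  value of \<open>x\<close> by restriction along \<open>lift x\<close>; the result is a section
  because the lifted path has value \<open>a\<close>.\<close>

lemma obtain_codomain_retraction:
  obtains v where "v \<in> Arr C" "Dom C v = Dom C (Pi f \<beta>)" "Cod C v = pb_obj C ev\<^sub>X \<pi>"
    "pb_proj1 C ev\<^sub>X \<pi> \<cdot> v = Pi f \<beta>"
    "\<And>m a. \<lbrakk>m \<in> Arr C; a \<in> Arr C; Cod C m = Dom C (Pi f \<beta>); Cod C a = A; Dom C m = Dom C a;
      p \<cdot> a = ev\<^sub>X \<cdot> (Pi f \<beta> \<cdot> m)\<rbrakk> \<Longrightarrow>
      App p q (pb_proj2 C ev\<^sub>X \<pi> \<cdot> (v \<cdot> m)) a = pb_proj2 C ev\<^sub>A q \<cdot> App f \<beta> m (lift (Pi f \<beta> \<cdot> m) a)"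
proof -
  define y where "y = Pi f \<beta>"
  have y [simp]: "y \<in> Arr C" "Cod C y = prod_obj C (Exp X) I"
    by (simp_all add: y_def)
  have Dom_y [simp]: "Dom C (Pi f \<beta>) = Dom C y" by (simp add: y_def)
  \<comment> \<open>The section \<open>g\<close> lives over the value of the path in
    \<open>y\<close>, hence the base \<open>z\<close> in place of \<open>y\<close>.\<close>
  define z where "z = ev\<^sub>X \<cdot> y"
  have z [simp]: "z \<in> Arr C" "Cod C z = X" "Dom C z = Dom C y"
    by (simp_all add: z_def)
  define a\<^sub>0 where "a\<^sub>0 = pb_proj1 C p z"
  define m\<^sub>0 where "m\<^sub>0 = pb_proj2 C p z"
  have a0 [simp]: "a\<^sub>0 \<in> Arr C" "Dom C a\<^sub>0 = pb_obj C p z" "Cod C a\<^sub>0 = A"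
    and m0 [simp]: "m\<^sub>0 \<in> Arr C" "Dom C m\<^sub>0 = pb_obj C p z" "Cod C m\<^sub>0 = Dom C y"
    and am\<^sub>0: "p \<cdot> a\<^sub>0 = z \<cdot> m\<^sub>0"
    by (simp_all add: a\<^sub>0_def m\<^sub>0_def pb_comm)
  have am: "p \<cdot> a\<^sub>0 = ev\<^sub>X \<cdot> (y \<cdot> m\<^sub>0)"
    using am\<^sub>0 by (simp add: z_def)
  have App_lift: "App f \<beta> m (lift (y \<cdot> m) a) \<in> Arr C" "Dom C (App f \<beta> m (lift (y \<cdot> m) a)) = Dom C a"
    "Cod C (App f \<beta> m (lift (y \<cdot> m) a)) = pb_obj C ev\<^sub>A q" "\<beta> \<cdot> App f \<beta> m (lift (y \<cdot> m) a) = lift (y \<cdot> m) a"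
    if [simp]: "m \<in> Arr C" "a \<in> Arr C" "Cod C m = Dom C y" "Cod C a = A" "Dom C m = Dom C a"
      and "p \<cdot> a = ev\<^sub>X \<cdot> (y \<cdot> m)" for m a
    using that(6) App_typing[of f \<beta> m "lift (y \<cdot> m) a"] by (simp_all flip: y_def)
  define k where "k = pb_proj2 C ev\<^sub>A q \<cdot> App f \<beta> m\<^sub>0 (lift (y \<cdot> m\<^sub>0) a\<^sub>0)"
  have dom0: "Dom C m\<^sub>0 = Dom C a\<^sub>0" by simp
  note App0 = App_lift[OF m0(1) a0(1) m0(3) a0(3) dom0 am]
  have k [simp]: "k \<in> Arr C" "Dom C k = pb_obj C p z" "Cod C k = B"
    using App0 by (simp_all add: k_def)
  have "q \<cdot> k = ev\<^sub>A \<cdot> (\<beta> \<cdot> App f \<beta> m\<^sub>0 (lift (y \<cdot> m\<^sub>0) a\<^sub>0))"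
    unfolding k_def by (rule comp_right_cong) (use App0 in \<open>simp_all add: pb_comm\<close>)
  also have "\<dots> = a\<^sub>0"
    unfolding App0(4) using am by simp
  finally have qk: "q \<cdot> k = pb_proj1 C p z" by (simp add: a\<^sub>0_def)
  obtain g where g [simp]: "g \<in> Arr C" "Dom C g = Dom C y" "Cod C g = P" and \<pi>g: "\<pi> \<cdot> g = z"
    and g_App: "\<And>m a. \<lbrakk>m \<in> Arr C; a \<in> Arr C; Cod C m = Dom C z; Dom C m = Dom C a; Cod C a = A;
      p \<cdot> a = z \<cdot> m\<rbrakk> \<Longrightarrow> App p q (g \<cdot> m) a = k \<cdot> pb_pair C p z a m"
    by (rule push_lambda[of p q z k]) (use qk in simp_all)
  define v where "v = pb_pair C ev\<^sub>X \<pi> y g"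
  have v [simp]: "v \<in> Arr C" "Dom C v = Dom C y" "Cod C v = pb_obj C ev\<^sub>X \<pi>"
    "pb_proj1 C ev\<^sub>X \<pi> \<cdot> v = y" "pb_proj2 C ev\<^sub>X \<pi> \<cdot> v = g"
    using \<pi>g by (simp_all add: v_def z_def)
  show thesis
  proof (rule that)
    fix m a assume [simp]: "m \<in> Arr C" "a \<in> Arr C" "Cod C m = Dom C (Pi f \<beta>)" "Cod C a = A" "Dom C m = Dom C a"
      and "p \<cdot> a = ev\<^sub>X \<cdot> (Pi f \<beta> \<cdot> m)"
    then have pa: "p \<cdot> a = ev\<^sub>X \<cdot> (y \<cdot> m)" by (simp only: y_def)
    have z_m: "p \<cdot> a = z \<cdot> m" using pa by (simp add: z_def)
    define n where "n = pb_pair C p z a m"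
    have n [simp]: "n \<in> Arr C" "Dom C n = Dom C a" "Cod C n = pb_obj C p z" "a\<^sub>0 \<cdot> n = a" "m\<^sub>0 \<cdot> n = m"
      using z_m by (simp_all add: n_def a\<^sub>0_def m\<^sub>0_def)
    have "pb_proj2 C ev\<^sub>X \<pi> \<cdot> (v \<cdot> m) = g \<cdot> m"
      by (rule comp_right_cong1) simp_all
    then have "App p q (pb_proj2 C ev\<^sub>X \<pi> \<cdot> (v \<cdot> m)) a = k \<cdot> n"
      using g_App[of m a] z_m by (simp add: n_def)
    also have "\<dots> = pb_proj2 C ev\<^sub>A q \<cdot> (App f \<beta> m\<^sub>0 (lift (y \<cdot> m\<^sub>0) a\<^sub>0) \<cdot> n)"
      using App0 by (simp add: k_def)
    also have "App f \<beta> m\<^sub>0 (lift (y \<cdot> m\<^sub>0) a\<^sub>0) \<cdot> n = App f \<beta> m (lift (y \<cdot> m) a)"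
      using am by (subst App_comp) (simp_all add: lift_comp flip: y_def)
    finally show "App p q (pb_proj2 C ev\<^sub>X \<pi> \<cdot> (v \<cdot> m)) a = pb_proj2 C ev\<^sub>A q \<cdot> App f \<beta> m (lift (Pi f \<beta> \<cdot> m) a)"
      by (simp flip: y_def)
  qed (simp_all flip: y_def)
qed

text \<open>A path over that of \<open>x\<close> with value \<open>a\<close> at \<open>j\<close>, but based at the point of \<open>x\<close> instead of \<open>j\<close>: an
  argument of \<open>App f \<kappa> w\<close> must have the same point as \<open>w\<close>.\<close>

definition transport :: "'b \<Rightarrow> 'b \<Rightarrow> 'b \<Rightarrow> 'b" where
  "transport x j a = prod_pair C (Exp A) I
    (fst_I (Exp A) \<cdot> lift (prod_pair C (Exp X) I (fst_I (Exp X) \<cdot> x) j) a) (snd_I (Exp X) \<cdot> x)"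

text \<open>Exchanging the point does not affect the path part of \<open>f\<close>, and the value at
  \<open>j\<close> depends on the path only. When \<open>j\<close> is the point of \<open>x\<close>,
  nothing is exchanged and \<open>lift x a\<close> returns.\<close>

lemma transport:
  assumes [simp]: "x \<in> Arr C" "j \<in> Arr C" "a \<in> Arr C" "Cod C x = prod_obj C (Exp X) I" "Cod C j = I" "Cod C a = A"
      "Dom C x = Dom C a" "Dom C j = Dom C a"
    and pa: "p \<cdot> a = ap X (fst_I (Exp X) \<cdot> x) j"
  shows "transport x j a \<in> Arr C" "Dom C (transport x j a) = Dom C a"
    "Cod C (transport x j a) = prod_obj C (Exp A) I" "f \<cdot> transport x j a = x"
    "ap A (fst_I (Exp A) \<cdot> transport x j a) j = a"
    "\<And>m. \<lbrakk>m \<in> Arr C; Cod C m = Dom C a\<rbrakk> \<Longrightarrow>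
      transport x j a \<cdot> m = transport (x \<cdot> m) (j \<cdot> m) (a \<cdot> m)"
    "j = snd_I (Exp X) \<cdot> x \<Longrightarrow> transport x j a = lift x a"
proof -
  let ?x = "prod_pair C (Exp X) I (fst_I (Exp X) \<cdot> x) j"
  have px: "p \<cdot> a = ev\<^sub>X \<cdot> ?x" using pa by (simp add: eval_comp)
  have x': "?x \<in> Arr C" "Cod C ?x = prod_obj C (Exp X) I" "Dom C ?x = Dom C a" by simp_all
  note l = lift[OF x'(1) assms(3) x'(2) assms(6) x'(3) px]
  show typing: "transport x j a \<in> Arr C" "Dom C (transport x j a) = Dom C a"
    "Cod C (transport x j a) = prod_obj C (Exp A) I"
    unfolding transport_def using l by simp_all
  have fst_tr: "fst_I (Exp A) \<cdot> transport x j a = fst_I (Exp A) \<cdot> lift ?x a"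
    and snd_tr: "snd_I (Exp A) \<cdot> transport x j a = snd_I (Exp X) \<cdot> x"
    unfolding transport_def using l(1-3) by simp_all
  have "exp_map p \<cdot> (fst_I (Exp A) \<cdot> transport x j a) = fst_I (Exp X) \<cdot> x"
    unfolding fst_tr l(7) by simp
  then show "f \<cdot> transport x j a = x"
    by (rule_tac prod_ext[of "Exp X" I]) (use typing snd_tr in simp_all)
  show "ap A (fst_I (Exp A) \<cdot> transport x j a) j = a"
    using ap_lift[OF x'(1) assms(3) x'(2) assms(6) x'(3) px] unfolding fst_tr by simp
  show "transport x j a \<cdot> m = transport (x \<cdot> m) (j \<cdot> m) (a \<cdot> m)" if "m \<in> Arr C" "Cod C m = Dom C a" for m
    using that l(1-3) lift_comp[OF x'(1) assms(3) x'(2) assms(6) x'(3) px that] by (simp add: transport_def)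
  show "transport x j a = lift x a" if j: "j = snd_I (Exp X) \<cdot> x"
  proof -
    have "?x = x" unfolding j by (rule prod_pair_eta) simp_all
    then show ?thesis
      by (rule_tac prod_ext[of "Exp A" I]) (use typing l(1-3,6) fst_tr snd_tr in simp_all)
  qed
qed

text \<open>The result must be a path of sections, so its time \<open>j\<close> is independent of
  the point carried by the base. Two abstractions are needed: over the fibre at the value at
  \<open>j\<close>, and then over \<open>j\<close>.\<close>

lemma obtain_domain_retraction:
  obtains r where "r \<in> Arr C" "Dom C r = Dom C (Pi f \<kappa>)" "Cod C r = prod_obj C (Exp P) I" "\<zeta> \<cdot> r = Pi f \<kappa>"
    "\<And>m a j. \<lbrakk>m \<in> Arr C; a \<in> Arr C; j \<in> Arr C; Cod C m = Dom C (Pi f \<kappa>); Cod C a = A; Cod C j = I;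
      Dom C m = Dom C a; Dom C j = Dom C a; p \<cdot> a = ap X (fst_I (Exp X) \<cdot> (Pi f \<kappa> \<cdot> m)) j\<rbrakk> \<Longrightarrow>
      App p q (ap P (fst_I (Exp P) \<cdot> (r \<cdot> m)) j) a
        = ap B (fst_I (Exp B) \<cdot> App f \<kappa> m (transport (Pi f \<kappa> \<cdot> m) j a)) j"
proof -
  define y where "y = Pi f \<kappa>"
  have y [simp]: "y \<in> Arr C" "Cod C y = prod_obj C (Exp X) I"
    by (simp_all add: y_def)
  define Z where "Z = Dom C y"
  have Z [simp]: "Dom C y = Z" "Z \<in> Obj C" "Dom C (Pi f \<kappa>) = Z" by (simp_all add: Z_def y_def)
  \<comment> \<open>The value of the base path at the generic time, which is the base of the section
    \<open>g\<close>.\<close>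
  define z where "z = ap X (fst_I (Exp X) \<cdot> (y \<cdot> fst_I Z)) (snd_I Z)"
  have z [simp]: "z \<in> Arr C" "Cod C z = X" "Dom C z = prod_obj C Z I"
    by (simp_all add: z_def)
  define a\<^sub>0 where "a\<^sub>0 = pb_proj1 C p z"
  define m\<^sub>0 where "m\<^sub>0 = pb_proj2 C p z"
  let ?m = "fst_I Z \<cdot> m\<^sub>0" and ?j = "snd_I Z \<cdot> m\<^sub>0"
  have a0 [simp]: "a\<^sub>0 \<in> Arr C" "Dom C a\<^sub>0 = pb_obj C p z" "Cod C a\<^sub>0 = A"
    and m0 [simp]: "m\<^sub>0 \<in> Arr C" "Dom C m\<^sub>0 = pb_obj C p z" "Cod C m\<^sub>0 = prod_obj C Z I"
    and am\<^sub>0: "p \<cdot> a\<^sub>0 = z \<cdot> m\<^sub>0"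
    by (simp_all add: a\<^sub>0_def m\<^sub>0_def pb_comm)
  have am: "p \<cdot> a\<^sub>0 = ap X (fst_I (Exp X) \<cdot> (y \<cdot> ?m)) ?j"
    using am\<^sub>0 by (simp add: z_def)
  have App_tr: "App f \<kappa> m (transport (y \<cdot> m) j a) \<in> Arr C"
    "Dom C (App f \<kappa> m (transport (y \<cdot> m) j a)) = Dom C a"
    "Cod C (App f \<kappa> m (transport (y \<cdot> m) j a)) = prod_obj C (Exp B) I"
    "exp_map q \<cdot> (fst_I (Exp B) \<cdot> App f \<kappa> m (transport (y \<cdot> m) j a)) = fst_I (Exp A) \<cdot> transport (y \<cdot> m) j a"
    "\<And>n. \<lbrakk>n \<in> Arr C; Cod C n = Dom C a\<rbrakk> \<Longrightarrow> App f \<kappa> m (transport (y \<cdot> m) j a) \<cdot> n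
      = App f \<kappa> (m \<cdot> n) (transport (y \<cdot> (m \<cdot> n)) (j \<cdot> n) (a \<cdot> n))"
    if [simp]: "m \<in> Arr C" "a \<in> Arr C" "j \<in> Arr C" "Cod C m = Z" "Cod C a = A" "Cod C j = I"
      "Dom C m = Dom C a" "Dom C j = Dom C a" and pa: "p \<cdot> a = ap X (fst_I (Exp X) \<cdot> (y \<cdot> m)) j" for m a j
  proof -
    have ym: "y \<cdot> m \<in> Arr C" "Cod C (y \<cdot> m) = prod_obj C (Exp X) I" "Dom C (y \<cdot> m) = Dom C a" by simp_all
    note tr = transport[OF ym(1) that(3,2) ym(2) that(6,5) ym(3) that(8) pa]
    show "App f \<kappa> m (transport (y \<cdot> m) j a) \<in> Arr C"
      "Dom C (App f \<kappa> m (transport (y \<cdot> m) j a)) = Dom C a"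
      "Cod C (App f \<kappa> m (transport (y \<cdot> m) j a)) = prod_obj C (Exp B) I"
      "exp_map q \<cdot> (fst_I (Exp B) \<cdot> App f \<kappa> m (transport (y \<cdot> m) j a)) = fst_I (Exp A) \<cdot> transport (y \<cdot> m) j a"
      using App_typing[of f \<kappa> m "transport (y \<cdot> m) j a"] App_\<kappa>[of m "transport (y \<cdot> m) j a"] tr
      by (simp_all flip: y_def)
    show "App f \<kappa> m (transport (y \<cdot> m) j a) \<cdot> n
      = App f \<kappa> (m \<cdot> n) (transport (y \<cdot> (m \<cdot> n)) (j \<cdot> n) (a \<cdot> n))" if [simp]: "n \<in> Arr C" "Cod C n = Dom C a" for n
      using tr by (subst App_comp) (simp_all flip: y_def)
  qed
  define k where "k = ap B (fst_I (Exp B) \<cdot> App f \<kappa> ?m (transport (y \<cdot> ?m) ?j a\<^sub>0)) ?j"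
  have mj: "?m \<in> Arr C" "?j \<in> Arr C" "Cod C ?m = Z" "Cod C ?j = I" "Dom C ?m = Dom C a\<^sub>0" "Dom C ?j = Dom C a\<^sub>0"
    by simp_all
  note App0 = App_tr[OF mj(1) a0(1) mj(2,3) a0(3) mj(4-6) am]
  have k [simp]: "k \<in> Arr C" "Dom C k = pb_obj C p z" "Cod C k = B"
    using App0 by (simp_all add: k_def)
  have "q \<cdot> k = ap A (exp_map q \<cdot> (fst_I (Exp B) \<cdot> App f \<kappa> ?m (transport (y \<cdot> ?m) ?j a\<^sub>0))) ?j"
    using App0(1-3) by (simp add: k_def)
  also have "\<dots> = a\<^sub>0"
    unfolding App0(4) using am by (intro transport(5)) simp_all
  finally have qk: "q \<cdot> k = pb_proj1 C p z" by (simp add: a\<^sub>0_def)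
  obtain g where g [simp]: "g \<in> Arr C" "Dom C g = prod_obj C Z I" "Cod C g = P" and \<pi>g: "\<pi> \<cdot> g = z"
    and g_App: "\<And>m a. \<lbrakk>m \<in> Arr C; a \<in> Arr C; Cod C m = Dom C z; Dom C m = Dom C a; Cod C a = A;
      p \<cdot> a = z \<cdot> m\<rbrakk> \<Longrightarrow> App p q (g \<cdot> m) a = k \<cdot> pb_pair C p z a m"
    by (rule push_lambda[of p q z k]) (use qk in simp_all)
  obtain G where G [simp]: "G \<in> Arr C" "Dom C G = Z" "Cod C G = Exp P"
    and G_ap: "\<And>m j. \<lbrakk>m \<in> Arr C; j \<in> Arr C; Cod C m = Z; Dom C m = Dom C j; Cod C j = I\<rbrakk> \<Longrightarrow>
      ap P (G \<cdot> m) j = g \<cdot> prod_pair C Z I m j"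
    by (rule exp_lambda[of Z P g]) simp_all
  \<comment> \<open>The point is copied from \<open>y\<close>, because \<open>\<zeta>\<close> leaves
    it alone and \<open>\<zeta> \<cdot> r\<close> has to be \<open>y\<close>.\<close>
  define r where "r = prod_pair C (Exp P) I G (snd_I (Exp X) \<cdot> y)"
  have r [simp]: "r \<in> Arr C" "Dom C r = Z" "Cod C r = prod_obj C (Exp P) I"
    by (simp_all add: r_def)
  have "exp_map \<pi> \<cdot> G = fst_I (Exp X) \<cdot> y"
    by (rule exp_ext[of X _ _ Z]) (use \<pi>g in \<open>simp_all add: G_ap z_def\<close>)
  then have \<zeta>r: "\<zeta> \<cdot> r = y"
    by (rule_tac prod_ext[of "Exp X" I]) (simp_all add: r_def)
  show thesis
  proof (rule that)
    fix m a j assume [simp]: "m \<in> Arr C" "a \<in> Arr C" "j \<in> Arr C" "Cod C m = Dom C (Pi f \<kappa>)" "Cod C a = A"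
      "Cod C j = I" "Dom C m = Dom C a" "Dom C j = Dom C a"
      and "p \<cdot> a = ap X (fst_I (Exp X) \<cdot> (Pi f \<kappa> \<cdot> m)) j"
    then have pa: "p \<cdot> a = ap X (fst_I (Exp X) \<cdot> (y \<cdot> m)) j" by (simp add: y_def)
    let ?mj = "prod_pair C Z I m j"
    have z_mj: "z \<cdot> ?mj = p \<cdot> a" using pa by (simp add: z_def)
    define n where "n = pb_pair C p z a ?mj"
    have n [simp]: "n \<in> Arr C" "Dom C n = Dom C a" "Cod C n = pb_obj C p z" "a\<^sub>0 \<cdot> n = a" "m\<^sub>0 \<cdot> n = ?mj"
      using z_mj by (simp_all add: n_def a\<^sub>0_def m\<^sub>0_def)
    have "App p q (ap P (fst_I (Exp P) \<cdot> (r \<cdot> m)) j) a = k \<cdot> n"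
      using g_App[of ?mj a] z_mj by (simp add: r_def G_ap n_def)
    also have "\<dots> = ap B (fst_I (Exp B) \<cdot> App f \<kappa> m (transport (y \<cdot> m) j a)) j"
      using App0 by (simp add: k_def)
    finally show "App p q (ap P (fst_I (Exp P) \<cdot> (r \<cdot> m)) j) a
        = ap B (fst_I (Exp B) \<cdot> App f \<kappa> m (transport (Pi f \<kappa> \<cdot> m) j a)) j"
      by (simp add: y_def)
  qed (use \<zeta>r in \<open>simp_all add: y_def\<close>)
qed

text \<open>Each of the four equations is tested on generalised elements: \<open>push_ext\<close>
  for sections, \<open>pb_ext\<close> and \<open>prod_ext\<close> for components,
  \<open>exp_ext\<close> for paths.\<close>

lemma pushforward_retract:
  "arrow_retract C (delta_imp C I \<pi>) (fst (amap (pushforward C f) (delta_imp C I q, \<beta>)))"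
proof -
  let ?p1 = "pb_proj1 C ev\<^sub>X \<pi>" and ?p2 = "pb_proj2 C ev\<^sub>X \<pi>" and ?q2 = "pb_proj2 C ev\<^sub>A q"
  let ?ev\<^sub>B = "eval_map C I B" and ?ev\<^sub>P = "eval_map C I P"
  define u where "u = delta_imp C I \<pi>"
  define d where "d = delta_imp C I q"
  define t where "t = fst (amap (pushforward C f) (d, \<beta>))"
  have u [simp]: "u \<in> Arr C" "Dom C u = prod_obj C (Exp P) I" "Cod C u = pb_obj C ev\<^sub>X \<pi>"
    and p1u: "?p1 \<cdot> u = \<zeta>" and p2u: "?p2 \<cdot> u = ?ev\<^sub>P"
    using delta_imp[of \<pi>] by (simp_all add: u_def)
  have d [simp]: "d \<in> Arr C" "Dom C d = prod_obj C (Exp B) I" "Cod C d = pb_obj C ev\<^sub>A q"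
    and \<beta>d: "\<beta> \<cdot> d = \<kappa>" and q2d: "?q2 \<cdot> d = ?ev\<^sub>B"
    using delta_imp[of q] by (simp_all add: d_def)
  have t [simp]: "t \<in> Arr C" "Dom C t = Dom C (Pi f \<kappa>)" "Cod C t = Dom C (Pi f \<beta>)" and \<beta>t: "Pi f \<beta> \<cdot> t = Pi f \<kappa>"
    using push_map_typing[of f \<beta> d] by (simp_all add: t_def \<beta>d)
  have App_t: "App f \<beta> (t \<cdot> w) a = d \<cdot> App f \<kappa> w a"
    if "w \<in> Arr C" "a \<in> Arr C" "Cod C w = Dom C (Pi f \<kappa>)" "Cod C a = prod_obj C (Exp A) I" "Dom C w = Dom C a"
      "f \<cdot> a = Pi f \<kappa> \<cdot> w" for w a
    using App_push_map[of f \<beta> d w a] that by (simp add: t_def \<beta>d)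
  obtain i where i [simp]: "i \<in> Arr C" "Dom C i = prod_obj C (Exp P) I" "Cod C i = Dom C (Pi f \<kappa>)"
    and \<kappa>i: "Pi f \<kappa> \<cdot> i = \<zeta>"
    and i_App: "\<And>m a j. \<lbrakk>m \<in> Arr C; a \<in> Arr C; j \<in> Arr C; Cod C m = prod_obj C (Exp P) I;
      Cod C a = prod_obj C (Exp A) I; Cod C j = I; Dom C m = Dom C a; Dom C j = Dom C a; f \<cdot> a = \<zeta> \<cdot> m\<rbrakk> \<Longrightarrow>
      ap B (fst_I (Exp B) \<cdot> App f \<kappa> (i \<cdot> m) a) j
        = App p q (ap P (fst_I (Exp P) \<cdot> m) j) (ap A (fst_I (Exp A) \<cdot> a) j)"
    by (rule obtain_domain_section) (rule that)
  obtain j where j [simp]: "j \<in> Arr C" "Dom C j = pb_obj C ev\<^sub>X \<pi>" "Cod C j = Dom C (Pi f \<beta>)"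
    and \<beta>j: "Pi f \<beta> \<cdot> j = ?p1"
    and j_App: "\<And>m a. \<lbrakk>m \<in> Arr C; a \<in> Arr C; Cod C m = pb_obj C ev\<^sub>X \<pi>; Cod C a = prod_obj C (Exp A) I;
      Dom C m = Dom C a; f \<cdot> a = ?p1 \<cdot> m\<rbrakk> \<Longrightarrow>
      ?q2 \<cdot> App f \<beta> (j \<cdot> m) a = App p q (?p2 \<cdot> m) (ev\<^sub>A \<cdot> a)"
    by (rule obtain_codomain_section) (rule that)
  obtain r where r [simp]: "r \<in> Arr C" "Dom C r = Dom C (Pi f \<kappa>)" "Cod C r = prod_obj C (Exp P) I"
    and \<zeta>r: "\<zeta> \<cdot> r = Pi f \<kappa>"
    and r_App: "\<And>m a j. \<lbrakk>m \<in> Arr C; a \<in> Arr C; j \<in> Arr C; Cod C m = Dom C (Pi f \<kappa>); Cod C a = A; Cod C j = I;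
      Dom C m = Dom C a; Dom C j = Dom C a; p \<cdot> a = ap X (fst_I (Exp X) \<cdot> (Pi f \<kappa> \<cdot> m)) j\<rbrakk> \<Longrightarrow>
      App p q (ap P (fst_I (Exp P) \<cdot> (r \<cdot> m)) j) a
        = ap B (fst_I (Exp B) \<cdot> App f \<kappa> m (transport (Pi f \<kappa> \<cdot> m) j a)) j"
    by (rule obtain_domain_retraction) (rule that)
  obtain v where v [simp]: "v \<in> Arr C" "Dom C v = Dom C (Pi f \<beta>)" "Cod C v = pb_obj C ev\<^sub>X \<pi>"
    and p1v: "?p1 \<cdot> v = Pi f \<beta>"
    and v_App: "\<And>m a. \<lbrakk>m \<in> Arr C; a \<in> Arr C; Cod C m = Dom C (Pi f \<beta>); Cod C a = A; Dom C m = Dom C a;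
      p \<cdot> a = ev\<^sub>X \<cdot> (Pi f \<beta> \<cdot> m)\<rbrakk> \<Longrightarrow>
      App p q (?p2 \<cdot> (v \<cdot> m)) a = ?q2 \<cdot> App f \<beta> m (lift (Pi f \<beta> \<cdot> m) a)"
    by (rule obtain_codomain_retraction) (rule that)
  \<comment> \<open>Both composites send \<open>g\<close> to the family whose value at
    \<open>a\<close> is the path part of \<open>a\<close> with its point \<open>i\<close> and the
    element \<open>g i (a i)\<close>.\<close>
  have "t \<cdot> i = j \<cdot> u"
  proof (rule push_ext[of f \<beta>])
    show "Pi f \<beta> \<cdot> (t \<cdot> i) = Pi f \<beta> \<cdot> (j \<cdot> u)"
      using comp_right_cong1[OF \<beta>t, of i] comp_right_cong1[OF \<beta>j, of u] \<kappa>i p1u by simp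
    fix m a assume [simp]: "m \<in> Arr C" "a \<in> Arr C" and m: "Cod C m = Dom C (j \<cdot> u)" "Dom C m = Dom C a"
      and a: "Cod C a = Dom C f" and fa: "f \<cdot> a = Pi f \<beta> \<cdot> ((j \<cdot> u) \<cdot> m)"
    have [simp]: "Cod C m = prod_obj C (Exp P) I" "Dom C m = Dom C a" "Cod C a = prod_obj C (Exp A) I"
      using m a by simp_all
    have fa_j: "f \<cdot> a = ?p1 \<cdot> (u \<cdot> m)"
      using fa comp_right_cong1[OF \<beta>j, of "u \<cdot> m"] by simp
    then have fa_\<zeta>: "f \<cdot> a = \<zeta> \<cdot> m"
      using comp_right_cong1[OF p1u, of m] by simp
    have fa_i: "f \<cdot> a = Pi f \<kappa> \<cdot> (i \<cdot> m)"
      using fa_\<zeta> comp_right_cong1[OF \<kappa>i, of m] by simp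
    have fa_j': "f \<cdot> a = Pi f \<beta> \<cdot> (j \<cdot> (u \<cdot> m))"
      using fa by simp
    \<comment> \<open>Lying over the same base forces \<open>m\<close> and \<open>a\<close> to carry
      the same point, so both are evaluated at one time.\<close>
    have snd_eq: "snd_I (Exp P) \<cdot> m = snd_I (Exp A) \<cdot> a"
    proof -
      have "snd_I (Exp X) \<cdot> (f \<cdot> a) = snd_I (Exp X) \<cdot> (\<zeta> \<cdot> m)" by (simp only: fa_\<zeta>)
      then show ?thesis by simp
    qed
    define K where "K = App f \<kappa> (i \<cdot> m) a"
    have K [simp]: "K \<in> Arr C" "Dom C K = Dom C a" "Cod C K = prod_obj C (Exp B) I"
      and \<kappa>K: "\<kappa> \<cdot> K = a" and snd_K: "snd_I (Exp B) \<cdot> K = snd_I (Exp A) \<cdot> a"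
      using App_typing[of f \<kappa> "i \<cdot> m" a] App_\<kappa>[of "i \<cdot> m" a] fa_i by (simp_all add: K_def)
    define L where "L = App f \<beta> (j \<cdot> (u \<cdot> m)) a"
    have L [simp]: "L \<in> Arr C" "Dom C L = Dom C a" "Cod C L = pb_obj C ev\<^sub>A q" and \<beta>L: "\<beta> \<cdot> L = a"
      using App_typing[of f \<beta> "j \<cdot> (u \<cdot> m)" a] fa_j' by (simp_all add: L_def)
    have "d \<cdot> K = L"
    proof (rule pb_ext[of ev\<^sub>A q])
      show "\<beta> \<cdot> (d \<cdot> K) = \<beta> \<cdot> L"
        using comp_right_cong1[OF \<beta>d, of K] \<kappa>K \<beta>L by simp
      have "?q2 \<cdot> (d \<cdot> K) = ?ev\<^sub>B \<cdot> K"
        by (rule comp_right_cong1[OF q2d]) simp_all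
      also have "\<dots> = ap B (fst_I (Exp B) \<cdot> K) (snd_I (Exp A) \<cdot> a)"
        by (simp add: eval_comp snd_K)
      also have "\<dots> = App p q (ap P (fst_I (Exp P) \<cdot> m) (snd_I (Exp A) \<cdot> a)) (ap A (fst_I (Exp A) \<cdot> a) (snd_I (Exp A) \<cdot> a))"
        unfolding K_def using fa_\<zeta> by (intro i_App) simp_all
      also have "\<dots> = App p q (?ev\<^sub>P \<cdot> m) (ev\<^sub>A \<cdot> a)"
        by (simp add: eval_comp snd_eq)
      also have "?ev\<^sub>P \<cdot> m = ?p2 \<cdot> (u \<cdot> m)"
        by (rule comp_right_cong1[OF p2u, symmetric]) simp_all
      also have "App p q (?p2 \<cdot> (u \<cdot> m)) (ev\<^sub>A \<cdot> a) = ?q2 \<cdot> L"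
        unfolding L_def using fa_j by (intro j_App[symmetric]) simp_all
      finally show "?q2 \<cdot> (d \<cdot> K) = ?q2 \<cdot> L" .
    qed simp_all
    then show "App f \<beta> ((t \<cdot> i) \<cdot> m) a = App f \<beta> ((j \<cdot> u) \<cdot> m) a"
      using fa_i App_t[of "i \<cdot> m" a] by (simp add: K_def L_def)
  qed simp_all
  \<comment> \<open>Both composites give \<open>a \<mapsto> h (s (x, i, a)) i\<close> over the base:
    \<open>u\<close> evaluates at the point of the base, and there \<open>transport\<close> is
    \<open>lift\<close>.\<close>
  moreover have "u \<cdot> r = v \<cdot> t"
  proof (rule pb_ext[of ev\<^sub>X \<pi>])
    have p1ur: "?p1 \<cdot> (u \<cdot> r) = Pi f \<kappa>" and p1vt: "?p1 \<cdot> (v \<cdot> t) = Pi f \<kappa>"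
      using comp_right_cong1[OF p1u, of r] comp_right_cong1[OF p1v, of t] \<zeta>r \<beta>t by simp_all
    then show "?p1 \<cdot> (u \<cdot> r) = ?p1 \<cdot> (v \<cdot> t)" by simp
    show "?p2 \<cdot> (u \<cdot> r) = ?p2 \<cdot> (v \<cdot> t)"
    proof (rule push_ext[of p q])
      have over_u: "\<pi> \<cdot> (?p2 \<cdot> (u \<cdot> r)) = ev\<^sub>X \<cdot> (?p1 \<cdot> (u \<cdot> r))"
        by (rule comp_right_cong[OF pb_comm[symmetric]]) simp_all
      have over_v: "\<pi> \<cdot> (?p2 \<cdot> (v \<cdot> t)) = ev\<^sub>X \<cdot> (?p1 \<cdot> (v \<cdot> t))"
        by (rule comp_right_cong[OF pb_comm[symmetric]]) simp_all
      show "\<pi> \<cdot> (?p2 \<cdot> (u \<cdot> r)) = \<pi> \<cdot> (?p2 \<cdot> (v \<cdot> t))"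
        unfolding over_u over_v p1ur p1vt by (rule refl)
      fix m a assume [simp]: "m \<in> Arr C" "a \<in> Arr C" and m: "Cod C m = Dom C (?p2 \<cdot> (v \<cdot> t))" "Dom C m = Dom C a"
        and [simp]: "Cod C a = A" and pa: "p \<cdot> a = \<pi> \<cdot> ((?p2 \<cdot> (v \<cdot> t)) \<cdot> m)"
      have [simp]: "Cod C m = Dom C (Pi f \<kappa>)" "Dom C m = Dom C a"
        using m by simp_all
      define y where "y = Pi f \<kappa> \<cdot> m"
      have y [simp]: "y \<in> Arr C" "Dom C y = Dom C a" "Cod C y = prod_obj C (Exp X) I"
        by (simp_all add: y_def)
      have "\<pi> \<cdot> ((?p2 \<cdot> (v \<cdot> t)) \<cdot> m) = (\<pi> \<cdot> (?p2 \<cdot> (v \<cdot> t))) \<cdot> m"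
        by simp
      also have "\<dots> = ev\<^sub>X \<cdot> y"
        unfolding over_v p1vt y_def by (rule comp_assoc) simp_all
      finally have pa_y: "p \<cdot> a = ev\<^sub>X \<cdot> y"
        using pa by simp
      then have pa_ap: "p \<cdot> a = ap X (fst_I (Exp X) \<cdot> y) (snd_I (Exp X) \<cdot> y)"
        by (simp add: eval_comp)
      note l = lift[OF y(1) \<open>a \<in> Arr C\<close> y(3) \<open>Cod C a = A\<close> y(2) pa_y]
      have tr: "transport y (snd_I (Exp X) \<cdot> y) a = lift y a"
        using pa_ap by (intro transport(7)) simp_all
      have fl: "f \<cdot> lift y a = Pi f \<kappa> \<cdot> m"
        using l(4) by (simp only: y_def)
      have lm: "f \<in> Arr C" "\<kappa> \<in> Arr C" "Cod C \<kappa> = Dom C f" "Cod C m = Dom C (Pi f \<kappa>)" "Cod C (lift y a) = Dom C f"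
          "Dom C m = Dom C (lift y a)"
        using l(2,3) by simp_all
      define K where "K = App f \<kappa> m (lift y a)"
      have K [simp]: "K \<in> Arr C" "Dom C K = Dom C a" "Cod C K = prod_obj C (Exp B) I"
        using App_typing[OF lm(1-3) \<open>m \<in> Arr C\<close> l(1) lm(4-6) fl] l(2) by (simp_all add: K_def)
      have snd_K: "snd_I (Exp B) \<cdot> K = snd_I (Exp X) \<cdot> y"
        unfolding K_def App_\<kappa>(1)[OF \<open>m \<in> Arr C\<close> l(1) lm(4) l(3) lm(6) fl] by (rule l(6))
      have "snd_I (Exp P) \<cdot> (r \<cdot> m) = snd_I (Exp X) \<cdot> y"
      proof -
        have "snd_I (Exp X) \<cdot> (\<zeta> \<cdot> (r \<cdot> m)) = snd_I (Exp X) \<cdot> y"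
          using comp_right_cong1[OF \<zeta>r, of m] by (simp add: y_def del: times_I_proj_comp)
        then show ?thesis by simp
      qed
      then have "?p2 \<cdot> (u \<cdot> (r \<cdot> m)) = ap P (fst_I (Exp P) \<cdot> (r \<cdot> m)) (snd_I (Exp X) \<cdot> y)"
        using comp_right_cong1[OF p2u, of "r \<cdot> m"] by (simp add: eval_comp)
      then have "App p q (?p2 \<cdot> (u \<cdot> (r \<cdot> m))) a = ap B (fst_I (Exp B) \<cdot> K) (snd_I (Exp X) \<cdot> y)"
        using r_App[of m a "snd_I (Exp X) \<cdot> y"] pa_ap tr by (simp add: K_def flip: y_def)
      also have "\<dots> = ?ev\<^sub>B \<cdot> K"
        by (simp add: eval_comp snd_K)
      also have "\<dots> = ?q2 \<cdot> (d \<cdot> K)"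
        by (rule comp_right_cong1[OF q2d, symmetric]) simp_all
      also have "d \<cdot> K = App f \<beta> (t \<cdot> m) (lift y a)"
        unfolding K_def by (rule App_t[OF \<open>m \<in> Arr C\<close> l(1) lm(4) l(3) lm(6) fl, symmetric])
      also have "?q2 \<cdot> App f \<beta> (t \<cdot> m) (lift y a) = App p q (?p2 \<cdot> (v \<cdot> (t \<cdot> m))) a"
      proof -
        have "Pi f \<beta> \<cdot> (t \<cdot> m) = y"
          unfolding y_def by (rule comp_right_cong1[OF \<beta>t]) simp_all
        then show ?thesis
          using v_App[of "t \<cdot> m" a] pa_y by simp
      qed
      finally show "App p q ((?p2 \<cdot> (u \<cdot> r)) \<cdot> m) a = App p q ((?p2 \<cdot> (v \<cdot> t)) \<cdot> m) a"
        by simp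
    qed simp_all
  qed simp_all
  \<comment> \<open>The time \<open>k\<close> is now generic. Since \<open>r\<close> applies the
    family to the transported path and \<open>i\<close> evaluates that path at \<open>k\<close>, the
    claim reduces to its value \<open>a\<close> at \<open>k\<close>.\<close>
  moreover have "r \<cdot> i = Ident C (Dom C u)"
  proof (rule prod_ext[of "Exp P" I])
    have \<zeta>ri: "\<zeta> \<cdot> (r \<cdot> i) = \<zeta>"
      using comp_right_cong1[OF \<zeta>r, of i] \<kappa>i by simp
    then have "snd_I (Exp X) \<cdot> (\<zeta> \<cdot> (r \<cdot> i)) = snd_I (Exp X) \<cdot> \<zeta>"
      and fst_ri: "fst_I (Exp X) \<cdot> (\<zeta> \<cdot> (r \<cdot> i)) = fst_I (Exp X) \<cdot> \<zeta>" by (simp_all only:)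
    then show "snd_I (Exp P) \<cdot> (r \<cdot> i) = snd_I (Exp P) \<cdot> Ident C (Dom C u)"
      by simp
    let ?Z = "prod_obj C (Exp P) I"
    let ?g = "fst_I (Exp P) \<cdot> (r \<cdot> i)"
    have exp_g: "exp_map \<pi> \<cdot> ?g = exp_map \<pi> \<cdot> fst_I (Exp P)"
      using fst_ri by simp
    show "fst_I (Exp P) \<cdot> (r \<cdot> i) = fst_I (Exp P) \<cdot> Ident C (Dom C u)"
    proof (rule exp_ext[of P _ _ ?Z])
      let ?n = "fst_I ?Z" and ?k = "snd_I ?Z"
      have "ap P (?g \<cdot> ?n) ?k = ap P (fst_I (Exp P) \<cdot> ?n) ?k"
      proof (rule push_ext[of p q])
        have "exp_map \<pi> \<cdot> (?g \<cdot> ?n) = exp_map \<pi> \<cdot> (fst_I (Exp P) \<cdot> ?n)"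
          by (rule comp_right_cong[OF exp_g]) simp_all
        then have "ap X (exp_map \<pi> \<cdot> (?g \<cdot> ?n)) ?k = ap X (exp_map \<pi> \<cdot> (fst_I (Exp P) \<cdot> ?n)) ?k"
          by (simp only:)
        then show "\<pi> \<cdot> ap P (?g \<cdot> ?n) ?k = \<pi> \<cdot> ap P (fst_I (Exp P) \<cdot> ?n) ?k"
          by simp
        fix m a assume [simp]: "m \<in> Arr C" "a \<in> Arr C"
          and m: "Cod C m = Dom C (ap P (fst_I (Exp P) \<cdot> ?n) ?k)" "Dom C m = Dom C a"
          and [simp]: "Cod C a = A" and pa: "p \<cdot> a = \<pi> \<cdot> (ap P (fst_I (Exp P) \<cdot> ?n) ?k \<cdot> m)"
        have [simp]: "Cod C m = prod_obj C ?Z I" "Dom C m = Dom C a"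
          using m by simp_all
        define x where "x = ?n \<cdot> m"
        define k where "k = ?k \<cdot> m"
        have x [simp]: "x \<in> Arr C" "Dom C x = Dom C a" "Cod C x = ?Z"
          and k [simp]: "k \<in> Arr C" "Dom C k = Dom C a" "Cod C k = I"
          by (simp_all add: x_def k_def)
        define y where "y = \<zeta> \<cdot> x"
        have y [simp]: "y \<in> Arr C" "Dom C y = Dom C a" "Cod C y = prod_obj C (Exp X) I"
          by (simp_all add: y_def)
        have \<kappa>ix: "Pi f \<kappa> \<cdot> (i \<cdot> x) = y"
          unfolding y_def by (rule comp_right_cong1[OF \<kappa>i]) simp_all
        have pa_ap: "p \<cdot> a = ap X (fst_I (Exp X) \<cdot> y) k"
          using pa by (simp add: y_def flip: x_def k_def)
        note tr = transport(1-5)[OF y(1) k(1) \<open>a \<in> Arr C\<close> y(3) k(3) \<open>Cod C a = A\<close> y(2) k(2) pa_ap]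
        have "App p q (ap P (fst_I (Exp P) \<cdot> (r \<cdot> (i \<cdot> x))) k) a
            = ap B (fst_I (Exp B) \<cdot> App f \<kappa> (i \<cdot> x) (transport y k a)) k"
          using r_App[of "i \<cdot> x" a k] pa_ap by (simp add: \<kappa>ix)
        also have "\<dots> = App p q (ap P (fst_I (Exp P) \<cdot> x) k) (ap A (fst_I (Exp A) \<cdot> transport y k a) k)"
          using tr(1-4) by (intro i_App) (simp_all flip: y_def)
        also have "ap A (fst_I (Exp A) \<cdot> transport y k a) k = a"
          by (rule tr(5))
        finally show "App p q (ap P (?g \<cdot> ?n) ?k \<cdot> m) a = App p q (ap P (fst_I (Exp P) \<cdot> ?n) ?k \<cdot> m) a"
          by (simp flip: x_def k_def)
      qed simp_all
      then show "ap P (?g \<cdot> ?n) ?k = ap P ((fst_I (Exp P) \<cdot> Ident C (Dom C u)) \<cdot> ?n) ?k"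
        by simp
    qed simp_all
  qed simp_all
  \<comment> \<open>Lifting \<open>a\<close> and evaluating the lifted path at its own point returns
    \<open>a\<close>, so the two restrictions cancel.\<close>
  moreover have "v \<cdot> j = Ident C (Cod C u)"
  proof (rule pb_ext[of ev\<^sub>X \<pi>])
    have p1vj: "?p1 \<cdot> (v \<cdot> j) = ?p1"
      using comp_right_cong1[OF p1v, of j] \<beta>j by simp
    then show "?p1 \<cdot> (v \<cdot> j) = ?p1 \<cdot> Ident C (Cod C u)"
      by simp
    show "?p2 \<cdot> (v \<cdot> j) = ?p2 \<cdot> Ident C (Cod C u)"
    proof (rule push_ext[of p q])
      have "\<pi> \<cdot> (?p2 \<cdot> (v \<cdot> j)) = ev\<^sub>X \<cdot> (?p1 \<cdot> (v \<cdot> j))"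
        by (rule comp_right_cong[OF pb_comm[symmetric]]) simp_all
      then show "\<pi> \<cdot> (?p2 \<cdot> (v \<cdot> j)) = \<pi> \<cdot> (?p2 \<cdot> Ident C (Cod C u))"
        unfolding p1vj by (simp add: pb_comm)
      fix m a assume [simp]: "m \<in> Arr C" "a \<in> Arr C"
        and m: "Cod C m = Dom C (?p2 \<cdot> Ident C (Cod C u))" "Dom C m = Dom C a"
        and [simp]: "Cod C a = A" and pa: "p \<cdot> a = \<pi> \<cdot> ((?p2 \<cdot> Ident C (Cod C u)) \<cdot> m)"
      have [simp]: "Cod C m = pb_obj C ev\<^sub>X \<pi>" "Dom C m = Dom C a"
        using m by simp_all
      define x where "x = ?p1 \<cdot> m"
      have x [simp]: "x \<in> Arr C" "Dom C x = Dom C a" "Cod C x = prod_obj C (Exp X) I"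
        by (simp_all add: x_def)
      have "\<pi> \<cdot> (?p2 \<cdot> m) = ev\<^sub>X \<cdot> x"
        unfolding x_def by (rule comp_right_cong[OF pb_comm[symmetric]]) simp_all
      then have pa_x: "p \<cdot> a = ev\<^sub>X \<cdot> x"
        using pa by simp
      note l = lift[OF x(1) \<open>a \<in> Arr C\<close> x(3) \<open>Cod C a = A\<close> x(2) pa_x]
      have \<beta>jm: "Pi f \<beta> \<cdot> (j \<cdot> m) = x"
        unfolding x_def by (rule comp_right_cong1[OF \<beta>j]) simp_all
      have "App p q (?p2 \<cdot> (v \<cdot> (j \<cdot> m))) a = ?q2 \<cdot> App f \<beta> (j \<cdot> m) (lift x a)"
        using v_App[of "j \<cdot> m" a] pa_x by (simp add: \<beta>jm)
      also have "\<dots> = App p q (?p2 \<cdot> m) (ev\<^sub>A \<cdot> lift x a)"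
        using l(1-4) by (intro j_App) (simp_all flip: x_def)
      also have "ev\<^sub>A \<cdot> lift x a = a"
        by (rule l(5))
      finally show "App p q ((?p2 \<cdot> (v \<cdot> j)) \<cdot> m) a = App p q ((?p2 \<cdot> Ident C (Cod C u)) \<cdot> m) a"
        by simp
    qed simp_all
  qed simp_all
  ultimately show ?thesis
    unfolding arrow_retract_def u_def[symmetric] d_def[symmetric] t_def[symmetric]
    by (intro conjI bexI[of _ i] bexI[of _ j] bexI[of _ r] bexI[of _ v]) (simp_all add: in_hom_iff)
qed

end

theorem theorem4p5:
  fixes E :: "('o, 'm) category" and I :: 'o and T :: "'m set" and p q :: 'm
  assumes "locally_cartesian_closed E"
    and "I \<in> Obj E"
    and "T \<subseteq> Arr E"
    and sections: "\<forall>t\<in>T. has_section E t"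
    and pushforwards: "\<forall>f\<in>Arr E. \<forall>(r, g)\<in>Arr (slice E (Dom E f)).
      r \<in> T \<longrightarrow> fst (amap (pushforward E f) (r, g)) \<in> T"
    and retracts: "\<forall>t\<in>T. \<forall>u. arrow_retract E u t \<longrightarrow> u \<in> T"
    and "Cod E q = Dom E p"
    and "fibration E I T p"
    and "fibration E I T q"
  shows "fibration E I T (omap (pushforward E p) q)"
proof -
  interpret lccc_interval E I
    using assms(1,2)
    by (simp add: lccc_interval_def lccc_interval_axioms_def lccc_def lccc_axioms_def locally_cartesian_closed_def)
  have p: "p \<in> Arr E" "delta_imp E I p \<in> T" and q: "q \<in> Arr E" and dq: "delta_imp E I q \<in> T"
    using assms(8,9) by (simp_all add: fibration_def)
  obtain s where "s \<in> hom E (Cod E (delta_imp E I p)) (Dom E (delta_imp E I p))"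
    "delta_imp E I p \<cdot>\<^bsub>E\<^esub> s = Ident E (Cod E (delta_imp E I p))"
    using sections p(2) unfolding has_section_def by blast
  then interpret pushforward_setup E I p q s
    using p(1) q assms(7) by unfold_locales (simp_all add: in_hom_iff delta_imp)
  have f: "f \<in> Arr E" by simp
  \<comment> \<open>Stability under pushforward is used along \<open>f\<close>, the map on path
    objects, rather than along \<open>p\<close>.\<close>
  have "(delta_imp E I q, \<beta>) \<in> Arr (slice E (Dom E f))"
    by (simp add: delta_imp)
  from bspec[OF bspec[OF pushforwards f] this]
  have "fst (amap (pushforward E f) (delta_imp E I q, \<beta>)) \<in> T"
    using dq by simp
  then have "delta_imp E I \<pi> \<in> T"
    using retracts pushforward_retract by blast
  then show ?thesis
    by (simp add: fibration_def)
qed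

end
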